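(* Let $X$ be a complex Banach function space with absolutely continuous norm, let $s\in[1,\infty]$, and let $A$ be an $\mathcal R_s$-sectorial operator in $X$, injective and with dense domain and dense range. Let $\sigma>\omega_{\mathcal R_s}(A)$ and $\varphi,\psi\in\Phi^\Sigma_{\sigma,0}$. Then there is a constant $C>0$ such that for all $f\in H^\infty(\Sigma_\sigma)$ and all $x\in X$ $$\Big\|\Big(\sum_{j\in\mathbb Z}|f(A)\varphi(2^jA)x|^s\Big)^{1/s}\Big\|_X\le C\,\|f\|_{\infty,\sigma}\,\Big\|\Big(\sum_{j\in\mathbb Z}|\psi(2^jA)x|^s\Big)^{1/s}\Big\|_X$$ (with sums replaced by suprema over $j\in\mathbb Z$ if $s=\infty$; the expressions are elements of $[0,\infty]$).
   Context: **Banach function spaces.** Let $(\Omega,\mu)$ be a $\sigma$-finite measure space with a fixed increasing sequence $(\Omega_n)_{n\in\mathbb N}$ of measurable sets of finite measure with union $\Omega$; a measurable set is bounded if it is contained in some $\Omega_n$. A Banach function norm is a map $\rho$ from the ($\mu$-a.e. classes of) measurable functions $\Omega\to[0,\infty]$ to $[0,\infty]$ with: $\rho(f)=0$ iff $f=0$ a.e., $\rho(\alpha f)=\alpha\rho(f)$ for $\alpha>0$, $\rho(f+g)\le\rho(f)+\rho(g)$; $0\le g\le f$ a.e. implies $\rho(g)\le\rho(f)$; $0\le f_n\nearrow f$ a.e. implies $\rho(f_n)\nearrow\rho(f)$; $\rho(\mathbf 1_M)<\infty$ for $M$ bounded; for each bounded $M$ there is $C_M$ with $\int_Mf\,d\mu\le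 C_M\rho(f)$ for all $f$. The complex Banach function space is $X=\{f:\Omega\to\mathbb C\text{ measurable}:\rho(|f|)<\infty\}$ with $\|f\|_X=\rho(|f|)$ (and we write $\|f\|_X=\infty$ if $\rho(|f|)=\infty$). It has absolutely continuous norm if $\|f\mathbf 1_{M_n}\|_X\to0$ whenever $f\in X$ and $(M_n)$ is a decreasing sequence of measurable sets with $\mathbf 1_{M_n}\to0$ a.e. **$\mathcal R_s$-boundedness.** $\mathcal T\subseteq L(X)$ is $\mathcal R_s$-bounded if there is $C>0$ with $\|(\sum_{j=1}^n|T_jx_j|^s)^{1/s}\|_X\le C\|(\sum_{j=1}^n|x_j|^s)^{1/s}\|_X$ for all $n\in\mathbb N$, $T_j\in\mathcal T$, $x_j\in X$ (suprema over $j$ instead of sums if $s=\infty$). **Sectors and operators.** $\Sigma_\sigma=\{z\in\mathbb C\setminus(-\infty,0]:|\arg z|<\sigma\}$ for $\sigma\in(0,\pi]$, $\Sigma_0=(0,\infty)$. $A$ is $\mathcal R_s$-sectorial if there is $\omega\in[0,\pi)$ with $\sigma(A)\subseteq\overline\Sigma_\omega$ and $\{zR(z,A):z\in\mathbb C\setminus\overline\Sigma_\sigma\}$ $\mathcal R_s$-bounded for every $\sigma\in(\omega,\pi)$; $\omega_{\mathcal R_s}(A)$ is the infimum of such $\omega$. **Functional calculus.** $H^\infty(\Sigma_\sigma)$: bounded analytic functions on $\Sigma_\sigma$ with norm $\|f\|_{\infty,\sigma}=\sup_{\Sigma_\sigma}|f|$. $H_0^\infty(\Sigma_\sigma)$: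 those with $\sup_{z\in\Sigma_\sigma}(|z|^\varepsilon\vee|z|^{-\varepsilon})|f(z)|<\infty$ for some $\varepsilon>0$. For $\varphi\in H_0^\infty(\Sigma_\sigma)$, $\varphi(A)=\frac1{2\pi i}\int_{\partial\Sigma_\omega}\varphi(\lambda)R(\lambda,A)\,d\lambda$, $\omega\in(\omega_{\mathcal R_s}(A),\sigma)$ ($\sigma(A)$ lying to the left of the contour); $\varphi(tA)=(\varphi(t\,\cdot))(A)$. For $f\in H^\infty(\Sigma_\sigma)$ and $\rho(z)=z(1+z)^{-2}$, $f(A)=\rho(A)^{-1}(\rho f)(A)$ is a closed operator, and $f(A)\varphi(2^jA)=(f\cdot\varphi(2^j\,\cdot))(A)\in L(X)$ for $\varphi\in H_0^\infty(\Sigma_\sigma)$. $\mathcal E(\Sigma_\sigma)=H_0^\infty(\Sigma_\sigma)\oplus\mathbb C\frac1{1+z}\oplus\mathbb C\mathbf 1$; its elements have limits $f(0),f(\infty)$ at $0$ and $\infty$. **The class $\Phi^\Sigma_{\sigma,0}$** is the set of $\varphi\in H_0^\infty(\Sigma_\sigma)$ with $0\notin\varphi(\Sigma_\sigma)$ for which there are $d\in\mathbb Z$ and a set $\mathcal F\subseteq\mathcal E(\Sigma_\sigma)$ such that for some $\varepsilon>0$ $$\sup_{f\in\mathcal F}\|f\|_{\infty,\sigma}<\infty,\qquad \sup_{f\in\mathcal F}\sup_{z\in\Sigma_\sigma}(|z|^\varepsilon\vee|z|^{-\varepsilon})\Big|f(z)-\frac{f(0)+f(\infty)z}{1+z}\Big|<\infty,$$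 and $\{\varphi(2^jt\,\cdot)/\varphi(2^{j-d}\,\cdot),\ \varphi(2^{j+d}\,\cdot)/\varphi(2^jt\,\cdot): j\in\mathbb Z,\ t\in[1,2]\}\subseteq\{f(r\,\cdot):f\in\mathcal F,\ r>0\}$. *)

theory Defs
  imports "HOL-Analysis.Analysis"
begin

section \<open>Complex Banach spaces\<close>

class complex_banach = banach +
  fixes scaleC :: "complex \<Rightarrow> 'a \<Rightarrow> 'a"  (infixr "*\<^sub>C" 75)
  assumes scaleC_add_right: "c *\<^sub>C (x + y) = c *\<^sub>C x + c *\<^sub>C y"
    and scaleC_add_left: "(c + d) *\<^sub>C x = c *\<^sub>C x + d *\<^sub>C x"
    and scaleC_scaleC: "c *\<^sub>C d *\<^sub>C x = (c * d) *\<^sub>C x"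
    and scaleC_of_real: "complex_of_real r *\<^sub>C x = r *\<^sub>R x"
    and norm_scaleC: "norm (c *\<^sub>C x) = cmod c * norm x"

definition bounded_clinear :: "('x::complex_banach \<Rightarrow> 'x) \<Rightarrow> bool" where
  "bounded_clinear T \<longleftrightarrow> bounded_linear T \<and> (\<forall>c x. T (c *\<^sub>C x) = c *\<^sub>C T x)"


section \<open>Banach function spaces\<close>

locale banach_function_norm =
  fixes M :: "'a measure" and \<Omega> :: "nat \<Rightarrow> 'a set" and \<rho> :: "('a \<Rightarrow> ennreal) \<Rightarrow> ennreal"
  assumes exhaust_sets: "\<Omega> n \<in> sets M"
    and exhaust_finite: "emeasure M (\<Omega> n) < \<infinity>"
    and exhaust_incseq: "incseq \<Omega>"
    and exhaust_Union: "(\<Union>n. \<Omega> n) = space M"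
    and rho_eq_0_iff: "f \<in> borel_measurable M \<Longrightarrow> \<rho> f = 0 \<longleftrightarrow> (AE \<xi> in M. f \<xi> = 0)"
    and rho_scale: "f \<in> borel_measurable M \<Longrightarrow> 0 < r \<Longrightarrow> \<rho> (\<lambda>\<xi>. ennreal r * f \<xi>) = ennreal r * \<rho> f"
    and rho_triangle: "f \<in> borel_measurable M \<Longrightarrow> g \<in> borel_measurable M \<Longrightarrow>
          \<rho> (\<lambda>\<xi>. f \<xi> + g \<xi>) \<le> \<rho> f + \<rho> g"
    and rho_mono: "f \<in> borel_measurable M \<Longrightarrow> g \<in> borel_measurable M \<Longrightarrow>
          (AE \<xi> in M. g \<xi> \<le> f \<xi>) \<Longrightarrow> \<rho> g \<le> \<rho> f"
    and rho_Fatou: "(\<And>n. F n \<in> borel_measurable M) \<Longrightarrow> f \<in> borel_measurable M \<Longrightarrow>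
          (AE \<xi> in M. incseq (\<lambda>n. F n \<xi>) \<and> (\<lambda>n. F n \<xi>) \<longlonglongrightarrow> f \<xi>) \<Longrightarrow>
          (\<lambda>n::nat. \<rho> (F n)) \<longlonglongrightarrow> \<rho> f"
    and rho_indicator: "B \<in> sets M \<Longrightarrow> B \<subseteq> \<Omega> n \<Longrightarrow> \<rho> (indicator B) < \<infinity>"
    and rho_local_L1: "B \<in> sets M \<Longrightarrow> B \<subseteq> \<Omega> n \<Longrightarrow>
          \<exists>C::real. \<forall>f\<in>borel_measurable M. (\<integral>\<^sup>+\<xi>\<in>B. f \<xi> \<partial>M) \<le> ennreal C * \<rho> f"

text \<open>
  The space of all measurable \<open>f\<close> with \<open>\<rho> \<bar>f\<bar> < \<infinity>\<close>, modulo equality almost everywhere, is carried by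
  the type \<open>'x\<close>; \<open>rep x\<close> is a representative of the class \<open>x\<close>. Its values on single points carry no
  information, so \<open>rep\<close> is linear only almost everywhere. Injectivity modulo null sets follows from
  \<open>norm_rep\<close> and \<open>rho_eq_0_iff\<close>; the completeness contained in the sort of \<open>'x\<close> is no additional
  assumption, being a consequence of the Fatou property \<open>rho_Fatou\<close>.
\<close>

locale complex_banach_function_space = banach_function_norm M \<Omega> \<rho>
  for M :: "'a measure" and \<Omega> :: "nat \<Rightarrow> 'a set" and \<rho> :: "('a \<Rightarrow> ennreal) \<Rightarrow> ennreal" +
  fixes rep :: "'x::complex_banach \<Rightarrow> 'a \<Rightarrow> complex"
  assumes rep_measurable: "rep x \<in> borel_measurable M"
    and rep_add: "AE \<xi> in M. rep (x + y) \<xi> = rep x \<xi> + rep y \<xi>"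
    and rep_scaleC: "AE \<xi> in M. rep (c *\<^sub>C x) \<xi> = c * rep x \<xi>"
    and norm_rep: "ennreal (norm x) = \<rho> (\<lambda>\<xi>. ennreal (cmod (rep x \<xi>)))"
    and rep_surj: "f \<in> borel_measurable M \<Longrightarrow> \<rho> (\<lambda>\<xi>. ennreal (cmod (f \<xi>))) < \<infinity> \<Longrightarrow>
          \<exists>x. AE \<xi> in M. rep x \<xi> = f \<xi>"

definition absolutely_continuous_norm ::
  "'a measure \<Rightarrow> (('a \<Rightarrow> ennreal) \<Rightarrow> ennreal) \<Rightarrow> ('x::complex_banach \<Rightarrow> 'a \<Rightarrow> complex) \<Rightarrow> bool" where
  "absolutely_continuous_norm M \<rho> rep \<longleftrightarrow>
     (\<forall>x B. (\<forall>n. B n \<in> sets M) \<and> decseq B \<and>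
            (AE \<xi> in M. (\<lambda>n. indicator (B n) \<xi> :: real) \<longlonglongrightarrow> 0) \<longrightarrow>
        (\<lambda>n::nat. \<rho> (\<lambda>\<xi>. ennreal (cmod (rep x \<xi> * indicator (B n) \<xi>)))) \<longlonglongrightarrow> 0)"


section \<open>\<open>R_s\<close>-boundedness\<close>

definition ennpowr :: "ennreal \<Rightarrow> real \<Rightarrow> ennreal" where
  "ennpowr a p = (if a = \<infinity> then \<infinity> else ennreal (enn2real a powr p))"

definition ls_norm :: "ennreal \<Rightarrow> 'i set \<Rightarrow> ('i \<Rightarrow> complex) \<Rightarrow> ennreal" where
  "ls_norm s I a =
     (if s = \<infinity> then (SUP j\<in>I. ennreal (cmod (a j)))
      else ennpowr (\<integral>\<^sup>+j. ennreal (cmod (a j) powr enn2real s) \<partial>count_space I) (1 / enn2real s))"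

definition mixed_norm :: "(('a \<Rightarrow> ennreal) \<Rightarrow> ennreal) \<Rightarrow> ('x \<Rightarrow> 'a \<Rightarrow> complex) \<Rightarrow> ennreal \<Rightarrow>
    'i set \<Rightarrow> ('i \<Rightarrow> 'x) \<Rightarrow> ennreal" where
  "mixed_norm \<rho> rep s I x = \<rho> (\<lambda>\<xi>. ls_norm s I (\<lambda>j. rep (x j) \<xi>))"

definition Rs_bounded :: "(('a \<Rightarrow> ennreal) \<Rightarrow> ennreal) \<Rightarrow> ('x::complex_banach \<Rightarrow> 'a \<Rightarrow> complex) \<Rightarrow> ennreal \<Rightarrow>
    ('x \<Rightarrow> 'x) set \<Rightarrow> bool" where
  "Rs_bounded \<rho> rep s \<T> \<longleftrightarrow>
     (\<forall>T\<in>\<T>. bounded_clinear T) \<and>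
     (\<exists>C>0. \<forall>(n::nat) T x. (\<forall>j<n. T j \<in> \<T>) \<longrightarrow>
        mixed_norm \<rho> rep s {..<n} (\<lambda>j. T j (x j)) \<le> ennreal C * mixed_norm \<rho> rep s {..<n} x)"


section \<open>Unbounded operators, sectoriality\<close>

text \<open>Unbounded operators are given by their graphs; domain and range are \<open>Domain\<close> and \<open>Range\<close>.\<close>

definition linear_operator :: "('x::complex_banach \<times> 'x) set \<Rightarrow> bool" where
  "linear_operator A \<longleftrightarrow> single_valued A \<and> (0, 0) \<in> A \<and>
     (\<forall>x y u v. (x, y) \<in> A \<and> (u, v) \<in> A \<longrightarrow> (x + u, y + v) \<in> A) \<and>
     (\<forall>c x y. (x, y) \<in> A \<longrightarrow> (c *\<^sub>C x, c *\<^sub>C y) \<in> A)"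

definition op_apply :: "('x \<times> 'x) set \<Rightarrow> 'x \<Rightarrow> 'x" where
  "op_apply A x = (THE y. (x, y) \<in> A)"

definition injective_operator :: "('x::complex_banach \<times> 'x) set \<Rightarrow> bool" where
  "injective_operator A \<longleftrightarrow> (\<forall>x. (x, 0) \<in> A \<longrightarrow> x = 0)"

definition resolvent :: "complex \<Rightarrow> ('x::complex_banach \<times> 'x) set \<Rightarrow> 'x \<Rightarrow> 'x" where
  "resolvent \<mu> A y = (THE x. \<exists>z. (x, z) \<in> A \<and> \<mu> *\<^sub>C x - z = y)"

definition op_spectrum :: "('x::complex_banach \<times> 'x) set \<Rightarrow> complex set" where
  "op_spectrum A = - {\<mu>. (\<forall>y. \<exists>!x. \<exists>z. (x, z) \<in> A \<and> \<mu> *\<^sub>C x - z = y) \<and>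
     bounded_clinear (resolvent \<mu> A)}"

definition sector :: "real \<Rightarrow> complex set" where
  "sector \<sigma> = (if \<sigma> = 0 then complex_of_real ` {0<..} else {z. z \<notin> \<real>\<^sub>\<le>\<^sub>0 \<and> \<bar>Arg z\<bar> < \<sigma>})"

definition Rs_sectorial_of_angle :: "(('a \<Rightarrow> ennreal) \<Rightarrow> ennreal) \<Rightarrow> ('x::complex_banach \<Rightarrow> 'a \<Rightarrow> complex) \<Rightarrow>
    ennreal \<Rightarrow> ('x \<times> 'x) set \<Rightarrow> real \<Rightarrow> bool" where
  "Rs_sectorial_of_angle \<rho> rep s A \<omega> \<longleftrightarrow>
     0 \<le> \<omega> \<and> \<omega> < pi \<and> op_spectrum A \<subseteq> closure (sector \<omega>) \<and>
     (\<forall>\<sigma>. \<omega> < \<sigma> \<and> \<sigma> < pi \<longrightarrow>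
        Rs_bounded \<rho> rep s ((\<lambda>z x. z *\<^sub>C resolvent z A x) ` (- closure (sector \<sigma>))))"

definition Rs_sectorial :: "(('a \<Rightarrow> ennreal) \<Rightarrow> ennreal) \<Rightarrow> ('x::complex_banach \<Rightarrow> 'a \<Rightarrow> complex) \<Rightarrow>
    ennreal \<Rightarrow> ('x \<times> 'x) set \<Rightarrow> bool" where
  "Rs_sectorial \<rho> rep s A \<longleftrightarrow> linear_operator A \<and> (\<exists>\<omega>. Rs_sectorial_of_angle \<rho> rep s A \<omega>)"

definition Rs_angle :: "(('a \<Rightarrow> ennreal) \<Rightarrow> ennreal) \<Rightarrow> ('x::complex_banach \<Rightarrow> 'a \<Rightarrow> complex) \<Rightarrow>
    ennreal \<Rightarrow> ('x \<times> 'x) set \<Rightarrow> real" where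
  "Rs_angle \<rho> rep s A = Inf {\<omega>. Rs_sectorial_of_angle \<rho> rep s A \<omega>}"


section \<open>Functional calculus\<close>

text \<open>Functions on a sector are total functions whose values off the sector are irrelevant.\<close>

definition Hinf :: "real \<Rightarrow> (complex \<Rightarrow> complex) set" where
  "Hinf \<sigma> = {f. f holomorphic_on sector \<sigma> \<and> bounded (f ` sector \<sigma>)}"

definition Hinf_norm :: "real \<Rightarrow> (complex \<Rightarrow> complex) \<Rightarrow> real" where
  "Hinf_norm \<sigma> f = (SUP z\<in>sector \<sigma>. cmod (f z))"

definition Hinf0 :: "real \<Rightarrow> (complex \<Rightarrow> complex) set" where
  "Hinf0 \<sigma> = {f. f holomorphic_on sector \<sigma> \<and>
     (\<exists>\<epsilon>>0. \<exists>C. \<forall>z\<in>sector \<sigma>. max (cmod z powr \<epsilon>) (cmod z powr (- \<epsilon>)) * cmod (f z) \<le> C)}"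

definition E_class :: "real \<Rightarrow> (complex \<Rightarrow> complex) set" where
  "E_class \<sigma> = {f. \<exists>g\<in>Hinf0 \<sigma>. \<exists>a b. \<forall>z\<in>sector \<sigma>. f z = g z + a * (1 / (1 + z)) + b}"

definition lim_zero :: "real \<Rightarrow> (complex \<Rightarrow> complex) \<Rightarrow> complex" where
  "lim_zero \<sigma> f = Lim (at 0 within sector \<sigma>) f"

definition lim_infinity :: "real \<Rightarrow> (complex \<Rightarrow> complex) \<Rightarrow> complex" where
  "lim_infinity \<sigma> f = Lim (inf at_infinity (principal (sector \<sigma>))) f"

text \<open>
  The boundary of the sector of angle \<open>\<omega>\<close> consists of the rays \<open>t \<mapsto> exp (t + i\<omega>)\<close>, run through
  inwards, and \<open>t \<mapsto> exp (t - i\<omega>)\<close>, run through outwards (\<open>t\<close> real); the additional factor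
  \<open>\<mu> = d\<mu>/dt\<close> stems from this parametrisation.
\<close>

definition Hinf0_calc :: "('x::complex_banach \<times> 'x) set \<Rightarrow> real \<Rightarrow> (complex \<Rightarrow> complex) \<Rightarrow> 'x \<Rightarrow> 'x" where
  "Hinf0_calc A \<omega> \<phi> x =
     (let h = (\<lambda>\<mu>. (\<phi> \<mu> * \<mu>) *\<^sub>C resolvent \<mu> A x)
      in (1 / (2 * of_real pi * \<i>)) *\<^sub>C
           integral UNIV (\<lambda>t::real. h (exp (Complex t (- \<omega>))) - h (exp (Complex t \<omega>))))"

definition regularizer :: "complex \<Rightarrow> complex" where
  "regularizer z = z / (1 + z)\<^sup>2"

text \<open>The graph of \<open>regularizer(A)\<^sup>-\<^sup>1 (regularizer f)(A)\<close>.\<close>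

definition Hinf_calc :: "('x::complex_banach \<times> 'x) set \<Rightarrow> real \<Rightarrow> (complex \<Rightarrow> complex) \<Rightarrow> ('x \<times> 'x) set" where
  "Hinf_calc A \<omega> f =
     {(x, y). Hinf0_calc A \<omega> regularizer y = Hinf0_calc A \<omega> (\<lambda>z. regularizer z * f z) x}"

definition Phi_class :: "real \<Rightarrow> (complex \<Rightarrow> complex) set" where
  "Phi_class \<sigma> = {\<phi> \<in> Hinf0 \<sigma>. 0 \<notin> \<phi> ` sector \<sigma> \<and>
     (\<exists>(d::int) \<F>. \<F> \<subseteq> E_class \<sigma> \<and>
        (\<exists>\<epsilon>>0.
          (\<exists>C. \<forall>f\<in>\<F>. \<forall>z\<in>sector \<sigma>. cmod (f z) \<le> C) \<and>
          (\<exists>C. \<forall>f\<in>\<F>. \<forall>z\<in>sector \<sigma>. max (cmod z powr \<epsilon>) (cmod z powr (- \<epsilon>)) *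
                 cmod (f z - (lim_zero \<sigma> f + lim_infinity \<sigma> f * z) / (1 + z)) \<le> C) \<and>
          (\<forall>(j::int) t::real. t \<in> {1..2} \<longrightarrow>
            (\<exists>f\<in>\<F>. \<exists>r>0. \<forall>z\<in>sector \<sigma>.
               \<phi> (2 powi j * of_real t * z) / \<phi> (2 powi (j - d) * z) = f (of_real r * z)) \<and>
            (\<exists>f\<in>\<F>. \<exists>r>0. \<forall>z\<in>sector \<sigma>.
               \<phi> (2 powi (j + d) * z) / \<phi> (2 powi j * of_real t * z) = f (of_real r * z)))))}"

end

theory Submission
  imports Defs "HOL-Complex_Analysis.Complex_Analysis"
begin

text \<open>
  Only the nonvanishing of \<open>\<psi>\<close> and the bound \<open>\<bar>\<psi>(tz)\<bar> \<le> B \<bar>\<psi>(2\<^sup>-\<^sup>d z)\<bar>\<close> for \<open>t \<in> [1,2]\<close> are used of the class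
  of \<open>\<psi>\<close>. Normalise \<open>\<psi>\<^sup>*(z) = cnj (\<psi> (cnj z))\<close> such that \<open>\<integral>\<^sub>0\<^sup>\<infinity> \<psi>\<^sup>*(tz) \<psi>(tz) dt/t = 1\<close>; then
  \<open>\<eta>(2\<^sup>-\<^sup>d z) = \<psi>(2\<^sup>-\<^sup>d z)\<^sup>-\<^sup>1 \<integral>\<^sub>1\<^sup>2 \<psi>\<^sup>*(tz) \<psi>(tz) dt/t\<close> belongs to \<open>H\<^sub>0\<^sup>\<infinity>\<close> and \<open>\<Sum>\<^sub>k \<eta>(2\<^sup>k z) \<psi>(2\<^sup>k z) = 1\<close>.
  Hence \<open>f(A) \<phi>(2\<^sup>j A) x = \<Sum>\<^sub>k (f \<phi>(2\<^sup>j \<cdot>) \<eta>(2\<^sup>k \<cdot>))(A) \<psi>(2\<^sup>k A) x\<close>. Put \<open>k = j + l\<close> and dilate the contour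
  by \<open>2\<^sup>-\<^sup>j\<close>: for fixed \<open>l\<close> and fixed \<open>t\<close> on the contour, the \<open>j\<close>-th integrand is an operator
  \<open>\<lambda> R(\<lambda>, A)\<close> applied to \<open>\<psi>(2\<^sup>j\<^sup>+\<^sup>l A) x\<close>, with a scalar factor of size at most
  \<open>\<parallel>f\<parallel> \<bar>\<phi>(t)\<bar> \<bar>\<eta>(2\<^sup>l t)\<bar>\<close>. By \<open>R\<^sub>s\<close>-boundedness and Minkowski's inequality its norm is at most
  this factor times the right-hand side, and the factors are integrable in \<open>t\<close> and summable in \<open>l\<close>.
\<close>

section \<open>Integrals over horizontal lines\<close>

text \<open>All functions are studied in the coordinate \<open>w = log z\<close>: sectors become
  strips, rays horizontal lines, dilations translations, and membership in \<open>Hinf0\<close>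
  becomes decay like \<open>exp (- e * \<bar>Re w\<bar>)\<close>. The calculus is a gauge integral
  of a vector-valued function. Identities between its values are therefore tested on a separating
  set of complex-linear functionals, where scalar Cauchy theory applies; only norm estimates and
  convergence are done with vectors. The conjugate \<open>\<psi>\<^sup>*\<close> is chosen because
  \<open>\<psi>\<^sup>* \<psi>\<close> is the square of \<open>\<bar>\<psi>\<bar>\<close> on the
  positive axis, so that its integral is positive and can be normalised, and because the remaining
  factor \<open>\<psi>\<close> is controlled by its value at \<open>2^-d z\<close>, which allows the
  division that defines \<open>\<eta>\<close>. After the dilation the point on the contour depends
  on \<open>j\<close>, and so do the operators and the values of \<open>f\<close>. This is why
  \<open>R_s\<close>-boundedness of the whole family is used and why \<open>f\<close> enters only
  through its supremum. The sums over \<open>k\<close> and \<open>j\<close> are truncated first; the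
  truncation in \<open>k\<close> is removed by convergence in the space, that in \<open>j\<close> by
  the Fatou property.\<close>

abbreviation decay :: "real \<Rightarrow> real \<Rightarrow> real" where
  "decay e t \<equiv> exp (- e * \<bar>t\<bar>)"

lemma exp_decay_integrable:
  assumes "0 < e"
  shows "(\<lambda>t::real. decay e t) integrable_on UNIV"
proof -
  have 1: "((\<lambda>t::real. exp (- e * t)) has_integral exp (- e * 0) / e) {0..}"
    using assms by (rule has_integral_exp_minus_to_infinity)
  then have h: "(\<lambda>t. if t \<in> {0..} then exp (- e * t) else 0) integrable_on UNIV"
    by (simp only: integrable_restrict_UNIV has_integral_integrable)
  define h where "h = (\<lambda>t::real. if t \<in> {0..} then exp (- e * t) else 0)"
  have hU: "h integrable_on UNIV" using h unfolding h_def .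
  \<comment> \<open>The Cauchy criterion is invariant under reflection: balls around 0 are
    symmetric, so the radius \<open>B\<close> found for \<open>h\<close> also serves for
    \<open>h (- t)\<close>.\<close>
  have "(\<lambda>t. h (- t)) integrable_on UNIV"
  proof (subst integrable_alt, intro conjI allI impI)
    show "(\<lambda>x. if x \<in> UNIV then h (- x) else 0) integrable_on cbox a b" for a b
      using integrable_on_subcbox[OF hU, of "-b" "-a"] Henstock_Kurzweil_Integration.integrable_reflect_real[where f=h and a="-b" and b="-a"] by simp
    fix d :: real assume "d > 0"
    from integrable_altD(2)[OF hU this] obtain B where B: "B > 0" and
      *: "\<And>a b c d'. ball 0 B \<subseteq> cbox a b \<Longrightarrow> ball 0 B \<subseteq> cbox c d' \<Longrightarrow> norm (integral (cbox a b) h - integral (cbox c d') h) < d"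
      by (auto; blast)
    have refl: "ball 0 B \<subseteq> cbox (-b) (-a)" if "ball 0 B \<subseteq> cbox a b" for a b :: real
    proof
      fix x :: real assume "x \<in> ball 0 B"
      then have "- x \<in> ball 0 B" by simp
      then have "- x \<in> cbox a b" using that by blast
      then show "x \<in> cbox (-b) (-a)" by auto
    qed
    show "\<exists>B>0. \<forall>a b c d'. ball 0 B \<subseteq> cbox a b \<and> ball 0 B \<subseteq> cbox c d' \<longrightarrow>
      norm (integral (cbox a b) (\<lambda>x. if x \<in> UNIV then h (- x) else 0) -
        integral (cbox c d') (\<lambda>x. if x \<in> UNIV then h (- x) else 0)) < d"
      using B *[OF refl refl] by (intro exI[of _ B]) (auto simp: Henstock_Kurzweil_Integration.integral_reflect_real[where f="\<lambda>t. h (-t)", simplified, symmetric])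
  qed
  from integrable_add[OF hU this] have i: "(\<lambda>t. h t + h (- t)) integrable_on UNIV" .
  \<comment> \<open>At \<open>t = 0\<close> both halves contribute 1, so the sum is 2 there instead
    of \<open>decay e 0 = 1\<close>; hence the exceptional set \<open>{0}\<close>.\<close>
  show ?thesis
    by (rule integrable_spike[OF i, of "{0}"]) (auto simp: h_def)
qed

text \<open>Continuity gives integrability on compact intervals. For nested intervals the two
  integrals of \<open>h\<close> differ by the outer pieces, where \<open>h\<close> is dominated by
  \<open>g\<close>, so the Cauchy criterion passes from \<open>g\<close> to \<open>h\<close>.
  Completeness is all that is asked of the space of values.\<close>

lemma integrable_UNIV_dominated:
  fixes h :: "real \<Rightarrow> 'b::banach" and g :: "real \<Rightarrow> real"
  assumes h: "continuous_on UNIV h" and g: "g integrable_on UNIV"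
    and le: "\<And>t. norm (h t) \<le> g t"
  shows "h integrable_on UNIV"
proof -
  have hi: "h integrable_on {a..b}" for a b
    using h by (intro integrable_continuous_real) (auto intro: continuous_on_subset)
  have gi: "g integrable_on {a..b}" for a b
    using g by (rule integrable_on_subinterval) auto
  have bd: "norm (integral {a..b} h) \<le> integral {a..b} g" for a b
    by (rule integral_norm_bound_integral[OF hi gi le])
  have diff: "norm (integral {c..d} h - integral {a..b} h) \<le> integral {c..d} g - integral {a..b} g"
    if "c \<le> a" "a \<le> b" "b \<le> d" for a b c d
  proof -
    have "integral {c..d} f = integral {c..a} f + integral {a..b} f + integral {b..d} f"
      if "\<And>x y. f integrable_on {x..y}" for f :: "real \<Rightarrow> 'c::banach"
      using that \<open>c \<le> a\<close> \<open>a \<le> b\<close> \<open>b \<le> d\<close> Henstock_Kurzweil_Integration.integral_combine[where a=c and c=a and b=b and f=f] Henstock_Kurzweil_Integration.integral_combine[where a=c and c=b and b=d and f=f]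
      by simp
    note s = this[OF hi] this[OF gi]
    have "norm (integral {c..d} h - integral {a..b} h) = norm (integral {c..a} h + integral {b..d} h)"
      by (simp add: s)
    also have "\<dots> \<le> integral {c..a} g + integral {b..d} g"
      using bd[of c a] bd[of b d] norm_triangle_ineq order_trans add_mono by metis
    finally show ?thesis by (simp add: s)
  qed
  show ?thesis
  proof (subst integrable_alt_subset, intro conjI allI impI)
    show "(\<lambda>x. if x \<in> UNIV then h x else 0) integrable_on cbox a b" for a b :: real
      using hi by simp
    fix e :: real assume "e > 0"
    from integrable_alt_subset[THEN iffD1, OF g] \<open>e > 0\<close> obtain B where B: "B > 0"
      and *: "\<And>a b c d. ball 0 B \<subseteq> cbox a b \<Longrightarrow> cbox a b \<subseteq> cbox c d \<Longrightarrow>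
         norm (integral (cbox a b) g - integral (cbox c d) g) < e"
      by (auto; blast)
    show "\<exists>B>0. \<forall>a b c d. ball 0 B \<subseteq> cbox a b \<and> cbox a b \<subseteq> cbox c d \<longrightarrow>
       norm (integral (cbox a b) (\<lambda>x. if x \<in> UNIV then h x else 0) -
             integral (cbox c d) (\<lambda>x. if x \<in> UNIV then h x else 0)) < e"
    proof (intro exI[of _ B] conjI B allI impI, elim conjE)
      fix a b c d :: real assume ab: "ball 0 B \<subseteq> cbox a b" "cbox a b \<subseteq> cbox c d"
      have "(0::real) \<in> ball 0 B" using B by simp
      then have "0 \<in> cbox a b" using ab by blast
      then have "c \<le> a" "a \<le> b" "b \<le> d" using ab by auto
      from diff[OF this] *[OF ab] show "norm (integral (cbox a b) (\<lambda>x. if x \<in> UNIV then h x else 0) -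
             integral (cbox c d) (\<lambda>x. if x \<in> UNIV then h x else 0)) < e"
        by (simp add: norm_minus_commute)
    qed
  qed
qed

lemma has_integral_UNIV_D:
  fixes h :: "real \<Rightarrow> 'b::banach"
  assumes "h integrable_on UNIV" "0 < e"
  obtains B where "0 < B" "\<And>a b. a \<le> - B \<Longrightarrow> B \<le> b \<Longrightarrow> norm (integral {a..b} h - integral UNIV h) < e"
proof -
  have "(h has_integral integral UNIV h) UNIV" using assms by blast
  from this[unfolded has_integral_alt'] assms obtain B where B: "B > 0"
    "\<And>a b. ball 0 B \<subseteq> cbox a b \<Longrightarrow> norm (integral (cbox a b) h - integral UNIV h) < e"
    by auto
  show ?thesis
    by (rule that[OF B(1)], rule B(2)[simplified]) (auto simp: dist_norm)
qed

lemma integral_UNIV_limit: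
  fixes h :: "real \<Rightarrow> 'b::banach"
  assumes "h integrable_on UNIV"
  shows "(\<lambda>n. integral {- real n..real n} h) \<longlonglongrightarrow> integral UNIV h"
proof (rule LIMSEQ_I)
  fix e :: real assume "0 < e"
  from has_integral_UNIV_D[OF assms this] obtain B where B: "0 < B"
    "\<And>a b. a \<le> - B \<Longrightarrow> B \<le> b \<Longrightarrow> norm (integral {a..b} h - integral UNIV h) < e" by metis
  obtain N where "B \<le> real N" using real_arch_simple by blast
  then show "\<exists>no. \<forall>n\<ge>no. norm (integral {- real n..real n} h - integral UNIV h) < e"
    by (intro exI[of _ N] allI impI B(2)) auto
qed

text \<open>In the logarithmic coordinate this is the dilation of a contour. A radius that works for
  \<open>h\<close> works for the translate once it is enlarged by
  \<open>\<bar>c\<bar>\<close>.\<close>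

lemma has_integral_UNIV_translate:
  fixes h :: "real \<Rightarrow> 'b::banach"
  assumes "h integrable_on UNIV"
  shows "((\<lambda>t. h (t + c)) has_integral integral UNIV h) UNIV"
proof -
  have hi: "h integrable_on {a..b}" for a b
    using assms by (rule integrable_on_subinterval) auto
  have tr: "((\<lambda>t. h (t + c)) has_integral integral {a + c..b + c} h) {a..b}" for a b
    using has_integral_affinity'[OF integrable_integral[OF hi[of "a+c" "b+c"], unfolded box_real(2)[symmetric]], of 1 c]
    by simp
  show ?thesis
  proof (subst has_integral_alt', intro conjI allI impI)
    show "(\<lambda>x. if x \<in> UNIV then h (x + c) else 0) integrable_on cbox a b" for a b
      using tr by auto
    fix e :: real assume "0 < e"
    from has_integral_UNIV_D[OF assms this] obtain B where B: "0 < B"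
      "\<And>a b. a \<le> - B \<Longrightarrow> B \<le> b \<Longrightarrow> norm (integral {a..b} h - integral UNIV h) < e" by metis
    show "\<exists>B>0. \<forall>a b. ball 0 B \<subseteq> cbox a b \<longrightarrow>
       norm (integral (cbox a b) (\<lambda>x. if x \<in> UNIV then h (x + c) else 0) - integral UNIV h) < e"
    proof (intro exI[of _ "B + \<bar>c\<bar>"] conjI allI impI)
      show "0 < B + \<bar>c\<bar>" using B by simp
      fix a b :: real assume s: "ball 0 (B + \<bar>c\<bar>) \<subseteq> cbox a b"
      have "closure (ball 0 (B + \<bar>c\<bar>)) \<subseteq> cbox a b" by (rule closure_minimal[OF s]) auto
      then have "cball 0 (B + \<bar>c\<bar>) \<subseteq> cbox a b" using B by simp
      moreover have "B + \<bar>c\<bar> \<in> cball 0 (B + \<bar>c\<bar>)" "- (B + \<bar>c\<bar>) \<in> cball 0 (B + \<bar>c\<bar>)" using B by auto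
      ultimately have "B + \<bar>c\<bar> \<in> cbox a b" "- (B + \<bar>c\<bar>) \<in> cbox a b" by blast+
      then have "a \<le> - (B + \<bar>c\<bar>)" "B + \<bar>c\<bar> \<le> b" by auto
      then have "norm (integral {a + c..b + c} h - integral UNIV h) < e"
        by (intro B(2)) auto
      then show "norm (integral (cbox a b) (\<lambda>x. if x \<in> UNIV then h (x + c) else 0) - integral UNIV h) < e"
        using tr[of a b] by (simp add: integral_unique)
    qed
  qed
qed

section \<open>Contour shifts in strips\<close>

abbreviation strip :: "real \<Rightarrow> real \<Rightarrow> complex set" where
  "strip a b \<equiv> {w. a < Im w \<and> Im w < b}"

lemma strip_convex: "convex (strip a b)" and strip_open: "open (strip a b)"
proof -
  have *: "strip a b = {w. Im w > a} \<inter> {w. Im w < b}" by auto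
  show "convex (strip a b)" unfolding *
    by (intro convex_Int convex_halfspace_Im_gt convex_halfspace_Im_lt)
  show "open (strip a b)" unfolding * by (intro open_Int open_halfspace_Im_gt open_halfspace_Im_lt)
qed

lemma continuous_on_line:
  assumes "F holomorphic_on strip \<alpha> \<beta>" "\<alpha> < a" "a < \<beta>"
  shows "continuous_on UNIV (\<lambda>t. F (Complex t a))"
proof -
  have "continuous_on UNIV (F \<circ> (\<lambda>t. Complex t a))"
    using assms by (intro continuous_on_compose continuous_on_subset[OF holomorphic_on_imp_continuous_on[OF assms(1)]])
      (auto simp: Complex_eq intro!: continuous_intros)
  then show ?thesis by (simp add: o_def)
qed

lemma exp_decay_tendsto:
  fixes f :: "nat \<Rightarrow> complex"
  assumes "0 < e" "\<And>n. cmod (f n) \<le> K * exp (- e * real n)"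
  shows "f \<longlonglongrightarrow> 0"
proof (rule Lim_null_comparison)
  show "\<forall>\<^sub>F n in sequentially. norm (f n) \<le> K * exp (- e * real n)" using assms by simp
  have "(\<lambda>n. K * exp (- e) ^ n) \<longlonglongrightarrow> K * 0"
    using assms by (intro tendsto_mult tendsto_const LIMSEQ_realpow_zero) auto
  moreover have "exp (- e) ^ n = exp (- e * real n)" for n
    by (metis exp_of_nat_mult mult.commute)
  ultimately show "(\<lambda>n. K * exp (- e * real n)) \<longlonglongrightarrow> 0"
    by simp
qed

text \<open>A strip is convex, so \<open>F\<close> has a primitive \<open>P\<close> there. The
  integrals over the two horizontal sides of the rectangle between the abscissas \<open>- n\<close>
  and \<open>n\<close> differ by increments of \<open>P\<close> along the vertical sides, and these
  are at most \<open>K * (b - a) * exp (- e * n)\<close>.\<close>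

lemma strip_shift:
  assumes F: "F holomorphic_on strip \<alpha> \<beta>" and e: "0 < e"
    and ab: "\<alpha> < a" "a \<le> b" "b < \<beta>"
    and bd: "\<And>w. a \<le> Im w \<Longrightarrow> Im w \<le> b \<Longrightarrow> cmod (F w) \<le> K * decay e (Re w)"
  shows "integral UNIV (\<lambda>t. F (Complex t a)) = integral UNIV (\<lambda>t. F (Complex t b))"
proof -
  obtain P where P: "\<And>w. w \<in> strip \<alpha> \<beta> \<Longrightarrow> (P has_field_derivative F w) (at w within strip \<alpha> \<beta>)"
    using holomorphic_convex_primitive'[OF strip_convex strip_open F] by metis
  then have P': "(P has_field_derivative F w) (at w)" if "w \<in> strip \<alpha> \<beta>" for w
    using P[OF that] at_within_open[OF that strip_open] by simp
  have int: "(\<lambda>t. F (Complex t c)) integrable_on UNIV" if "a \<le> c" "c \<le> b" for c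
  proof (rule integrable_UNIV_dominated)
    show "continuous_on UNIV (\<lambda>t. F (Complex t c))"
      by (rule continuous_on_line[OF F]) (use ab that in auto)
    show "(\<lambda>t. K * decay e t) integrable_on UNIV"
      using exp_decay_integrable[OF e] by (rule integrable_on_mult_right)
    show "cmod (F (Complex t c)) \<le> K * decay e t" for t
      using bd[of "Complex t c"] that by simp
  qed
  have ii: "integral {- real n..real n} (\<lambda>t. F (Complex t c)) = P (Complex n c) - P (Complex (- n) c)"
    if "a \<le> c" "c \<le> b" for c n
  proof (rule integral_unique, rule fundamental_theorem_of_calculus)
    fix t :: real
    have "((\<lambda>t. complex_of_real t + \<i> * of_real c) has_vector_derivative 1) (at t within {- real n..real n})"
      by (auto intro!: derivative_eq_intros)
    moreover have "(P has_field_derivative F (Complex t c)) (at (complex_of_real t + \<i> * of_real c))"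
      using P'[of "Complex t c"] ab that by (simp add: Complex_eq)
    ultimately have "((P \<circ> (\<lambda>t. complex_of_real t + \<i> * of_real c)) has_vector_derivative 1 * F (Complex t c)) (at t within {- real n..real n})"
      by (rule field_vector_diff_chain_within[OF _ has_field_derivative_at_within])
    then show "((\<lambda>x. P (Complex x c)) has_vector_derivative F (Complex t c)) (at t within {- real n..real n})"
      by (simp add: o_def Complex_eq)
  qed simp
  \<comment> \<open>\<open>f n\<close> will be \<open>n\<close> for the right side of the rectangle
    and \<open>- n\<close> for the left one.\<close>
  have vert: "(\<lambda>n. P (Complex (f n) a) - P (Complex (f n) b)) \<longlonglongrightarrow> 0"
    if f: "\<And>n. \<bar>f n\<bar> = real n" for f
  proof (rule exp_decay_tendsto[OF e, where K = "K * (b - a)"])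
    fix n
    have "cmod (P (Complex (f n) a) - P (Complex (f n) b))
       \<le> (K * exp (- e * real n)) * cmod (Complex (f n) a - Complex (f n) b)"
    proof (rule field_differentiable_bound)
      let ?S = "closed_segment (Complex (f n) b) (Complex (f n) a)"
      have S: "Re w = f n \<and> a \<le> Im w \<and> Im w \<le> b" if "w \<in> ?S" for w
      proof -
        from that obtain u where u: "0 \<le> u" "u \<le> 1"
          and w: "w = (1 - u) *\<^sub>R Complex (f n) b + u *\<^sub>R Complex (f n) a"
          unfolding in_segment by auto
        have "Re w = (1 - u) * f n + u * f n" and "Im w = (1 - u) * b + u * a"
          by (simp_all add: w)
        then have "Re w = f n" "Im w = b - u * (b - a)"
          by (simp_all add: algebra_simps)
        moreover have "0 \<le> u * (b - a)" "u * (b - a) \<le> 1 * (b - a)"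
          using u ab by (intro mult_nonneg_nonneg mult_right_mono; simp)+
        ultimately show ?thesis by auto
      qed
      show "convex ?S" by simp
      show "(P has_field_derivative F w) (at w within ?S)" if "w \<in> ?S" for w
        using S[OF that] ab by (intro has_field_derivative_at_within[OF P']) auto
      show "cmod (F w) \<le> K * exp (- e * real n)" if "w \<in> ?S" for w
        using S[OF that] bd[of w] f[of n] by auto
    qed auto
    also have "cmod (Complex (f n) a - Complex (f n) b) = b - a"
      using ab by (simp add: complex_diff cmod_def)
    finally show "cmod (P (Complex (f n) a) - P (Complex (f n) b)) \<le> K * (b - a) * exp (- e * real n)"
      by (simp add: mult_ac)
  qed
  have "(\<lambda>n. integral {- real n..real n} (\<lambda>t. F (Complex t a)) - integral {- real n..real n} (\<lambda>t. F (Complex t b)))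
    \<longlonglongrightarrow> 0"
  proof -
    have "(\<lambda>n. (P (Complex (real n) a) - P (Complex (real n) b)) - (P (Complex (- real n) a) - P (Complex (- real n) b))) \<longlonglongrightarrow> 0 - 0"
      by (intro tendsto_diff vert) auto
    also have "(\<lambda>n. (P (Complex (real n) a) - P (Complex (real n) b)) - (P (Complex (- real n) a) - P (Complex (- real n) b)))
      = (\<lambda>n. integral {- real n..real n} (\<lambda>t. F (Complex t a)) - integral {- real n..real n} (\<lambda>t. F (Complex t b)))"
      using ab by (simp add: ii fun_eq_iff algebra_simps)
    finally show ?thesis by simp
  qed
  moreover have "(\<lambda>n. integral {- real n..real n} (\<lambda>t. F (Complex t a)) - integral {- real n..real n} (\<lambda>t. F (Complex t b)))
    \<longlonglongrightarrow> integral UNIV (\<lambda>t. F (Complex t a)) - integral UNIV (\<lambda>t. F (Complex t b))"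
    using ab by (intro tendsto_diff integral_UNIV_limit int) auto
  ultimately show ?thesis using LIMSEQ_unique by fastforce
qed

section \<open>The Cauchy kernel in logarithmic coordinates\<close>

text \<open>With \<open>d\<close> half the difference of the arguments and \<open>p\<close>,
  \<open>q\<close> the moduli, the square of the distance is
  \<open>(p - q)^2 cos^2 d + (p + q)^2 sin^2 d\<close>; the first term is dropped. The bound is
  uniform in the moduli, which is what makes the Cauchy kernel bounded between two rays.\<close>

lemma cmod_exp_diff_ge:
  "(exp (Re a) + exp (Re b)) * \<bar>sin ((Im a - Im b) / 2)\<bar> \<le> cmod (exp a - exp b)"
proof (rule power2_le_imp_le)
  define p q d where "p = exp (Re a)" and "q = exp (Re b)" and "d = (Im a - Im b) / 2"
  have c: "cos (Im a - Im b) = (cos d)\<^sup>2 - (sin d)\<^sup>2"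
  proof -
    have "Im a - Im b = 2 * d" by (simp add: d_def)
    then show ?thesis by (simp only: cos_double)
  qed
  have "(cmod (exp a - exp b))\<^sup>2 = (p * cos (Im a) - q * cos (Im b))\<^sup>2 + (p * sin (Im a) - q * sin (Im b))\<^sup>2"
    by (simp add: cmod_power2 Re_exp Im_exp p_def q_def)
  also have "\<dots> = p\<^sup>2 * ((sin (Im a))\<^sup>2 + (cos (Im a))\<^sup>2) + q\<^sup>2 * ((sin (Im b))\<^sup>2 + (cos (Im b))\<^sup>2) - 2 * p * q * cos (Im a - Im b)"
    unfolding cos_diff by algebra
  also have "\<dots> = (p\<^sup>2 + q\<^sup>2) * ((sin d)\<^sup>2 + (cos d)\<^sup>2) - 2 * p * q * ((cos d)\<^sup>2 - (sin d)\<^sup>2)"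
    by (simp only: sin_cos_squared_add c mult_1_right)
  also have "\<dots> = (p - q)\<^sup>2 * (cos d)\<^sup>2 + ((p + q) * sin d)\<^sup>2"
    by algebra
  finally have "((p + q) * sin d)\<^sup>2 \<le> (cmod (exp a - exp b))\<^sup>2" by simp
  moreover have "((p + q) * \<bar>sin d\<bar>)\<^sup>2 = ((p + q) * sin d)\<^sup>2" by (simp add: power_mult_distrib)
  ultimately show "((exp (Re a) + exp (Re b)) * \<bar>sin ((Im a - Im b) / 2)\<bar>)\<^sup>2 \<le> (cmod (exp a - exp b))\<^sup>2"
    by (simp add: p_def q_def d_def)
qed simp

lemma cmod_exp_plus_one_ge:
  assumes "\<bar>Im w\<bar> \<le> a" "a < pi"
  shows "(1 + exp (Re w)) * cos (a / 2) \<le> cmod (exp w + 1)"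
proof -
  \<comment> \<open>\<open>-1\<close> is the exponential of \<open>- \<i> * pi\<close>; the shift by
    \<open>pi\<close> turns the half-angle sine into a cosine.\<close>
  have "(exp (Re w) + 1) * \<bar>sin ((Im w + pi) / 2)\<bar> \<le> cmod (exp w + 1)"
    using cmod_exp_diff_ge[of w "- (of_real pi * \<i>)"] by (simp add: exp_minus)
  moreover have "sin ((Im w + pi) / 2) = cos (Im w / 2)"
    by (simp add: add_divide_distrib sin_add)
  moreover have "cos (a / 2) \<le> cos (Im w / 2)"
  proof -
    have "cos (a / 2) \<le> cos (\<bar>Im w\<bar> / 2)" using assms by (intro cos_monotone_0_pi_le) auto
    then show ?thesis by (cases "0 \<le> Im w") auto
  qed
  then have "(exp (Re w) + 1) * cos (a / 2) \<le> (exp (Re w) + 1) * \<bar>cos (Im w / 2)\<bar>"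
    by (intro mult_left_mono) auto
  ultimately show ?thesis by (simp add: add.commute)
qed

text \<open>In the coordinate \<open>z = exp w\<close> the Cauchy kernel \<open>dz / (z - exp v)\<close> becomes \<open>cauchy_kernel v w dw\<close>.\<close>

definition cauchy_kernel :: "complex \<Rightarrow> complex \<Rightarrow> complex" where
  "cauchy_kernel v w = exp w / (exp w - exp v)"

lemma exp_notin_nonpos_Reals:
  assumes "\<bar>Im c\<bar> < pi"
  shows "exp c \<notin> \<real>\<^sub>\<le>\<^sub>0"
proof
  assume "exp c \<in> \<real>\<^sub>\<le>\<^sub>0"
  then have 1: "exp (Re c) * cos (Im c) \<le> 0" and 2: "exp (Re c) * sin (Im c) = 0"
    unfolding complex_nonpos_Reals_iff by (simp_all add: Re_exp Im_exp)
  from 2 have "sin (Im c) = 0" by simp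
  then have "Im c = 0" using assms
    by (metis abs_less_iff minus_less_iff sin_eq_0_pi)
  with 1 show False by simp
qed

lemma exp_add_exp_notin_nonpos_Reals:
  assumes "\<bar>Im c\<bar> < pi"
  shows "of_real (exp t) + exp c \<notin> \<real>\<^sub>\<le>\<^sub>0"
proof
  assume "of_real (exp t) + exp c \<in> \<real>\<^sub>\<le>\<^sub>0"
  then have "exp t + Re (exp c) \<le> 0" "Im (exp c) = 0" by (simp_all add: complex_nonpos_Reals_iff)
  then have "exp c \<in> \<real>\<^sub>\<le>\<^sub>0"
    using exp_gt_zero[of t] unfolding complex_nonpos_Reals_iff by linarith
  with exp_notin_nonpos_Reals[OF assms] show False by blast
qed

text \<open>In each bracket only one term is kept: \<open>exp t\<close> for
  \<open>t \<ge> 0\<close>, the constant for \<open>t < 0\<close>.\<close>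

lemma exp_quotient_decay:
  fixes p q t :: real
  assumes "0 < p" "0 < q"
  shows "exp t / ((exp t + p) * (exp t + q)) \<le> max 1 (1 / (p * q)) * exp (- \<bar>t\<bar>)"
proof (cases "0 \<le> t")
  case True
  have "exp t / ((exp t + p) * (exp t + q)) \<le> exp t / (exp t * exp t)"
    using assms by (intro frac_le mult_mono mult_pos_pos) auto
  also have "\<dots> = 1 * exp (- \<bar>t\<bar>)" using True by (simp add: exp_minus field_simps)
  also have "\<dots> \<le> max 1 (1 / (p * q)) * exp (- \<bar>t\<bar>)" by (intro mult_right_mono) auto
  finally show ?thesis .
next
  case False
  have "exp t / ((exp t + p) * (exp t + q)) \<le> exp t / (p * q)"
    using assms by (intro frac_le mult_mono mult_pos_pos) auto
  also have "\<dots> = 1 / (p * q) * exp (- \<bar>t\<bar>)" using False by simp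
  also have "\<dots> \<le> max 1 (1 / (p * q)) * exp (- \<bar>t\<bar>)" by (intro mult_right_mono) auto
  finally show ?thesis .
qed

text \<open>Each quotient alone tends to 1 at \<open>+\<infinity>\<close>, so only the difference is
  integrable. The principal branch of \<open>Ln (exp t + exp c)\<close> is a primitive, since its
  argument never meets the cut. It tends to \<open>c\<close> at \<open>-\<infinity>\<close> and
  behaves like \<open>t\<close> at \<open>+\<infinity>\<close>, where the two primitives
  cancel.\<close>

lemma has_integral_log_kernel:
  assumes c: "\<bar>Im c\<bar> < pi" and c': "\<bar>Im c'\<bar> < pi"
  shows "((\<lambda>t. of_real (exp t) / (of_real (exp t) + exp c) - of_real (exp t) / (of_real (exp t) + exp c'))
     has_integral c' - c) UNIV" (is "(?K has_integral _) _")
proof -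
  define E where "E t = complex_of_real (exp t)" for t
  have nz: "E t + exp d \<noteq> 0" if "\<bar>Im d\<bar> < pi" for d t
    using exp_add_exp_notin_nonpos_Reals[OF that, of t] by (metis E_def nonpos_Reals_zero_I)
  have contE: "continuous_on UNIV E" unfolding E_def by (intro continuous_intros)
  have K: "?K = (\<lambda>t. E t / (E t + exp c) - E t / (E t + exp c'))" by (simp add: E_def)
  \<comment> \<open>\<open>exp t + exp d\<close> equals \<open>exp t - exp (d + \<i> * pi)\<close>,
    and \<open>s d\<close> is the sine in \<open>cmod_exp_diff_ge\<close> for this pair; it is the
    same for all real \<open>t\<close>.\<close>
  define s where "s d = \<bar>sin ((0 - Im (d + \<i> * pi)) / 2)\<bar>" for d :: complex
  have spos: "0 < s d" if "\<bar>Im d\<bar> < pi" for d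
  proof -
    have "0 < sin ((Im d + pi) / 2)" using that by (intro sin_gt_zero) auto
    moreover have "(0 - Im (d + \<i> * pi)) / 2 = - ((Im d + pi) / 2)" by (simp add: field_simps)
    ultimately show ?thesis unfolding s_def by (simp only: sin_minus)
  qed
  have lower: "(exp t + exp (Re d)) * s d \<le> cmod (E t + exp d)" for d t
    using cmod_exp_diff_ge[of "of_real t" "d + \<i> * pi"] by (simp add: E_def s_def exp_add exp_of_real[symmetric])
  have bound: "cmod (?K t) \<le> cmod (exp c' - exp c) / (s c * s c') * max 1 (1 / (exp (Re c) * exp (Re c'))) * decay 1 t" for t
  proof -
    have "?K t = E t * (exp c' - exp c) / ((E t + exp c) * (E t + exp c'))"
      unfolding E_def[symmetric] using nz[OF c, of t] nz[OF c', of t] by (simp add: field_simps)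
    then have "cmod (?K t) = exp t * cmod (exp c' - exp c) / (cmod (E t + exp c) * cmod (E t + exp c'))"
      by (simp add: norm_divide norm_mult E_def)
    also have "\<dots> \<le> exp t * cmod (exp c' - exp c) / (((exp t + exp (Re c)) * s c) * ((exp t + exp (Re c')) * s c'))"
      using spos[OF c] spos[OF c']
      by (intro frac_le mult_mono lower mult_pos_pos add_pos_pos) auto
    also have "\<dots> = cmod (exp c' - exp c) / (s c * s c') * (exp t / ((exp t + exp (Re c)) * (exp t + exp (Re c'))))"
      by (simp add: field_simps)
    also have "\<dots> \<le> cmod (exp c' - exp c) / (s c * s c') * (max 1 (1 / (exp (Re c) * exp (Re c'))) * exp (- \<bar>t\<bar>))"
      using spos[OF c] spos[OF c'] by (intro mult_left_mono exp_quotient_decay) auto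
    finally show ?thesis by (simp add: mult_ac)
  qed
  have int: "?K integrable_on UNIV"
  proof (rule integrable_UNIV_dominated[OF _ _ bound])
    show "continuous_on UNIV ?K" unfolding K
      using nz[OF c] nz[OF c'] by (intro continuous_intros contE) auto
    show "(\<lambda>t. cmod (exp c' - exp c) / (s c * s c') * max 1 (1 / (exp (Re c) * exp (Re c'))) * decay 1 t) integrable_on UNIV"
      by (intro integrable_on_mult_right exp_decay_integrable) simp
  qed
  define Q where "Q d t = Ln (E t + exp d)" for d t
  have dQ: "(Q d has_vector_derivative E t / (E t + exp d)) (at t within S)" if "\<bar>Im d\<bar> < pi" for d t S
  proof -
    have "((\<lambda>z. Ln (exp z + exp d)) has_field_derivative exp (of_real t) / (exp (of_real t) + exp d)) (at (of_real t))"
      using exp_add_exp_notin_nonpos_Reals[OF that, of t]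
      by (auto intro!: derivative_eq_intros simp: exp_of_real divide_inverse)
    from has_vector_derivative_real_field[OF this] show ?thesis
      unfolding Q_def E_def by (simp add: exp_of_real)
  qed
  have ii: "integral {- real n..real n} ?K = (Q c n - Q c' n) - (Q c (- n) - Q c' (- n))" for n
    unfolding K by (rule integral_unique, rule fundamental_theorem_of_calculus)
      (auto intro!: has_vector_derivative_diff dQ c c')
  have E0: "(\<lambda>n. E (- real n)) \<longlonglongrightarrow> 0"
  proof (rule exp_decay_tendsto[of 1 _ 1])
    show "cmod (E (- real n)) \<le> 1 * exp (- 1 * real n)" for n by (simp add: E_def)
  qed simp
  have Ln_exp': "Ln (exp d) = d" if "\<bar>Im d\<bar> < pi" for d using that by (intro Ln_exp) auto
  have lo: "(\<lambda>n. Q d (- real n)) \<longlonglongrightarrow> d" if "\<bar>Im d\<bar> < pi" for d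
  proof -
    have "exp d \<notin> \<real>\<^sub>\<le>\<^sub>0" using that by (rule exp_notin_nonpos_Reals)
    then have "(\<lambda>n. Ln (E (- real n) + exp d)) \<longlonglongrightarrow> Ln (0 + exp d)"
      by (intro tendsto_Ln tendsto_add E0 tendsto_const) auto
    then show ?thesis by (simp add: Q_def Ln_exp'[OF that])
  qed
  \<comment> \<open>\<open>exp n\<close> is factored out of the logarithm; what remains tends to
    \<open>Ln 1\<close>.\<close>
  have hi: "(\<lambda>n. Q d (real n) - of_real (real n)) \<longlonglongrightarrow> 0" if "\<bar>Im d\<bar> < pi" for d
  proof -
    have "Q d (real n) - of_real (real n) = Ln (1 + E (- real n) * exp d)" for n
    proof -
      have eq: "E n + exp d = of_real (exp (real n)) * (1 + E (- real n) * exp d)"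
        by (simp add: E_def algebra_simps exp_minus flip: of_real_mult exp_of_real)
      then have "1 + E (- real n) * exp d \<noteq> 0" using nz[OF that, of n] by auto
      then have "Q d (real n) = of_real (ln (exp (real n))) + Ln (1 + E (- real n) * exp d)"
        unfolding Q_def eq by (subst Ln_times_of_real) (auto simp: Ln_of_real)
      then show ?thesis by simp
    qed
    moreover have "(\<lambda>n. Ln (1 + E (- real n) * exp d)) \<longlonglongrightarrow> Ln (1 + 0 * exp d)"
      by (intro tendsto_Ln tendsto_intros E0) auto
    ultimately show ?thesis by simp
  qed
  have "(\<lambda>n. ((Q c n - of_real (real n)) - (Q c' n - of_real (real n))) - (Q c (- real n) - Q c' (- real n))) \<longlonglongrightarrow> (0 - 0) - (c - c')"
    by (intro tendsto_diff hi lo c c')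
  then have "(\<lambda>n. integral {- real n..real n} ?K) \<longlonglongrightarrow> c' - c" unfolding ii by simp
  with integral_UNIV_limit[OF int] have "integral UNIV ?K = c' - c"
    by (rule LIMSEQ_unique)
  with int show ?thesis by (simp add: has_integral_integrable_integral)
qed

text \<open>Factoring \<open>exp (\<i> * a)\<close> out of the denominator rotates the line to the
  real axis; the extra \<open>\<i> * pi\<close> turns the minus sign in front of
  \<open>exp v\<close> into a plus.\<close>

lemma cauchy_kernel_line:
  "cauchy_kernel v (Complex t a) = of_real (exp t) / (of_real (exp t) + exp (v + \<i> * of_real (pi - a)))"
proof -
  have "exp (v + \<i> * of_real (pi - a)) = - (exp v * exp (- (\<i> * of_real a)))"
    by (simp add: exp_add exp_diff exp_minus algebra_simps)
      (simp add: divide_inverse)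
  moreover have "exp (Complex t a) = of_real (exp t) * exp (\<i> * of_real a)"
    by (simp add: Complex_eq exp_add exp_of_real)
  moreover have "exp v = exp v * exp (- (\<i> * of_real a)) * exp (\<i> * of_real a)"
    by (simp add: mult.assoc flip: exp_add)
  ultimately have "exp (Complex t a) - exp v = (of_real (exp t) + exp (v + \<i> * of_real (pi - a))) * exp (\<i> * of_real a)"
    by (simp add: algebra_simps)
  then show ?thesis unfolding cauchy_kernel_def
    by (simp add: \<open>exp (Complex t a) = _\<close>)
qed

text \<open>The bounds on \<open>a - Im v\<close> say that the rotated point
  \<open>v + \<i> * (pi - a)\<close> has imaginary part between \<open>- pi\<close> and
  \<open>pi\<close>, which fixes the branch of the logarithm. A point above the line has to be moved
  down by \<open>2 * pi * \<i>\<close> before this applies.\<close>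

lemma has_integral_cauchy_kernel_diff:
  assumes "0 < a - Im v" "a - Im v < 2 * pi" "0 < a - Im v'" "a - Im v' < 2 * pi"
  shows "((\<lambda>t. cauchy_kernel v (Complex t a) - cauchy_kernel v' (Complex t a)) has_integral v' - v) UNIV"
  using has_integral_log_kernel[of "v + \<i> * of_real (pi - a)" "v' + \<i> * of_real (pi - a)"] assms
  unfolding cauchy_kernel_line by (simp add: abs_less_iff)

lemma cauchy_kernel_periodic: "cauchy_kernel (v + 2 * of_real pi * \<i>) w = cauchy_kernel v w"
  by (simp add: cauchy_kernel_def exp_add exp_two_pi_i)

lemma exp_inj_strip:
  assumes "exp w = exp v" "\<bar>Im w - Im v\<bar> < 2 * pi"
  shows "w = v"
proof -
  from assms(1) obtain n where n: "w = v + complex_of_real (real_of_int (2 * n) * pi) * \<i>"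
    by (auto simp: exp_eq)
  have "Im w - Im v = 2 * pi * n" by (simp add: n)
  with assms(2) have "2 * pi * \<bar>real_of_int n\<bar> < 2 * pi * 1" by (simp add: abs_mult)
  then have "\<bar>real_of_int n\<bar> < 1" by (simp only: mult_less_cancel_left_pos pi_gt_zero mult_pos_pos zero_less_numeral)
  then have "n = 0" by simp
  then show ?thesis using n by simp
qed

text \<open>Both \<open>D w\<close> and \<open>exp w - exp v\<close> vanish at \<open>v\<close>, the
  latter only there within \<open>S\<close> and to first order. Dividing each by
  \<open>w - v\<close> removes the singularity, and \<open>F\<close> is formed from the two
  quotients.\<close>

lemma removable_cauchy_kernel:
  assumes D: "D holomorphic_on S" and S: "open S" "v \<in> S" and Dv: "D v = 0"
    and inj: "\<And>w. w \<in> S \<Longrightarrow> exp w = exp v \<Longrightarrow> w = v"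
  obtains F where "F holomorphic_on S" "\<And>w. w \<in> S \<Longrightarrow> w \<noteq> v \<Longrightarrow> F w = D w * cauchy_kernel v w"
proof -
  define d where "d = (\<lambda>z. if z = v then deriv D v else (D z - D v) / (z - v))"
  define E where "E = (\<lambda>z. if z = v then deriv exp v else (exp z - exp v) / (z - v))"
  have d: "d holomorphic_on S" and E: "E holomorphic_on S"
    unfolding d_def E_def by (intro pole_lemma_open D S holomorphic_on_exp)+
  have E0: "E z \<noteq> 0" if "z \<in> S" for z
    using inj[OF that] by (auto simp: E_def DERIV_imp_deriv[OF DERIV_exp])
  show ?thesis
  proof (rule that)
    show "(\<lambda>w. exp w * d w / E w) holomorphic_on S"
      by (intro holomorphic_intros d E E0)
    show "exp w * d w / E w = D w * cauchy_kernel v w" if "w \<in> S" "w \<noteq> v" for w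
      using that by (simp add: d_def E_def Dv cauchy_kernel_def)
  qed
qed

lemma decay_extend:
  assumes F: "F holomorphic_on strip \<alpha> \<beta>" and ab: "\<alpha> < a" "b < \<beta>"
    and bd: "\<And>w. a \<le> Im w \<Longrightarrow> Im w \<le> b \<Longrightarrow> R \<le> \<bar>Re w\<bar> \<Longrightarrow> cmod (F w) \<le> K * decay e (Re w)"
    and e: "0 < e"
  obtains K' where "\<And>w. a \<le> Im w \<Longrightarrow> Im w \<le> b \<Longrightarrow> cmod (F w) \<le> K' * decay e (Re w)"
proof -
  let ?B = "cbox (Complex (- R) a) (Complex R b)"
  have "continuous_on ?B F"
    by (rule continuous_on_subset[OF holomorphic_on_imp_continuous_on[OF F]]) (use ab in \<open>auto simp: in_cbox_complex_iff\<close>)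
  then have "bounded (F ` ?B)" by (intro compact_imp_bounded compact_continuous_image compact_cbox)
  then obtain N where N: "\<And>w. w \<in> ?B \<Longrightarrow> cmod (F w) \<le> N" unfolding bounded_iff by auto
  \<comment> \<open>Where \<open>\<bar>Re w\<bar> < R\<close>, the decay factor is at least
    \<open>exp (- e * R)\<close>, for which the constant has to compensate.\<close>
  define K' where "K' = max K (N * exp (e * R))"
  show ?thesis
  proof (rule that[of K'])
    fix w assume w: "a \<le> Im w" "Im w \<le> b"
    show "cmod (F w) \<le> K' * decay e (Re w)"
    proof (cases "R \<le> \<bar>Re w\<bar>")
      case True
      have "cmod (F w) \<le> K * decay e (Re w)" using bd w True by blast
      also have "\<dots> \<le> K' * decay e (Re w)" unfolding K'_def by (intro mult_right_mono) auto
      finally show ?thesis .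
    next
      case False
      then have "w \<in> ?B" using w by (auto simp: in_cbox_complex_iff)
      then have N1: "cmod (F w) \<le> N" by (rule N)
      then have "0 \<le> N" using norm_ge_zero order_trans by blast
      then have "N * 1 \<le> N * exp (e * R - e * \<bar>Re w\<bar>)"
        using False e by (intro mult_left_mono) auto
      also have "\<dots> = (N * exp (e * R)) * decay e (Re w)" by (simp add: exp_diff exp_minus field_simps)
      also have "\<dots> \<le> K' * decay e (Re w)" unfolding K'_def by (intro mult_right_mono) auto
      finally show ?thesis using N1 by simp
    qed
  qed
qed

lemma integrable_line:
  assumes "F holomorphic_on strip \<alpha> \<beta>" "\<alpha> < a" "a < \<beta>" "0 < e"
    and "\<And>t. cmod (F (Complex t a)) \<le> K * decay e t"
  shows "(\<lambda>t. F (Complex t a)) integrable_on UNIV"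
  by (rule integrable_UNIV_dominated[OF continuous_on_line[OF assms(1-3)] _ assms(5)])
     (intro integrable_on_mult_right exp_decay_integrable assms(4))

text \<open>Since \<open>exp 1 \<ge> 2\<close>, the moduli \<open>p\<close> and \<open>q\<close>
  differ at least by the factor 2, so their difference is at least half of the larger one. The
  second bound carries the decay of the kernel as \<open>Re w\<close> tends to
  \<open>-\<infinity>\<close>.\<close>

lemma cauchy_kernel_bound_far:
  assumes "1 \<le> \<bar>Re w - Re v\<bar>"
  shows "cmod (cauchy_kernel v w) \<le> 2" and "cmod (cauchy_kernel v w) \<le> 2 * exp (Re w - Re v)"
proof -
  define p q where "p = exp (Re w)" and "q = exp (Re v)"
  have pq: "0 < p" "0 < q" by (auto simp: p_def q_def)
  have "exp (- 1) \<le> (1/2 :: real)"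
    using exp_ge_add_one_self[of "1::real"] by (simp add: exp_minus field_simps)
  then have *: "q \<le> p / 2 \<or> p \<le> q / 2"
  proof (cases "Re v \<le> Re w - 1")
    case True
    then have "q \<le> exp (Re w + - 1)" by (simp add: q_def)
    also have "\<dots> = p * exp (- 1)" by (simp only: p_def exp_add)
    also have "\<dots> \<le> p * (1/2)" using \<open>exp (- 1) \<le> (1/2 :: real)\<close> pq by (intro mult_left_mono) auto
    finally show ?thesis by simp
  next
    case False
    then have "p \<le> exp (Re v + - 1)" using assms by (simp add: p_def)
    also have "\<dots> = q * exp (- 1)" by (simp only: q_def exp_add)
    also have "\<dots> \<le> q * (1/2)" using \<open>exp (- 1) \<le> (1/2 :: real)\<close> pq by (intro mult_left_mono) auto
    finally show ?thesis by simp
  qed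
  have low: "\<bar>p - q\<bar> \<le> cmod (exp w - exp v)"
    using norm_triangle_ineq3[of "exp w" "exp v"] by (simp add: p_def q_def)
  have nz: "exp w - exp v \<noteq> 0" using low * pq by auto
  have "cmod (cauchy_kernel v w) = p / cmod (exp w - exp v)"
    by (simp add: cauchy_kernel_def norm_divide p_def)
  moreover have "p \<le> 2 * \<bar>p - q\<bar>" "p \<le> 2 * (p / q) * \<bar>p - q\<bar>"
  proof -
    show "p \<le> 2 * \<bar>p - q\<bar>" using * pq by auto
  next
    have "q \<le> 2 * \<bar>p - q\<bar>" using * pq by auto
    then have "(p / q) * q \<le> (p / q) * (2 * \<bar>p - q\<bar>)" using pq by (intro mult_left_mono) auto
    then show "p \<le> 2 * (p / q) * \<bar>p - q\<bar>" using pq by (simp add: algebra_simps)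
  qed
  moreover have "2 * \<bar>p - q\<bar> \<le> 2 * cmod (exp w - exp v)" "2 * (p / q) * \<bar>p - q\<bar> \<le> 2 * (p / q) * cmod (exp w - exp v)"
    using low pq by (intro mult_left_mono; simp)+
  moreover have "0 < cmod (exp w - exp v)" using nz by simp
  ultimately have "cmod (cauchy_kernel v w) \<le> 2 \<and> cmod (cauchy_kernel v w) \<le> 2 * (p / q)"
    by (simp only: pos_divide_le_eq) (meson order_trans)
  then show "cmod (cauchy_kernel v w) \<le> 2" "cmod (cauchy_kernel v w) \<le> 2 * exp (Re w - Re v)"
    by (auto simp: p_def q_def exp_diff)
qed

text \<open>Multiplying \<open>h v\<close> by \<open>(exp v + 1) / (exp w + 1)\<close> before subtracting it from \<open>h w\<close> produces decay
  and turns its contribution into the difference of two Cauchy kernels.\<close>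

lemma Cauchy_formula_strip:
  assumes h: "h holomorphic_on strip (- \<sigma>) \<sigma>" and e: "0 < e" "e \<le> 1"
    and bd: "\<And>w. \<bar>Im w\<bar> < \<sigma> \<Longrightarrow> cmod (h w) \<le> K * decay e (Re w)"
    and a: "0 < a" "a < \<sigma>" "\<sigma> \<le> pi" and v: "\<bar>Im v\<bar> < a"
  shows "integral UNIV (\<lambda>t. h (Complex t (- a)) * cauchy_kernel v (Complex t (- a)))
       - integral UNIV (\<lambda>t. h (Complex t a) * cauchy_kernel v (Complex t a)) = 2 * of_real pi * \<i> * h v"
proof -
  \<comment> \<open>\<open>exp m = -1\<close>, so \<open>exp w + 1\<close> is the denominator of the
    kernel for \<open>m\<close>. As \<open>a < pi\<close>, the point \<open>m\<close> lies below
    both lines \<open>Im w = a\<close> and \<open>Im w = - a\<close>, by less than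
    \<open>2 * pi\<close>.\<close>
  define m where "m = - (of_real pi * \<i>)"
  define q where "q w = (exp v + 1) / (exp w + 1)" for w
  have sub: "w \<in> strip (- \<sigma>) \<sigma> \<Longrightarrow> \<bar>Im w\<bar> < pi" for w using a by auto
  have em: "exp m = - 1" by (simp add: m_def exp_minus)
  have nz1: "exp w + 1 \<noteq> 0" if "\<bar>Im w\<bar> < pi" for w
  proof
    assume "exp w + 1 = 0"
    then have "exp w = exp m" by (simp add: em add_eq_0_iff2)
    from exp_inj_strip[OF this] that have "w = m" by (auto simp: m_def abs_less_iff)
    with that show False by (simp add: m_def)
  qed
  have Q: "q w * cauchy_kernel v w = cauchy_kernel v w - cauchy_kernel m w" if "\<bar>Im w\<bar> < pi" "exp w \<noteq> exp v" for w
    using nz1[OF that(1)] that(2) by (simp add: q_def cauchy_kernel_def em divide_simps) (simp add: algebra_simps)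
  define D where "D w = h w - h v * q w" for w
  have vp: "\<bar>Im v\<bar> < pi" using v a by linarith
  have D: "D holomorphic_on strip (- \<sigma>) \<sigma>" unfolding D_def q_def
    by (intro holomorphic_intros h) (use sub nz1 in blast)
  have Dv: "D v = 0" using nz1[OF vp] by (simp add: D_def q_def)
  obtain F where F: "F holomorphic_on strip (- \<sigma>) \<sigma>"
    and FD: "\<And>w. w \<in> strip (- \<sigma>) \<sigma> \<Longrightarrow> w \<noteq> v \<Longrightarrow> F w = D w * cauchy_kernel v w"
  proof (rule removable_cauchy_kernel[OF D strip_open _ Dv])
    show "v \<in> strip (- \<sigma>) \<sigma>" using v a by auto
    show "w = v" if "w \<in> strip (- \<sigma>) \<sigma>" "exp w = exp v" for w
      by (rule exp_inj_strip[OF that(2)]) (use that v a in auto)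
  qed (rule that, blast+)
  have Kpos: "0 \<le> K" using bd[of 0] a norm_ge_zero[of "h 0"] by (simp del: norm_ge_zero)
  define s where "s = cos (a / 2)"
  have spos: "0 < s" unfolding s_def by (intro cos_gt_zero_pi) (use a in auto)
  have low: "(1 + exp (Re w)) * s \<le> cmod (exp w + 1)" if "\<bar>Im w\<bar> \<le> a" for w
    unfolding s_def using that a by (intro cmod_exp_plus_one_ge) auto
  define K1 where "K1 = 2 * K + cmod (h v) * (cmod (exp v + 1) / s * (2 * (1 + exp (- Re v))))"
  obtain K' where K': "\<And>w. - a \<le> Im w \<Longrightarrow> Im w \<le> a \<Longrightarrow> cmod (F w) \<le> K' * decay e (Re w)"
  proof (rule decay_extend[OF F, of "- a" a "\<bar>Re v\<bar> + 1" K1 e])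
    fix w assume w: "- a \<le> Im w" "Im w \<le> a" "\<bar>Re v\<bar> + 1 \<le> \<bar>Re w\<bar>"
    then have wa: "\<bar>Im w\<bar> \<le> a" "\<bar>Im w\<bar> < \<sigma>" and ne: "w \<noteq> v" and far: "1 \<le> \<bar>Re w - Re v\<bar>" using a by auto
    have "F w = h w * cauchy_kernel v w - h v * (q w * cauchy_kernel v w)"
      using FD[of w] wa(2) ne by (simp add: D_def algebra_simps abs_less_iff)
    then have "cmod (F w) \<le> cmod (h w) * cmod (cauchy_kernel v w) + cmod (h v) * (cmod (q w) * cmod (cauchy_kernel v w))"
      using norm_triangle_ineq4[of "h w * cauchy_kernel v w" "h v * (q w * cauchy_kernel v w)"] by (simp add: norm_mult)
    also have "cmod (h w) * cmod (cauchy_kernel v w) \<le> (K * decay e (Re w)) * 2"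
      using Kpos by (intro mult_mono bd wa cauchy_kernel_bound_far far) auto
    \<comment> \<open>\<open>q\<close> supplies the decay to the right, where the kernel is merely
      bounded; the kernel supplies it to the left, where \<open>q\<close> is merely bounded.\<close>
    also have "cmod (q w) * cmod (cauchy_kernel v w) \<le> cmod (exp v + 1) / s * (2 * (1 + exp (- Re v))) * decay e (Re w)"
    proof -
      have "cmod (q w) = cmod (exp v + 1) / cmod (exp w + 1)" by (simp add: q_def norm_divide)
      also have "\<dots> \<le> cmod (exp v + 1) / ((1 + exp (Re w)) * s)"
        using low[OF wa(1)] spos by (intro divide_left_mono mult_pos_pos add_pos_pos less_le_trans[OF _ low[OF wa(1)]]) auto
      finally have "cmod (q w) * cmod (cauchy_kernel v w)
          \<le> cmod (exp v + 1) / s * (cmod (cauchy_kernel v w) / (1 + exp (Re w)))"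
        by (simp add: mult_right_mono mult_ac)
          (metis (no_types) divide_divide_eq_left mult.commute mult_right_mono norm_ge_zero times_divide_eq_left)
      moreover have "cmod (cauchy_kernel v w) / (1 + exp (Re w)) \<le> 2 * (1 + exp (- Re v)) * decay e (Re w)"
      proof (cases "0 \<le> Re w")
        case True
        have "cmod (cauchy_kernel v w) / (1 + exp (Re w)) \<le> 2 / exp (Re w)"
          by (intro frac_le cauchy_kernel_bound_far far) auto
        also have "\<dots> = 2 * 1 * exp (- \<bar>Re w\<bar>)" using True by (simp add: exp_minus field_simps)
        also have "\<dots> \<le> 2 * (1 + exp (- Re v)) * decay e (Re w)"
          using e by (intro mult_mono) (auto intro: mult_left_le_one_le)
        finally show ?thesis .
      next
        case False
        have "cmod (cauchy_kernel v w) / (1 + exp (Re w)) \<le> 2 * exp (Re w - Re v) / 1"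
          by (intro frac_le cauchy_kernel_bound_far far) auto
        also have "\<dots> = 2 * exp (- Re v) * exp (- \<bar>Re w\<bar>)" using False by (simp add: exp_minus exp_diff field_simps)
        also have "\<dots> \<le> 2 * (1 + exp (- Re v)) * decay e (Re w)"
          using e by (intro mult_mono) (auto intro: mult_left_le_one_le)
        finally show ?thesis .
      qed
      then have "cmod (exp v + 1) / s * (cmod (cauchy_kernel v w) / (1 + exp (Re w)))
          \<le> cmod (exp v + 1) / s * (2 * (1 + exp (- Re v)) * decay e (Re w))"
        using spos by (intro mult_left_mono) auto
      ultimately show ?thesis by (simp add: mult.assoc)
    qed
    finally show "cmod (F w) \<le> K1 * decay e (Re w)"
      by (simp add: K1_def algebra_simps mult_right_mono)
  qed ((use a e in \<open>simp; fail\<close> | rule that, blast)+)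
  have line: "integral UNIV (\<lambda>t. F (Complex t b)) =
      integral UNIV (\<lambda>t. h (Complex t b) * cauchy_kernel v (Complex t b)) - h v * X"
    if b: "\<bar>b\<bar> = a" and X: "((\<lambda>t. cauchy_kernel v (Complex t b) - cauchy_kernel m (Complex t b)) has_integral X) UNIV" for b X
  proof -
    have ne: "Complex t b \<noteq> v" for t using v b by auto
    have ne': "exp (Complex t b) \<noteq> exp v" for t
    proof -
      have "\<bar>b - Im v\<bar> < 2 * pi" using v b a by linarith
      then show ?thesis using exp_inj_strip[of "Complex t b" v] ne by auto
    qed
    have eq: "F (Complex t b) = h (Complex t b) * cauchy_kernel v (Complex t b)
       - h v * (cauchy_kernel v (Complex t b) - cauchy_kernel m (Complex t b))" for t
      using FD[of "Complex t b"] ne[of t] b a minus_less_iff[of \<sigma> b] abs_less_iff[of b \<sigma>] Q[of "Complex t b", OF _ ne'] by (simp add: D_def left_diff_distrib mult.assoc)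
    have Fi: "(\<lambda>t. F (Complex t b)) integrable_on UNIV"
      by (rule integrable_line[OF F, of _ e K']) (use a b e K'[of "Complex _ b"] in auto)
    have i2: "((\<lambda>t. h v * (cauchy_kernel v (Complex t b) - cauchy_kernel m (Complex t b))) has_integral h v * X) UNIV"
      using X by (rule has_integral_mult_right)
    have "((\<lambda>t. h (Complex t b) * cauchy_kernel v (Complex t b)) has_integral integral UNIV (\<lambda>t. F (Complex t b)) + h v * X) UNIV"
      using has_integral_add[OF integrable_integral[OF Fi] i2] by (simp add: eq)
    then show ?thesis by (simp add: integral_unique)
  qed
  have up: "integral UNIV (\<lambda>t. F (Complex t a)) =
      integral UNIV (\<lambda>t. h (Complex t a) * cauchy_kernel v (Complex t a)) - h v * (m - v)"
    by (rule line, use a in simp, rule has_integral_cauchy_kernel_diff) (use a v in \<open>auto simp: m_def\<close>)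
  \<comment> \<open>\<open>v\<close> lies above this line and is replaced by
    \<open>v - 2 * pi * \<i>\<close>, which leaves the kernel unchanged. This shift is the only
    difference to the upper line and becomes the factor \<open>2 * pi * \<i>\<close> of the
    formula.\<close>
  have dn: "integral UNIV (\<lambda>t. F (Complex t (- a))) =
      integral UNIV (\<lambda>t. h (Complex t (- a)) * cauchy_kernel v (Complex t (- a))) - h v * (m - (v - 2 * of_real pi * \<i>))"
  proof (rule line)
    have "((\<lambda>t. cauchy_kernel (v - 2 * of_real pi * \<i>) (Complex t (- a)) - cauchy_kernel m (Complex t (- a)))
       has_integral m - (v - 2 * of_real pi * \<i>)) UNIV"
      by (rule has_integral_cauchy_kernel_diff) (use a v in \<open>auto simp: m_def\<close>)
    then show "((\<lambda>t. cauchy_kernel v (Complex t (- a)) - cauchy_kernel m (Complex t (- a)))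
       has_integral m - (v - 2 * of_real pi * \<i>)) UNIV"
      using cauchy_kernel_periodic[of "v - 2 * of_real pi * \<i>"] by simp
  qed (use a in simp)
  have "integral UNIV (\<lambda>t. F (Complex t (- a))) = integral UNIV (\<lambda>t. F (Complex t a))"
    by (rule strip_shift[OF F e(1)]) (use a K' in auto)
  then show ?thesis unfolding up dn by (simp add: algebra_simps)
qed

text \<open>On squares the interchange holds for continuous functions. Both iterated integrals are
  limits of those over the squares with side \<open>[- n, n]\<close>, by dominated convergence in
  the outer variable: the inner integrals are bounded by a multiple of the decay factor of the outer
  variable.\<close>

lemma integral_swap_UNIV:
  fixes f :: "real \<Rightarrow> real \<Rightarrow> complex"
  assumes c: "continuous_on UNIV (\<lambda>(s, t). f s t)" and e: "0 < e"
    and bd: "\<And>s t. cmod (f s t) \<le> K * (decay e s * decay e t)"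
  shows "integral UNIV (\<lambda>s. integral UNIV (\<lambda>t. f s t)) = integral UNIV (\<lambda>t. integral UNIV (\<lambda>s. f s t))"
proof -
  have lim: "(\<lambda>n. integral {- real n..real n} (\<lambda>s. integral {- real n..real n} (\<lambda>t. g s t)))
     \<longlonglongrightarrow> integral UNIV (\<lambda>s. integral UNIV (\<lambda>t. g s t))"
    if c: "continuous_on UNIV (\<lambda>(s, t). g s t)"
      and bd: "\<And>s t. cmod (g s t) \<le> K * (decay e s * decay e t)" for g :: "real \<Rightarrow> real \<Rightarrow> complex"
  proof -
    define I where "I = integral UNIV (\<lambda>t. decay e t)"
    have bd2: "cmod (g s t) \<le> (K * decay e s) * decay e t" for s t
      using bd by (simp add: mult.assoc)
    have c1: "continuous_on UNIV (\<lambda>t. g s t)" for s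
    proof -
      have "continuous_on UNIV (\<lambda>t::real. (s, t))"
        by (intro continuous_on_Pair continuous_on_const continuous_on_id)
      from continuous_on_compose2[OF c this] show ?thesis by simp
    qed
    have ei: "(\<lambda>t. (K * decay e s) * decay e t) integrable_on S" if "S = UNIV \<or> (\<exists>a b. S = {a..b})" for s S
      using that exp_decay_integrable[OF e]
      by (intro integrable_on_mult_right) (auto intro!: integrable_continuous_real continuous_intros)
    have gi: "(\<lambda>t. g s t) integrable_on UNIV" for s
      by (rule integrable_UNIV_dominated[OF c1 ei[of UNIV s]]) (use bd2 in auto)
    have Kp: "0 \<le> K * decay e s" for s
      using bd[of s 0] norm_ge_zero[of "g s 0"] by (simp del: norm_ge_zero)
    have pos: "0 \<le> decay e t" for t by simp
    have gb: "cmod (integral {- real n..real n} (\<lambda>t. g s t)) \<le> K * decay e s * I" for s n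
    proof -
      have "cmod (integral {- real n..real n} (\<lambda>t. g s t)) \<le> integral {- real n..real n} (\<lambda>t. (K * decay e s) * decay e t)"
        by (rule integral_norm_bound_integral[OF integrable_on_subinterval[OF gi] ei bd2]) auto
      also have "\<dots> \<le> integral UNIV (\<lambda>t. (K * decay e s) * decay e t)"
        by (rule integral_subset_le[OF _ ei ei]) (use Kp[of s] in auto)
      finally show ?thesis by (simp add: I_def)
    qed
    define G where "G n s = (if s \<in> {- real n..real n} then integral {- real n..real n} (\<lambda>t. g s t) else 0)" for n s
    have "(\<lambda>n. integral UNIV (G n)) \<longlonglongrightarrow> integral UNIV (\<lambda>s. integral UNIV (\<lambda>t. g s t))"
    proof (rule dominated_convergence(2))
      show "(\<lambda>s. (K * I) * decay e s) integrable_on UNIV"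
        by (intro integrable_on_mult_right exp_decay_integrable e)
      show "G n integrable_on UNIV" for n
      proof -
        have "continuous_on (cbox (- real n) (real n)) (\<lambda>s. integral (cbox (- real n) (real n)) (\<lambda>t. g s t))"
          by (rule integral_continuous_on_param) (rule continuous_on_subset[OF c], simp)
        then have "(\<lambda>s. integral {- real n..real n} (\<lambda>t. g s t)) integrable_on {- real n..real n}"
          by (simp add: integrable_continuous_real)
        then show ?thesis unfolding G_def by (simp only: integrable_restrict_UNIV)
      qed
      show "norm (G n s) \<le> (K * I) * decay e s" for n s
        using gb[of n s] order_trans[OF norm_ge_zero gb[of n s]] by (auto simp: G_def mult_ac)
      show "(\<lambda>n. G n s) \<longlonglongrightarrow> integral UNIV (\<lambda>t. g s t)" for s
      proof (rule Lim_transform_eventually[OF integral_UNIV_limit[OF gi]])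
        obtain N where "\<bar>s\<bar> \<le> real N" using real_arch_simple by blast
        then show "\<forall>\<^sub>F n in sequentially. integral {- real n..real n} (g s) = G n s"
          by (intro eventually_sequentiallyI[of N]) (auto simp: G_def)
      qed
    qed
    then show ?thesis unfolding G_def by (simp only: integral_restrict_UNIV)
  qed
  have c': "continuous_on UNIV (\<lambda>(t, s). f s t)"
    using continuous_on_compose2[OF c continuous_on_swap[of UNIV]] by (simp add: prod.swap_def case_prod_beta)
  have sw: "integral {- real n..real n} (\<lambda>s. integral {- real n..real n} (\<lambda>t. f s t))
     = integral {- real n..real n} (\<lambda>t. integral {- real n..real n} (\<lambda>s. f s t))" for n
    using integral_swap_continuous[of "- real n" "- real n" "real n" "real n" f] continuous_on_subset[OF c, of "cbox (- real n, - real n) (real n, real n)"]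
    by simp
  have "(\<lambda>n. integral {- real n..real n} (\<lambda>s. integral {- real n..real n} (\<lambda>t. f s t)))
     \<longlonglongrightarrow> integral UNIV (\<lambda>t. integral UNIV (\<lambda>s. f s t))"
    unfolding sw by (rule lim[OF c']) (metis bd mult.commute)
  with lim[OF c bd] show ?thesis by (rule LIMSEQ_unique)
qed

section \<open>Sectors and decaying functions\<close>

lemma bounded_bilinear_scaleC: "bounded_bilinear ((*\<^sub>C) :: complex \<Rightarrow> 'x::complex_banach \<Rightarrow> 'x)"
proof
  fix r :: real and a b :: complex and x y :: 'x
  show "(a + b) *\<^sub>C x = a *\<^sub>C x + b *\<^sub>C x" "a *\<^sub>C (x + y) = a *\<^sub>C x + a *\<^sub>C y"
    by (rule scaleC_add_left scaleC_add_right)+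
  show "(r *\<^sub>R a) *\<^sub>C x = r *\<^sub>R (a *\<^sub>C x)"
    by (simp add: scaleR_conv_of_real flip: scaleC_of_real scaleC_scaleC)
  show "a *\<^sub>C (r *\<^sub>R x) = r *\<^sub>R (a *\<^sub>C x)"
    by (simp add: scaleC_scaleC mult.commute flip: scaleC_of_real)
  show "\<exists>K. \<forall>a (x :: 'x). norm (a *\<^sub>C x) \<le> norm a * norm x * K"
    by (rule exI[of _ 1]) (simp add: norm_scaleC)
qed

interpretation scaleC: bounded_bilinear "(*\<^sub>C) :: complex \<Rightarrow> 'x::complex_banach \<Rightarrow> 'x"
  by (rule bounded_bilinear_scaleC)

lemma scaleC_one [simp]: "1 *\<^sub>C x = (x :: 'x::complex_banach)"
  using scaleC_of_real[of 1 x] by simp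

definition clinear_functional :: "('x::complex_banach \<Rightarrow> complex) \<Rightarrow> bool" where
  "clinear_functional l \<longleftrightarrow> bounded_linear l \<and> (\<forall>c x. l (c *\<^sub>C x) = c * l x)"

lemma clinear_functional_compose:
  assumes "clinear_functional l" "bounded_clinear T"
  shows "clinear_functional (\<lambda>x. l (T x))"
  using assms bounded_linear_compose unfolding clinear_functional_def bounded_clinear_def by auto

lemma clinear_functional_cmult:
  assumes "clinear_functional l"
  shows "clinear_functional (\<lambda>x. c * l x)"
  using assms bounded_linear_compose[OF bounded_linear_mult_right, of l c]
  unfolding clinear_functional_def by auto

text \<open>\<open>Arg\<close> jumps on the negative axis, whereas the inequality is a closed
  condition. It holds on the sector because cosine decreases on \<open>[0, pi]\<close>, and hence on
  the closure.\<close>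

lemma closure_sector_subset:
  assumes "0 < \<theta>" "\<theta> < pi" "z \<in> closure (sector \<theta>)"
  shows "cmod z * cos \<theta> \<le> Re z"
proof -
  have "closed {z. cmod z * cos \<theta> \<le> Re z}"
    by (intro closed_Collect_le continuous_intros)
  moreover have "sector \<theta> \<subseteq> {z. cmod z * cos \<theta> \<le> Re z}"
  proof (clarsimp simp: sector_def \<open>0 < \<theta>\<close>[THEN less_imp_neq, symmetric])
    fix z :: complex assume "\<bar>Arg z\<bar> < \<theta>"
    then have "cos \<theta> \<le> cos \<bar>Arg z\<bar>" using assms by (intro cos_monotone_0_pi_le) auto
    then have "cmod z * cos \<theta> \<le> cmod z * cos (Arg z)" by (intro mult_left_mono) auto
    also have "\<dots> = Re z"
      by (metis Re_complex_of_real cmod_eq_Re complex_of_real_def Re_rcis rcis_cmod_Arg)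
    finally show "cmod z * cos \<theta> \<le> Re z" .
  qed
  ultimately show ?thesis using assms(3) closure_minimal by blast
qed

lemma exp_notin_closure_sector:
  assumes "0 < \<theta>" "\<theta> < pi" "\<theta> < \<bar>Im w\<bar>" "\<bar>Im w\<bar> < 2 * pi - \<theta>"
  shows "exp w \<notin> closure (sector \<theta>)"
proof
  assume "exp w \<in> closure (sector \<theta>)"
  from closure_sector_subset[OF assms(1,2) this] have "cos \<theta> \<le> cos \<bar>Im w\<bar>"
    by (simp add: Re_exp)
  moreover have "cos \<bar>Im w\<bar> < cos \<theta>"
  proof (cases "\<bar>Im w\<bar> \<le> pi")
    case True
    then show ?thesis using assms by (intro cos_monotone_0_pi) auto
  next
    case False
    then have "cos (2 * pi - \<bar>Im w\<bar>) < cos \<theta>" using assms by (intro cos_monotone_0_pi) auto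
    then show ?thesis by (simp add: cos_diff)
  qed
  ultimately show False by simp
qed

lemma exp_in_sector:
  assumes "0 < \<sigma>" "\<sigma> \<le> pi" "\<bar>Im w\<bar> < \<sigma>"
  shows "exp w \<in> sector \<sigma>"
proof -
  have "Arg (exp w) = Im w" using assms by (intro Arg_exp) auto
  moreover have "exp w \<notin> \<real>\<^sub>\<le>\<^sub>0" using assms by (intro exp_notin_nonpos_Reals) simp
  ultimately show ?thesis using assms by (simp add: sector_def)
qed

lemma sector_Ln:
  assumes "0 < \<sigma>" "z \<in> sector \<sigma>"
  shows "z \<noteq> 0" "exp (Ln z) = z" "\<bar>Im (Ln z)\<bar> < \<sigma>" "z \<notin> \<real>\<^sub>\<le>\<^sub>0"
proof -
  from assms show z: "z \<notin> \<real>\<^sub>\<le>\<^sub>0" by (auto simp: sector_def)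
  then show nz: "z \<noteq> 0" by auto
  then show "exp (Ln z) = z" by simp
  from assms nz show "\<bar>Im (Ln z)\<bar> < \<sigma>" by (auto simp: sector_def Arg_eq_Im_Ln)
qed

lemma holomorphic_on_sector_exp:
  assumes "f holomorphic_on sector \<sigma>" "0 < \<sigma>" "\<sigma> \<le> pi"
  shows "(\<lambda>w. f (exp w)) holomorphic_on strip (- \<sigma>) \<sigma>"
  by (rule holomorphic_on_compose_gen[OF holomorphic_on_exp assms(1), unfolded o_def])
    (use assms exp_in_sector in \<open>auto simp: abs_less_iff\<close>)

text \<open>In the coordinate \<open>w\<close> the weight is
  \<open>exp (\<epsilon> * \<bar>Re w\<bar>)\<close>. The rate is lowered to at most 1 because
  \<open>Cauchy_formula_strip\<close> combines it with a term that is estimated by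
  \<open>exp (- \<bar>Re w\<bar>)\<close>.\<close>

lemma Hinf0_decay:
  assumes "g \<in> Hinf0 \<sigma>" "0 < \<sigma>" "\<sigma> \<le> pi"
  obtains K e where "0 < e" "e \<le> 1" "0 \<le> K"
    "\<And>w. \<bar>Im w\<bar> < \<sigma> \<Longrightarrow> cmod (g (exp w)) \<le> K * decay e (Re w)"
proof -
  from assms(1) obtain \<epsilon> C where \<epsilon>: "\<epsilon> > 0"
    and C: "\<And>z. z \<in> sector \<sigma> \<Longrightarrow> max (cmod z powr \<epsilon>) (cmod z powr (- \<epsilon>)) * cmod (g z) \<le> C"
    unfolding Hinf0_def by blast
  show ?thesis
  proof (rule that[of "min \<epsilon> 1" "max C 0"])
    fix w assume w: "\<bar>Im w\<bar> < \<sigma>"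
    have "exp (\<epsilon> * \<bar>Re w\<bar>) = max (cmod (exp w) powr \<epsilon>) (cmod (exp w) powr (- \<epsilon>))"
    proof (cases "0 \<le> Re w")
      case True
      then have "- \<epsilon> * Re w \<le> \<epsilon> * Re w" using \<epsilon> by simp
      then show ?thesis using True by (simp add: powr_def max_def)
    next
      case False
      then have "\<epsilon> * Re w \<le> - \<epsilon> * Re w" using \<epsilon> by (simp add: mult_nonneg_nonpos)
      then show ?thesis using False by (simp add: powr_def max_def)
    qed
    with C[OF exp_in_sector[OF assms(2,3) w]] have "exp (\<epsilon> * \<bar>Re w\<bar>) * cmod (g (exp w)) \<le> max C 0" by simp
    then have "cmod (g (exp w)) \<le> max C 0 * exp (- \<epsilon> * \<bar>Re w\<bar>)"
      by (simp add: exp_minus field_simps)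
    also have "\<dots> \<le> max C 0 * exp (- min \<epsilon> 1 * \<bar>Re w\<bar>)"
      by (intro mult_left_mono) (auto intro: mult_right_mono)
    finally show "cmod (g (exp w)) \<le> max C 0 * exp (- min \<epsilon> 1 * \<bar>Re w\<bar>)" .
  qed (use \<epsilon> in auto)
qed

lemma Hinf0I:
  assumes h: "h holomorphic_on strip (- \<sigma>) \<sigma>" and s: "0 < \<sigma>" "\<sigma> \<le> pi" and e: "0 < e"
    and bd: "\<And>w. \<bar>Im w\<bar> < \<sigma> \<Longrightarrow> cmod (h w) \<le> K * decay e (Re w)"
    and g: "\<And>z. z \<in> sector \<sigma> \<Longrightarrow> g z = h (Ln z)"
  shows "g \<in> Hinf0 \<sigma>"
proof -
  have "(\<lambda>z. h (Ln z)) holomorphic_on sector \<sigma>"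
    by (rule holomorphic_on_compose_gen[OF _ h, unfolded o_def])
      (use sector_Ln[OF s(1)] in \<open>auto intro!: holomorphic_on_Ln simp: abs_less_iff minus_less_iff\<close>)
  then have hol: "g holomorphic_on sector \<sigma>" by (rule holomorphic_transform) (simp add: g)
  have "max (cmod z powr e) (cmod z powr (- e)) * cmod (g z) \<le> K" if z: "z \<in> sector \<sigma>" for z
  proof -
  have "max (cmod z powr e) (cmod z powr (- e)) \<le> exp (e * \<bar>Re (Ln z)\<bar>)"
    using sector_Ln[OF s(1) z] e by (auto simp: powr_def abs_if mult_less_0_iff)
  moreover have "cmod (g z) \<le> K * decay e (Re (Ln z))"
    unfolding g[OF z] by (rule bd) (rule sector_Ln[OF s(1) z])
  ultimately have "max (cmod z powr e) (cmod z powr (- e)) * cmod (g z)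
     \<le> exp (e * \<bar>Re (Ln z)\<bar>) * (K * decay e (Re (Ln z)))"
    by (intro mult_mono) (auto intro: order_trans[OF norm_ge_zero])
  also have "\<dots> = K" by (simp add: exp_minus)
  finally show ?thesis .
  qed
  then show ?thesis using hol e unfolding Hinf0_def by blast
qed

lemma Hinf0_mult_bounded:
  assumes "g \<in> Hinf0 \<sigma>" "f holomorphic_on sector \<sigma>" "\<And>z. z \<in> sector \<sigma> \<Longrightarrow> cmod (f z) \<le> B"
  shows "(\<lambda>z. f z * g z) \<in> Hinf0 \<sigma>"
proof -
  from assms(1) obtain \<epsilon> C where \<epsilon>: "\<epsilon> > 0" and g: "g holomorphic_on sector \<sigma>"
    and C: "\<And>z. z \<in> sector \<sigma> \<Longrightarrow> max (cmod z powr \<epsilon>) (cmod z powr (- \<epsilon>)) * cmod (g z) \<le> C"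
    unfolding Hinf0_def by blast
  have "max (cmod z powr \<epsilon>) (cmod z powr (- \<epsilon>)) * cmod (f z * g z) \<le> B * C" if z: "z \<in> sector \<sigma>" for z
  proof -
    have "cmod (f z) * (max (cmod z powr \<epsilon>) (cmod z powr (- \<epsilon>)) * cmod (g z)) \<le> B * C"
      using z by (intro mult_mono C assms(3)) (auto intro: order_trans[OF norm_ge_zero assms(3)] mult_nonneg_nonneg simp: le_max_iff_disj)
    then show ?thesis by (simp add: norm_mult mult_ac)
  qed
  moreover have "(\<lambda>z. f z * g z) holomorphic_on sector \<sigma>" by (intro holomorphic_intros g assms)
  ultimately show ?thesis using \<epsilon> unfolding Hinf0_def by blast
qed

lemma Hinf0_bounded:
  assumes "g \<in> Hinf0 \<sigma>" "0 < \<sigma>" "\<sigma> \<le> pi"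
  obtains B where "\<And>z. z \<in> sector \<sigma> \<Longrightarrow> cmod (g z) \<le> B"
proof -
  obtain K e where e: "0 < e" "0 \<le> K"
    and K: "\<And>w. \<bar>Im w\<bar> < \<sigma> \<Longrightarrow> cmod (g (exp w)) \<le> K * decay e (Re w)"
    using Hinf0_decay[OF assms] by metis
  have "cmod (g z) \<le> K" if "z \<in> sector \<sigma>" for z
  proof -
    have "cmod (g z) \<le> K * decay e (Re (Ln z))"
      using K[of "Ln z"] sector_Ln[OF assms(2) that] by simp
    also have "\<dots> \<le> K" using e by (intro mult_right_le_one_le) auto
    finally show ?thesis .
  qed
  then show ?thesis by (rule that)
qed

lemma Hinf0_mult:
  assumes "g \<in> Hinf0 \<sigma>" "f \<in> Hinf0 \<sigma>" "0 < \<sigma>" "\<sigma> \<le> pi"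
  shows "(\<lambda>z. f z * g z) \<in> Hinf0 \<sigma>"
proof -
  obtain B where B: "\<And>z. z \<in> sector \<sigma> \<Longrightarrow> cmod (f z) \<le> B"
    using Hinf0_bounded[OF assms(2-4)] by metis
  show ?thesis by (rule Hinf0_mult_bounded[OF assms(1) _ B]) (use assms(2) in \<open>auto simp: Hinf0_def\<close>)
qed

lemma Hinf0_dilate:
  assumes "g \<in> Hinf0 \<sigma>" "0 < \<sigma>" "\<sigma> \<le> pi"
  shows "(\<lambda>z. g (exp (of_real r) * z)) \<in> Hinf0 \<sigma>"
proof -
  obtain K e where e: "0 < e" "0 \<le> K"
    and K: "\<And>w. \<bar>Im w\<bar> < \<sigma> \<Longrightarrow> cmod (g (exp w)) \<le> K * decay e (Re w)"
    using Hinf0_decay[OF assms] by metis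
  show ?thesis
  proof (rule Hinf0I[where h = "\<lambda>w. g (exp (w + of_real r))"])
    have "(\<lambda>w. g (exp w)) holomorphic_on strip (- \<sigma>) \<sigma>"
      using holomorphic_on_sector_exp assms by (auto simp: Hinf0_def)
    from holomorphic_on_compose_gen[OF _ this, of "\<lambda>w. w + of_real r" "strip (- \<sigma>) \<sigma>", unfolded o_def]
    show "(\<lambda>w. g (exp (w + of_real r))) holomorphic_on strip (- \<sigma>) \<sigma>"
      by (rule, intro holomorphic_intros) auto
    show "cmod (g (exp (w + of_real r))) \<le> (K * exp (e * \<bar>r\<bar>)) * decay e (Re w)" if "\<bar>Im w\<bar> < \<sigma>" for w
    proof -
      have "cmod (g (exp (w + of_real r))) \<le> K * decay e (Re w + r)" using K[of "w + of_real r"] that by simp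
      also have "\<dots> \<le> K * exp (e * \<bar>r\<bar> - e * \<bar>Re w\<bar>)"
      proof -
        have "e * \<bar>Re w\<bar> \<le> e * (\<bar>Re w + r\<bar> + \<bar>r\<bar>)" using e by (intro mult_left_mono) auto
        then show ?thesis using e by (intro mult_left_mono) (auto simp: algebra_simps)
      qed
      finally show ?thesis by (simp add: exp_diff exp_minus field_simps)
    qed
    show "g (exp (of_real r) * z) = g (exp (Ln z + of_real r))" if "z \<in> sector \<sigma>" for z
      using sector_Ln[OF assms(2) that] by (simp add: exp_add mult.commute)
  qed (use assms e in auto)
qed

lemma sector_mono:
  assumes "0 \<le> \<sigma>" "\<sigma> \<le> \<tau>"
  shows "sector \<sigma> \<subseteq> sector \<tau>"
  using assms by (auto simp: sector_def Arg_of_real complex_nonpos_Reals_iff)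

lemma Hinf0_mono: "0 \<le> \<sigma> \<Longrightarrow> \<sigma> \<le> \<tau> \<Longrightarrow> Hinf0 \<tau> \<subseteq> Hinf0 \<sigma>"
  using sector_mono[of \<sigma> \<tau>] holomorphic_on_subset[of _ "sector \<tau>" "sector \<sigma>"]
  unfolding Hinf0_def by (auto; meson subsetD)

text \<open>\<open>\<sigma> < pi\<close> keeps the sector away from the double pole at
  \<open>-1\<close>; the positive constant \<open>s = cos (\<sigma> / 2)\<close> measures the
  distance.\<close>

lemma regularizer_Hinf0:
  assumes "0 < \<sigma>" "\<sigma> < pi"
  shows "regularizer \<in> Hinf0 \<sigma>"
proof (rule Hinf0I)
  let ?h = "\<lambda>w. exp w / (1 + exp w)\<^sup>2 :: complex"
  define s where "s = cos (\<sigma> / 2)"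
  have s: "0 < s" unfolding s_def by (intro cos_gt_zero_pi) (use assms in auto)
  have low: "(exp (Re w) + 1) * s \<le> cmod (1 + exp w)" if "\<bar>Im w\<bar> < \<sigma>" for w
    unfolding s_def using cmod_exp_plus_one_ge[of w \<sigma>] that assms by (simp add: add.commute)
  have pos: "0 < (exp (Re w) + 1) * s" for w using s by (intro mult_pos_pos add_pos_pos) auto
  show "?h holomorphic_on strip (- \<sigma>) \<sigma>"
    using low pos by (intro holomorphic_intros) (auto simp: abs_less_iff, smt (verit) norm_zero)
  show "cmod (?h w) \<le> (1 / s\<^sup>2) * decay 1 (Re w)" if "\<bar>Im w\<bar> < \<sigma>" for w
  proof -
    have "cmod (?h w) = exp (Re w) / (cmod (1 + exp w))\<^sup>2" by (simp add: norm_divide norm_power)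
    also have "\<dots> \<le> exp (Re w) / ((exp (Re w) + 1) * s)\<^sup>2"
      using low[OF that] pos[of w] by (intro frac_le power_mono zero_less_power) auto
    also have "\<dots> = (1 / s\<^sup>2) * (exp (Re w) / ((exp (Re w) + 1) * (exp (Re w) + 1)))"
      by (simp add: power2_eq_square)
    also have "\<dots> \<le> (1 / s\<^sup>2) * (max 1 (1 / (1 * 1)) * exp (- \<bar>Re w\<bar>))"
      by (intro mult_left_mono exp_quotient_decay) auto
    finally show ?thesis by simp
  qed
  show "regularizer z = ?h (Ln z)" if "z \<in> sector \<sigma>" for z
    using sector_Ln[OF assms(1) that] by (simp add: regularizer_def)
qed (use assms in auto)

lemma abs_sin_ge:
  assumes "0 \<le> d" "d \<le> \<bar>x\<bar>" "\<bar>x\<bar> \<le> pi - d"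
  shows "sin d \<le> \<bar>sin x\<bar>"
proof -
  have "sin d \<le> sin \<bar>x\<bar>"
  proof (cases "\<bar>x\<bar> \<le> pi / 2")
    case True
    then show ?thesis using assms by (intro sin_monotone_2pi_le) auto
  next
    case False
    then have "sin d \<le> sin (pi - \<bar>x\<bar>)" using assms by (intro sin_monotone_2pi_le) auto
    then show ?thesis by simp
  qed
  also have "\<dots> \<le> \<bar>sin x\<bar>" by (cases "0 \<le> x") auto
  finally show ?thesis .
qed

text \<open>With the weight in front, the left-hand side is the sum of the moduli of
  \<open>exp w\<close> and \<open>exp v\<close> divided by their distance, to which
  \<open>cmod_exp_diff_ge\<close> applies. The weight is at least 1, so the kernel itself is
  bounded; it also records the decay to the left.\<close>

lemma cauchy_kernel_bound:
  assumes "0 < d" "d < pi" "d \<le> \<bar>Im w - Im v\<bar> / 2" "\<bar>Im w - Im v\<bar> / 2 \<le> pi - d"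
  shows "(1 + exp (Re (v - w))) * cmod (cauchy_kernel v w) \<le> 1 / sin d" and "exp w \<noteq> exp v"
proof -
  have sd: "0 < sin d" using assms by (intro sin_gt_zero) auto
  have "sin d \<le> \<bar>sin ((Im w - Im v) / 2)\<bar>" using assms by (intro abs_sin_ge) auto
  then have "(exp (Re w) + exp (Re v)) * sin d \<le> (exp (Re w) + exp (Re v)) * \<bar>sin ((Im w - Im v) / 2)\<bar>"
    by (intro mult_left_mono) auto
  also have "\<dots> \<le> cmod (exp w - exp v)" by (rule cmod_exp_diff_ge)
  finally have le: "(exp (Re w) + exp (Re v)) * sin d \<le> cmod (exp w - exp v)" .
  have pos: "0 < (exp (Re w) + exp (Re v)) * sin d" using sd by (intro mult_pos_pos add_pos_pos) auto
  with le show "exp w \<noteq> exp v" by auto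
  have "(1 + exp (Re (v - w))) * cmod (cauchy_kernel v w) = (exp (Re w) + exp (Re v)) / cmod (exp w - exp v)"
  proof -
    have "(1 + exp (Re (v - w))) * exp (Re w) = exp (Re w) + exp (Re v)"
      by (simp add: distrib_right flip: exp_add)
    then show ?thesis by (simp add: cauchy_kernel_def norm_divide)
  qed
  also have "\<dots> \<le> (exp (Re w) + exp (Re v)) / ((exp (Re w) + exp (Re v)) * sin d)"
    using le pos by (intro frac_le) auto
  also have "\<dots> = 1 / sin d" using exp_gt_zero[of "Re w"] exp_gt_zero[of "Re v"] by (simp add: add_pos_pos less_imp_neq[symmetric])
  finally show "(1 + exp (Re (v - w))) * cmod (cauchy_kernel v w) \<le> 1 / sin d" .
qed

section \<open>The functional calculus of a sectorial operator\<close>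

text \<open>\<open>L\<close> is a set of functionals on which equality of two values of the calculus
  is checked. All contours will have an angle above \<open>\<theta>\<close>, so they can be moved a
  little without leaving the resolvent set, and \<open>C\<close> bounds \<open>z R(z)\<close>
  uniformly off the sector of angle \<open>\<theta>\<close>.\<close>

locale sectorial_operator =
  fixes A :: "('x::complex_banach \<times> 'x) set" and \<theta> C :: real and L :: "('x \<Rightarrow> complex) set"
  assumes linear_op: "linear_operator A"
    and angle: "0 < \<theta>" "\<theta> < pi"
    and resolvent_set: "z \<notin> closure (sector \<theta>) \<Longrightarrow> z \<notin> op_spectrum A"
    and resolvent_bound: "z \<notin> closure (sector \<theta>) \<Longrightarrow> norm (z *\<^sub>C resolvent z A x) \<le> C * norm x"
    and functional: "l \<in> L \<Longrightarrow> clinear_functional l"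
    and separating: "(\<And>l. l \<in> L \<Longrightarrow> l x = 0) \<Longrightarrow> x = 0"
begin

abbreviation R where "R z \<equiv> resolvent z A"

definition off :: "complex set" where "off = {z. z \<noteq> 0 \<and> z \<notin> closure (sector \<theta>)}"

lemma open_off: "open off"
proof -
  have "off = - closure (sector \<theta>) - {0}" by (auto simp: off_def)
  then show ?thesis by (auto intro: open_Diff)
qed

lemma offD: "z \<in> off \<Longrightarrow> z \<noteq> 0" "z \<in> off \<Longrightarrow> z \<notin> closure (sector \<theta>)"
  by (auto simp: off_def)

lemma exp_off: "\<theta> < \<bar>Im w\<bar> \<Longrightarrow> \<bar>Im w\<bar> < 2 * pi - \<theta> \<Longrightarrow> exp w \<in> off"
  using exp_notin_closure_sector[OF angle] by (auto simp: off_def)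

lemma minus_one_off: "- 1 \<in> off"
  using exp_off[of "\<i> * of_real pi"] angle by simp

lemma resolvent_in: "z \<in> off \<Longrightarrow> (R z y, z *\<^sub>C R z y - y) \<in> A"
proof -
  assume "z \<in> off"
  then have "\<exists>!x. \<exists>u. (x, u) \<in> A \<and> z *\<^sub>C x - u = y"
    using resolvent_set by (auto simp: off_def op_spectrum_def)
  from theI'[OF this] obtain u where "(R z y, u) \<in> A" "z *\<^sub>C R z y - u = y"
    unfolding resolvent_def by blast
  then show ?thesis by (metis add_diff_cancel_left' diff_add_cancel)
qed

lemma resolvent_eq: "z \<in> off \<Longrightarrow> (x, u) \<in> A \<Longrightarrow> R z (z *\<^sub>C x - u) = x"
proof -
  assume z: "z \<in> off" and x: "(x, u) \<in> A"
  then have "\<exists>!x'. \<exists>u'. (x', u') \<in> A \<and> z *\<^sub>C x' - u' = z *\<^sub>C x - u"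
    using resolvent_set by (auto simp: off_def op_spectrum_def)
  then show ?thesis unfolding resolvent_def by (rule the1_equality) (use x in blast)
qed

lemma resolvent_clinear: "z \<in> off \<Longrightarrow> bounded_clinear (R z)"
  using resolvent_set by (auto simp: off_def op_spectrum_def)

lemma resolvent_linear:
  assumes "z \<in> off"
  shows "R z (x + y) = R z x + R z y" "R z (x - y) = R z x - R z y" "R z (- x) = - R z x"
    "R z (c *\<^sub>C x) = c *\<^sub>C R z x" "R z 0 = 0" "bounded_linear (R z)"
proof -
  from resolvent_clinear[OF assms] interpret bounded_linear "R z"
    by (simp add: bounded_clinear_def)
  show "R z (x + y) = R z x + R z y" "R z (x - y) = R z x - R z y" "R z (- x) = - R z x" "R z 0 = 0"
    using diff[of 0 x] by (auto simp: add diff zero)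
  show "R z (c *\<^sub>C x) = c *\<^sub>C R z x" "bounded_linear (R z)"
    using resolvent_clinear[OF assms] by (auto simp: bounded_clinear_def)
qed

lemma resolvent_norm: "z \<in> off \<Longrightarrow> norm (R z x) \<le> C * norm x / cmod z"
  using resolvent_bound[of z x] by (simp add: off_def norm_scaleC field_simps)

lemma resolvent_identity:
  assumes "z \<in> off" "m \<in> off"
  shows "R z y = R m y + (m - z) *\<^sub>C R z (R m y)"
proof -
  have "R z (z *\<^sub>C R m y - (m *\<^sub>C R m y - y)) = R m y"
    by (rule resolvent_eq[OF assms(1) resolvent_in[OF assms(2)]])
  then have "R z ((z - m) *\<^sub>C R m y + y) = R m y"
    by (simp add: scaleC.diff_left algebra_simps)
  then have "(z - m) *\<^sub>C R z (R m y) + R z y = R m y"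
    by (simp add: resolvent_linear[OF assms(1)])
  then have "R z y = R m y - (z - m) *\<^sub>C R z (R m y)"
    by (metis add_diff_cancel_left')
  then show ?thesis by (simp add: scaleC.diff_left)
qed

text \<open>The zero space would allow a negative \<open>C\<close>; hence the restriction to nonzero
  \<open>x\<close>, and \<open>Cn_nonneg\<close> for the product that occurs in the
  estimates.\<close>

lemma C_nonneg: "(x :: 'x) \<noteq> 0 \<Longrightarrow> 0 \<le> C"
  using resolvent_bound[of "-1" x] minus_one_off norm_ge_zero[of "- 1 *\<^sub>C R (- 1) x"]
  by (smt (verit) offD(2) mult_neg_pos zero_less_norm_iff)

lemma Cn_nonneg: "0 \<le> C * norm (x :: 'x)"
  using C_nonneg[of x] by (cases "x = 0") auto

lemma continuous_resolvent: "continuous_on off (\<lambda>z. R z x)"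
proof (rule continuous_at_imp_continuous_on, intro ballI)
  fix m assume m: "m \<in> off"
  have ev: "\<forall>\<^sub>F z in at m. z \<in> off"
    using eventually_nhds_in_open[OF open_off m] by (simp add: eventually_at_filter eventually_mono)
  have "((\<lambda>z. R z x - R m x) \<longlongrightarrow> 0) (at m)"
  proof (rule Lim_null_comparison)
    show "\<forall>\<^sub>F z in at m. norm (R z x - R m x) \<le> cmod (m - z) * (C * (norm (R m x)) / cmod z)"
      using ev
    proof eventually_elim
      case (elim z)
      have "R z x - R m x = (m - z) *\<^sub>C R z (R m x)" by (subst resolvent_identity[OF elim m]) simp
      then have "norm (R z x - R m x) = cmod (m - z) * norm (R z (R m x))" by (simp add: norm_scaleC)
      also have "\<dots> \<le> cmod (m - z) * (C * norm (R m x) / cmod z)"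
        by (intro mult_left_mono resolvent_norm elim) auto
      finally show ?case .
    qed
    have "((\<lambda>z. cmod (m - z) * (C * (norm (R m x)) / cmod z)) \<longlongrightarrow> cmod (m - m) * (C * (norm (R m x)) / cmod m)) (at m)"
      using offD(1)[OF m] by (intro tendsto_intros) auto
    then show "((\<lambda>z. cmod (m - z) * (C * (norm (R m x)) / cmod z)) \<longlongrightarrow> 0) (at m)" by simp
  qed
  then show "isCont (\<lambda>z. R z x) m" unfolding isCont_def by (rule LIM_zero_cancel)
qed

text \<open>By the resolvent identity the difference quotient at \<open>m\<close> is
  \<open>- l (R z (R m x))\<close>, which converges by continuity of the resolvent.\<close>

lemma holomorphic_resolvent:
  assumes l: "clinear_functional l"
  shows "(\<lambda>z. l (R z x)) holomorphic_on off"
proof (rule holomorphic_onI)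
  from l interpret l: bounded_linear l by (simp add: clinear_functional_def)
  have lc: "l (c *\<^sub>C y) = c * l y" for c y using l by (simp add: clinear_functional_def)
  fix m assume m: "m \<in> off"
  have ev: "\<forall>\<^sub>F z in at m. z \<in> off"
    using eventually_nhds_in_open[OF open_off m] by (simp add: eventually_at_filter eventually_mono)
  have "((\<lambda>z. R z (R m x)) \<longlongrightarrow> R m (R m x)) (at m)"
    using continuous_resolvent[of "R m x"] m open_off
    by (simp add: continuous_on_eq_continuous_at isCont_def)
  then have "((\<lambda>z. - l (R z (R m x))) \<longlongrightarrow> - l (R m (R m x))) (at m)"
    by (intro tendsto_minus l.tendsto)
  then have "((\<lambda>z. (l (R z x) - l (R m x)) / (z - m)) \<longlongrightarrow> - l (R m (R m x))) (at m)"
  proof (rule Lim_transform_eventually)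
    have "\<forall>\<^sub>F z in at m. z \<noteq> m" by (simp add: eventually_at_filter)
    with ev show "\<forall>\<^sub>F z in at m. - l (R z (R m x)) = (l (R z x) - l (R m x)) / (z - m)"
    proof eventually_elim
      case (elim z)
      have "l (R z x) = l (R m x) + (m - z) * l (R z (R m x))"
        by (subst resolvent_identity[OF elim(1) m]) (simp add: l.add lc)
      then show ?case using elim(2) by (simp add: field_simps)
    qed
  qed
  then have "((\<lambda>z. l (R z x)) has_field_derivative - l (R m (R m x))) (at m)"
    by (simp add: has_field_derivative_iff)
  then show "(\<lambda>z. l (R z x)) field_differentiable at m within off"
    using field_differentiable_at_within field_differentiable_def by blast
qed

text \<open>This is \<open>z R(z) x\<close> at \<open>z = exp w\<close>. The factor \<open>z\<close>
  is the derivative \<open>dz/dw\<close> of the parametrisation and at the same time what makes the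
  function bounded by \<open>C * norm x\<close>.\<close>

definition U :: "'x \<Rightarrow> complex \<Rightarrow> 'x" where "U x w = exp w *\<^sub>C R (exp w) x"

lemma U_norm: "exp w \<in> off \<Longrightarrow> norm (U x w) \<le> C * norm x"
  unfolding U_def by (rule resolvent_bound[OF offD(2)])

lemma U_continuous_line:
  assumes "\<theta> < \<bar>a\<bar>" "\<bar>a\<bar> < 2 * pi - \<theta>"
  shows "continuous_on UNIV (\<lambda>t. U x (Complex t a))"
  unfolding U_def
proof (intro scaleC.continuous_on)
  have c: "continuous_on UNIV (\<lambda>t. exp (Complex t a))"
    unfolding Complex_eq by (intro continuous_intros)
  then show "continuous_on UNIV (\<lambda>t. exp (Complex t a))" .
  show "continuous_on UNIV (\<lambda>t. R (exp (Complex t a)) x)"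
    by (rule continuous_on_compose2[OF continuous_resolvent c]) (use exp_off assms in auto)
qed

lemma U_holomorphic:
  assumes "clinear_functional l" "\<And>w. w \<in> S \<Longrightarrow> exp w \<in> off"
  shows "(\<lambda>w. l (U x w)) holomorphic_on S"
proof -
  have "l (U x w) = exp w * l (R (exp w) x)" for w
    using assms(1) by (simp add: U_def clinear_functional_def)
  moreover have "(\<lambda>w. l (R (exp w) x)) holomorphic_on S"
    by (rule holomorphic_on_compose_gen[OF holomorphic_on_exp holomorphic_resolvent[OF assms(1)], unfolded o_def])
      (use assms(2) in auto)
  ultimately show ?thesis by (simp add: holomorphic_intros)
qed

lemma U_functional_bound:
  assumes "clinear_functional l"
  obtains B where "0 \<le> B" "\<And>w. exp w \<in> off \<Longrightarrow> cmod (l (U x w)) \<le> B"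
proof -
  from assms have "bounded_linear l" by (simp add: clinear_functional_def)
  then obtain B where B: "\<And>y. cmod (l y) \<le> norm y * B" "0 \<le> B"
    using bounded_linear.nonneg_bounded by blast
  show ?thesis
  proof (rule that)
    show "0 \<le> (C * norm x) * B" using Cn_nonneg B(2) by simp
    show "cmod (l (U x w)) \<le> (C * norm x) * B" if "exp w \<in> off" for w
      using order_trans[OF B(1) mult_right_mono[OF U_norm[OF that] B(2)]] .
  qed
qed

lemma calc_eq:
  "Hinf0_calc A a g x = (1 / (2 * of_real pi * \<i>)) *\<^sub>C
     integral UNIV (\<lambda>t. g (exp (Complex t (- a))) *\<^sub>C U x (Complex t (- a)) - g (exp (Complex t a)) *\<^sub>C U x (Complex t a))"
  by (simp add: Hinf0_calc_def U_def scaleC_scaleC)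

lemma ray_bound:
  assumes g: "\<And>w. \<bar>Im w\<bar> < \<sigma> \<Longrightarrow> cmod (g (exp w)) \<le> K * decay e (Re w)"
    and a: "\<theta> < \<bar>a\<bar>" "\<bar>a\<bar> < \<sigma>" "\<sigma> \<le> pi"
  shows "norm (g (exp (Complex t a)) *\<^sub>C U x (Complex t a)) \<le> (K * (C * norm x)) * decay e t"
proof -
  have off: "exp (Complex t a) \<in> off" using a angle by (intro exp_off) auto
  have "norm (g (exp (Complex t a)) *\<^sub>C U x (Complex t a)) = cmod (g (exp (Complex t a))) * norm (U x (Complex t a))"
    by (simp add: norm_scaleC)
  also have "\<dots> \<le> (K * decay e t) * (C * norm x)"
    using g[of "Complex t a"] a by (intro mult_mono U_norm off) (auto intro: order_trans[OF norm_ge_zero])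
  finally show ?thesis by (simp add: mult_ac)
qed

lemma ray_continuous:
  assumes "g holomorphic_on sector \<sigma>" and "\<theta> < \<bar>a\<bar>" "\<bar>a\<bar> < \<sigma>" "\<sigma> \<le> pi"
  shows "continuous_on UNIV (\<lambda>t. g (exp (Complex t a)) *\<^sub>C U x (Complex t a))"
proof (rule scaleC.continuous_on)
  show "continuous_on UNIV (\<lambda>t. g (exp (Complex t a)))"
    by (rule continuous_on_line[OF holomorphic_on_sector_exp[OF assms(1)]]) (use assms in auto)
  show "continuous_on UNIV (\<lambda>t. U x (Complex t a))"
    by (rule U_continuous_line) (use assms angle in auto)
qed

lemma ray_integrable:
  assumes g: "g \<in> Hinf0 \<sigma>" and a: "\<theta> < \<bar>a\<bar>" "\<bar>a\<bar> < \<sigma>" "\<sigma> \<le> pi"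
  shows "(\<lambda>t. g (exp (Complex t a)) *\<^sub>C U x (Complex t a)) integrable_on UNIV"
proof -
  obtain K e where e: "0 < e"
    and K: "\<And>w. \<bar>Im w\<bar> < \<sigma> \<Longrightarrow> cmod (g (exp w)) \<le> K * decay e (Re w)"
    using Hinf0_decay[OF g] a by (metis abs_ge_zero le_less_trans)
  show ?thesis
    by (rule integrable_UNIV_dominated[OF ray_continuous _ ray_bound[OF K a]])
      (use g a e in \<open>auto simp: Hinf0_def intro!: integrable_on_mult_right exp_decay_integrable[OF e, simplified]\<close>)
qed

lemma calc_split:
  assumes g: "g \<in> Hinf0 \<sigma>" and a: "\<theta> < a" "a < \<sigma>" "\<sigma> \<le> pi"
  shows "Hinf0_calc A a g x = (1 / (2 * of_real pi * \<i>)) *\<^sub>C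
     (integral UNIV (\<lambda>t. g (exp (Complex t (- a))) *\<^sub>C U x (Complex t (- a)))
      - integral UNIV (\<lambda>t. g (exp (Complex t a)) *\<^sub>C U x (Complex t a)))"
  unfolding calc_eq using a angle
  by (subst integral_diff[OF ray_integrable[OF g] ray_integrable[OF g]]) auto

lemma calc_functional:
  assumes g: "g \<in> Hinf0 \<sigma>" and a: "\<theta> < a" "a < \<sigma>" "\<sigma> \<le> pi" and l: "clinear_functional l"
  shows "l (Hinf0_calc A a g x) = (1 / (2 * of_real pi * \<i>)) *
     (integral UNIV (\<lambda>t. g (exp (Complex t (- a))) * l (U x (Complex t (- a))))
      - integral UNIV (\<lambda>t. g (exp (Complex t a)) * l (U x (Complex t a))))"
proof -
  from l interpret l: bounded_linear l by (simp add: clinear_functional_def)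
  have lc: "l (c *\<^sub>C y) = c * l y" for c y using l by (simp add: clinear_functional_def)
  have "l (integral UNIV (\<lambda>t. g (exp (Complex t b)) *\<^sub>C U x (Complex t b)))
    = integral UNIV (\<lambda>t. g (exp (Complex t b)) * l (U x (Complex t b)))" if "\<bar>b\<bar> = a" for b
    using integral_linear[OF ray_integrable[OF g, of b] l.bounded_linear_axioms] a that
    by (simp add: o_def lc)
  from this[of a] this[of "- a"] show ?thesis
    unfolding calc_split[OF g a] lc l.diff using a angle by simp
qed

lemma eq_functionalI:
  assumes "\<And>l. l \<in> L \<Longrightarrow> l x = l y"
  shows "x = y"
proof -
  have "x - y = 0"
  proof (rule separating)
    fix l assume l: "l \<in> L"
    from functional[OF l] interpret l: bounded_linear l by (simp add: clinear_functional_def)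
    show "l (x - y) = 0" using assms[OF l] by (simp add: l.diff)
  qed
  then show ?thesis by simp
qed

lemma calc_diff:
  assumes g: "g \<in> Hinf0 \<sigma>" and a: "\<theta> < a" "a < \<sigma>" "\<sigma> \<le> pi"
  shows "Hinf0_calc A a g (x - y) = Hinf0_calc A a g x - Hinf0_calc A a g y"
proof (rule eq_functionalI)
  fix l assume "l \<in> L"
  then have l: "clinear_functional l" by (rule functional)
  then interpret l: bounded_linear l by (simp add: clinear_functional_def)
  have "integral UNIV (\<lambda>t. g (exp (Complex t b)) * l (U (x - y) (Complex t b)))
    = integral UNIV (\<lambda>t. g (exp (Complex t b)) * l (U x (Complex t b)))
      - integral UNIV (\<lambda>t. g (exp (Complex t b)) * l (U y (Complex t b)))" if b: "\<bar>b\<bar> = a" for b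
  proof -
    have i: "(\<lambda>t. g (exp (Complex t b)) * l (U z (Complex t b))) integrable_on UNIV" for z
      using integrable_linear[OF ray_integrable[OF g, of b z] l.bounded_linear_axioms] a b l
      by (simp add: o_def clinear_functional_def)
    have "U (x - y) (Complex t b) = U x (Complex t b) - U y (Complex t b)" for t
    proof -
      have "exp (Complex t b) \<in> off" using a b angle by (intro exp_off) auto
      then show ?thesis by (simp add: U_def resolvent_linear scaleC.diff_right)
    qed
    then show ?thesis by (simp add: l.diff right_diff_distrib integral_diff[OF i i])
  qed
  note * = this
  have "\<bar>a\<bar> = a" "\<bar>- a\<bar> = a" using a angle by auto
  note ** = *[OF this(1)] *[OF this(2)]
  show "l (Hinf0_calc A a g (x - y)) = l (Hinf0_calc A a g x - Hinf0_calc A a g y)"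
    unfolding l.diff calc_functional[OF g a l] ** by (simp add: algebra_simps)
qed

text \<open>The two rays are moved separately, in the strips above \<open>\<theta>\<close> and below
  \<open>- \<theta>\<close>; between these the resolvent need not exist.\<close>

lemma calc_angle:
  assumes g: "g \<in> Hinf0 \<sigma>" and ab: "\<theta> < a" "a \<le> b" "b < \<sigma>" "\<sigma> \<le> pi"
  shows "Hinf0_calc A a g x = Hinf0_calc A b g x"
proof (rule eq_functionalI)
  fix l assume "l \<in> L"
  then have l: "clinear_functional l" by (rule functional)
  have s: "0 < \<sigma>" using ab angle by linarith
  obtain K e where e: "0 < e" and Kp: "0 \<le> K"
    and K: "\<And>w. \<bar>Im w\<bar> < \<sigma> \<Longrightarrow> cmod (g (exp w)) \<le> K * decay e (Re w)"
    using Hinf0_decay[OF g s ab(4)] by metis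
  obtain B where B: "0 \<le> B" "\<And>w. exp w \<in> off \<Longrightarrow> cmod (l (U x w)) \<le> B"
    using U_functional_bound[OF l] by metis
  let ?F = "\<lambda>w. g (exp w) * l (U x w)"
  have gh: "(\<lambda>w. g (exp w)) holomorphic_on strip (- \<sigma>) \<sigma>"
    using g by (intro holomorphic_on_sector_exp s ab) (simp add: Hinf0_def)
  have bd: "cmod (?F w) \<le> (K * B) * decay e (Re w)" if "\<theta> < \<bar>Im w\<bar>" "\<bar>Im w\<bar> < \<sigma>" for w
  proof -
    have "cmod (?F w) \<le> (K * decay e (Re w)) * B"
      unfolding norm_mult using that ab angle Kp by (intro mult_mono K B(2) exp_off) auto
    then show ?thesis by (simp add: mult_ac)
  qed
  have hol: "?F holomorphic_on S" if "S \<subseteq> strip (- \<sigma>) \<sigma>" "\<And>w. w \<in> S \<Longrightarrow> \<theta> < \<bar>Im w\<bar>" for S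
    using that ab angle
    by (intro holomorphic_on_mult holomorphic_on_subset[OF gh that(1)] U_holomorphic[OF l] exp_off)
      (auto simp: abs_less_iff dest!: subsetD)
  have up: "integral UNIV (\<lambda>t. ?F (Complex t a)) = integral UNIV (\<lambda>t. ?F (Complex t b))"
    by (rule strip_shift[OF hol[of "strip \<theta> \<sigma>"] e _ _ _ bd]) (use ab angle in auto)
  have dn: "integral UNIV (\<lambda>t. ?F (Complex t (- b))) = integral UNIV (\<lambda>t. ?F (Complex t (- a)))"
    by (rule strip_shift[OF hol[of "strip (- \<sigma>) (- \<theta>)"] e _ _ _ bd]) (use ab angle in auto)
  show "l (Hinf0_calc A a g x) = l (Hinf0_calc A b g x)"
    using ab up dn by (subst (1 2) calc_functional[OF g _ _ ab(4) l]) auto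
qed

end

section \<open>Multiplicativity of the calculus\<close>

context sectorial_operator
begin

text \<open>The resolvent identity in partial fractions: the product of \<open>z R(z)\<close> at two
  points is a combination of its values at these points, and the coefficients are the two Cauchy
  kernels.\<close>

lemma resolvent_product:
  assumes v: "exp v \<in> off" and w: "exp w \<in> off" and ne: "exp w \<noteq> exp v" and l: "clinear_functional l"
  shows "exp v * l (R (exp v) (U x w)) = cauchy_kernel v w * l (U x v) + cauchy_kernel w v * l (U x w)"
proof -
  from l interpret l: bounded_linear l by (simp add: clinear_functional_def)
  have lc: "l (c *\<^sub>C y) = c * l y" for c y using l by (simp add: clinear_functional_def)
  define rv rw rr where "rv = l (R (exp v) x)" and "rw = l (R (exp w) x)" and "rr = l (R (exp v) (R (exp w) x))"
  have "rv = rw + (exp w - exp v) * rr"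
    unfolding rv_def rw_def rr_def by (subst resolvent_identity[OF v w]) (simp add: l.add lc)
  then have "(exp w - exp v) * rr = rv - rw" by simp
  then have rr: "rr = (rv - rw) / (exp w - exp v)" using ne by (simp add: eq_divide_eq mult.commute)
  have d: "exp w - exp v \<noteq> 0" "exp v - exp w \<noteq> 0" using ne by auto
  have "exp v * (exp w * ((rv - rw) / (exp w - exp v))) = exp w / (exp w - exp v) * (exp v * rv) + exp v / (exp v - exp w) * (exp w * rw)"
  proof -
    have "exp v / (exp v - exp w) = - (exp v / (exp w - exp v))"
      by (metis minus_diff_eq minus_divide_right)
    then show ?thesis by (simp add: algebra_simps diff_divide_distrib)
  qed
  then show ?thesis
    by (simp add: cauchy_kernel_def U_def resolvent_linear[OF v] lc flip: rv_def rw_def rr_def) (simp add: rr)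
qed

text \<open>Take the inner contour for \<open>g\<close>. After the resolvent identity, Cauchy's formula evaluates one
  term, and the other one vanishes by Fubini, since \<open>g\<close> times the kernel has no pole inside.\<close>

lemma calc_mult:
  assumes g: "g \<in> Hinf0 \<sigma>" and h: "h \<in> Hinf0 \<sigma>" and a: "\<theta> < a" "a < \<sigma>" "\<sigma> \<le> pi"
  shows "Hinf0_calc A a g (Hinf0_calc A a h x) = Hinf0_calc A a (\<lambda>z. g z * h z) x"
proof (rule eq_functionalI)
  fix l assume "l \<in> L"
  then have l: "clinear_functional l" by (rule functional)
  \<comment> \<open>The contour of \<open>g\<close> will be moved to the angle \<open>b\<close>,
    halfway between \<open>\<theta>\<close> and \<open>a\<close>, so that its points lie inside the
    contour of \<open>h\<close>. Below, \<open>d\<close> is half the gap, and kernels between the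
    two contours are bounded by \<open>1 / sin d\<close>.\<close>
  define b where "b = (\<theta> + a) / 2"
  have b: "\<theta> < b" "b < a" "0 < b" using a angle by (auto simp: b_def)
  define d where "d = (a - b) / 2"
  have d: "0 < d" "d < pi" using b a angle by (auto simp: d_def)
  have sd: "0 < sin d" using d by (intro sin_gt_zero)
  have s: "0 < \<sigma>" using a angle by linarith
  have gh: "(\<lambda>z. g z * h z) \<in> Hinf0 \<sigma>" using Hinf0_mult[OF h g s a(3)] .
  obtain K1 e1 where e1: "0 < e1" "0 \<le> K1"
    and K1: "\<And>w. \<bar>Im w\<bar> < \<sigma> \<Longrightarrow> cmod (g (exp w)) \<le> K1 * decay e1 (Re w)"
    using Hinf0_decay[OF g s a(3)] by metis
  obtain K2 e2 where e2: "0 < e2" "e2 \<le> 1" "0 \<le> K2"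
    and K2: "\<And>w. \<bar>Im w\<bar> < \<sigma> \<Longrightarrow> cmod (h (exp w)) \<le> K2 * decay e2 (Re w)"
    using Hinf0_decay[OF h s a(3)] by metis
  define u where "u w = l (U x w)" for w
  obtain B where B: "0 \<le> B" "\<And>w. exp w \<in> off \<Longrightarrow> cmod (u w) \<le> B"
    unfolding u_def using U_functional_bound[OF l] by metis
  have offl: "exp (Complex t c) \<in> off" if "\<bar>c\<bar> = a \<or> \<bar>c\<bar> = b" for t c
    using that a b angle by (intro exp_off) auto
  have kb: "cmod (cauchy_kernel v w) \<le> 1 / sin d" "exp w \<noteq> exp v"
    if "(\<bar>Im w\<bar> = a \<and> \<bar>Im v\<bar> \<le> b) \<or> (\<bar>Im v\<bar> = a \<and> \<bar>Im w\<bar> \<le> b)" for v w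
  proof -
    have c: "d \<le> \<bar>Im w - Im v\<bar> / 2" "\<bar>Im w - Im v\<bar> / 2 \<le> pi - d"
    proof -
      have "a - b \<le> \<bar>Im w - Im v\<bar>" "\<bar>Im w - Im v\<bar> \<le> a + b" using that by arith+
      then show "d \<le> \<bar>Im w - Im v\<bar> / 2" "\<bar>Im w - Im v\<bar> / 2 \<le> pi - d"
        using a by (simp_all add: d_def field_simps)
    qed
    show "exp w \<noteq> exp v" by (rule cauchy_kernel_bound(2)[OF d c])
    have "1 * cmod (cauchy_kernel v w) \<le> (1 + exp (Re (v - w))) * cmod (cauchy_kernel v w)"
      by (intro mult_right_mono) auto
    then show "cmod (cauchy_kernel v w) \<le> 1 / sin d"
      using cauchy_kernel_bound(1)[OF d c] by linarith
  qed
  have cexp: "continuous_on UNIV (\<lambda>t. exp (Complex t c))" for c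
    unfolding Complex_eq by (intro continuous_intros)
  have gc: "continuous_on UNIV (\<lambda>t. g (exp (Complex t c)))" if "\<bar>c\<bar> = b" for c
    by (rule continuous_on_line[OF holomorphic_on_sector_exp[of _ \<sigma>]]) (use g a b s that in \<open>auto simp: Hinf0_def\<close>)
  have hc: "continuous_on UNIV (\<lambda>t. h (exp (Complex t c)))" if "\<bar>c\<bar> = a" for c
    by (rule continuous_on_line[OF holomorphic_on_sector_exp[of _ \<sigma>]]) (use h a b s that in \<open>auto simp: Hinf0_def\<close>)
  have uc: "continuous_on UNIV (\<lambda>t. u (Complex t c))" if "\<bar>c\<bar> = a \<or> \<bar>c\<bar> = b" for c
  proof -
    from l interpret l: bounded_linear l by (simp add: clinear_functional_def)
    show ?thesis unfolding u_def
      by (intro l.continuous_on U_continuous_line) (use that a b angle in auto)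
  qed
  define y where "y = Hinf0_calc A a h x"
  define hu where "hu w = h (exp w) * u w" for w
  \<comment> \<open>The part of the product in which the resolvent stays on the outer contour,
    collected from both rays; \<open>v\<close> is a point of the inner one.\<close>
  define \<Phi> where "\<Phi> t v = hu (Complex t (- a)) * cauchy_kernel (Complex t (- a)) v
     - hu (Complex t a) * cauchy_kernel (Complex t a) v" for t v
  have huc: "continuous_on UNIV (\<lambda>t. hu (Complex t c))" if "\<bar>c\<bar> = a" for c
    unfolding hu_def by (intro continuous_on_mult hc uc) (use that in auto)
  have hub: "cmod (hu (Complex t c)) \<le> (K2 * B) * decay e2 t" if "\<bar>c\<bar> = a" for c t
  proof -
    have "cmod (hu (Complex t c)) \<le> (K2 * decay e2 t) * B"
      unfolding hu_def norm_mult
      by (intro mult_mono B offl) (use K2[of "Complex t c"] that a e2 in auto)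
    then show ?thesis by (simp add: mult_ac)
  qed
  have kc: "continuous_on S (\<lambda>t. cauchy_kernel (p t) (q t))"
    if "continuous_on S (\<lambda>t. exp (p t))" "continuous_on S (\<lambda>t. exp (q t))" "\<And>t. t \<in> S \<Longrightarrow> exp (q t) \<noteq> exp (p t)"
    for S :: "'t::topological_space set" and p q
    unfolding cauchy_kernel_def by (intro continuous_intros that) (use that in auto)
  have kui: "(\<lambda>t. hu (Complex t c) * cauchy_kernel (Complex t c) v) integrable_on UNIV"
    if "\<bar>c\<bar> = a" "\<bar>Im v\<bar> \<le> b" for c v
  proof (rule integrable_UNIV_dominated)
    show "continuous_on UNIV (\<lambda>t. hu (Complex t c) * cauchy_kernel (Complex t c) v)"
      by (intro continuous_on_mult huc kc cexp continuous_on_const) (use that kb in auto)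
    show "(\<lambda>t. ((K2 * B) / sin d) * decay e2 t) integrable_on UNIV"
      by (intro integrable_on_mult_right exp_decay_integrable e2)
    show "cmod (hu (Complex t c) * cauchy_kernel (Complex t c) v) \<le> ((K2 * B) / sin d) * decay e2 t" for t
    proof -
      have "cmod (hu (Complex t c)) * cmod (cauchy_kernel (Complex t c) v) \<le> ((K2 * B) * decay e2 t) * (1 / sin d)"
        by (intro mult_mono hub kb) (use that B e2 in auto)
      then show ?thesis by (simp add: norm_mult)
    qed
  qed
  have khi: "(\<lambda>t. h (exp (Complex t c)) * cauchy_kernel v (Complex t c)) integrable_on UNIV"
    if "\<bar>c\<bar> = a" "\<bar>Im v\<bar> \<le> b" for c v
  proof (rule integrable_UNIV_dominated)
    show "continuous_on UNIV (\<lambda>t. h (exp (Complex t c)) * cauchy_kernel v (Complex t c))"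
      by (intro continuous_on_mult hc kc cexp continuous_on_const) (use that kb in auto)
    show "(\<lambda>t. (K2 / sin d) * decay e2 t) integrable_on UNIV"
      by (intro integrable_on_mult_right exp_decay_integrable e2)
    show "cmod (h (exp (Complex t c)) * cauchy_kernel v (Complex t c)) \<le> (K2 / sin d) * decay e2 t" for t
    proof -
      have "cmod (h (exp (Complex t c))) * cmod (cauchy_kernel v (Complex t c)) \<le> (K2 * decay e2 t) * (1 / sin d)"
        by (intro mult_mono kb) (use K2[of "Complex t c"] that a e2 in auto)
      then show ?thesis by (simp add: norm_mult)
    qed
  qed
  have step1: "l (U y v) = h (exp v) * u v + (1 / (2 * of_real pi * \<i>)) * integral UNIV (\<lambda>t. \<Phi> t v)"
    if v: "\<bar>Im v\<bar> = b" for v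
  proof -
    have voff: "exp v \<in> off" using v a b angle by (intro exp_off) auto
    have l': "clinear_functional (\<lambda>z. exp v * l (R (exp v) z))"
      by (rule clinear_functional_cmult[OF clinear_functional_compose[OF l resolvent_clinear[OF voff]]])
    have int: "integral UNIV (\<lambda>t. h (exp (Complex t c)) * (exp v * l (R (exp v) (U x (Complex t c)))))
       = integral UNIV (\<lambda>t. h (exp (Complex t c)) * cauchy_kernel v (Complex t c)) * u v
         + integral UNIV (\<lambda>t. hu (Complex t c) * cauchy_kernel (Complex t c) v)" if c: "\<bar>c\<bar> = a" for c
    proof -
      have "h (exp (Complex t c)) * (exp v * l (R (exp v) (U x (Complex t c))))
        = h (exp (Complex t c)) * cauchy_kernel v (Complex t c) * u v + hu (Complex t c) * cauchy_kernel (Complex t c) v" for t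
        using resolvent_product[OF voff offl kb(2) l, of c t x] c v by (simp add: u_def hu_def algebra_simps)
      then show ?thesis
        using khi[OF c, of v] kui[OF c, of v] v
        by (simp add: integral_add integrable_on_mult_left)
    qed
    have l0: "l (U y v) = exp v * l (R (exp v) y)"
      using l by (simp add: U_def clinear_functional_def)
    also have "\<dots> = (1 / (2 * of_real pi * \<i>)) *
       ((integral UNIV (\<lambda>t. h (exp (Complex t (- a))) * cauchy_kernel v (Complex t (- a)))
        - integral UNIV (\<lambda>t. h (exp (Complex t a)) * cauchy_kernel v (Complex t a))) * u v
        + integral UNIV (\<lambda>t. \<Phi> t v))"
    proof -
      have aa: "\<bar>a\<bar> = a" "\<bar>- a\<bar> = a" using a angle by auto
      have \<Phi>eq: "integral UNIV (\<lambda>t. \<Phi> t v) = integral UNIV (\<lambda>t. hu (Complex t (- a)) * cauchy_kernel (Complex t (- a)) v)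
          - integral UNIV (\<lambda>t. hu (Complex t a) * cauchy_kernel (Complex t a) v)"
        unfolding \<Phi>_def using aa v by (intro integral_diff kui) auto
      show ?thesis
        unfolding y_def calc_functional[OF h a l'] int[OF aa(1)] int[OF aa(2)] \<Phi>eq by (simp add: algebra_simps)
    qed
    also have "integral UNIV (\<lambda>t. h (exp (Complex t (- a))) * cauchy_kernel v (Complex t (- a)))
        - integral UNIV (\<lambda>t. h (exp (Complex t a)) * cauchy_kernel v (Complex t a)) = 2 * of_real pi * \<i> * h (exp v)"
      by (rule Cauchy_formula_strip[where h = "\<lambda>w. h (exp w)", OF holomorphic_on_sector_exp e2(1,2) K2])
        (use h s a v b in \<open>auto simp: Hinf0_def\<close>)
    finally show ?thesis by (simp add: distrib_left)
  qed
  \<comment> \<open>\<open>J c\<close> is the contribution of \<open>\<Phi>\<close> on the line at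
    height \<open>c\<close>. After the interchange it involves \<open>g\<close> only through
    \<open>I\<close>, its integral against a kernel whose pole \<open>w\<close> is on the outer
    contour.\<close>
  define J where "J c = integral UNIV (\<lambda>s. g (exp (Complex s c)) * integral UNIV (\<lambda>t. \<Phi> t (Complex s c)))" for c
  define I where "I w c = integral UNIV (\<lambda>s. g (exp (Complex s c)) * cauchy_kernel w (Complex s c))" for w c
  have Jc: "J c = integral UNIV (\<lambda>t. hu (Complex t (- a)) * I (Complex t (- a)) c - hu (Complex t a) * I (Complex t a) c)"
    if c: "\<bar>c\<bar> = b" for c
  proof -
    \<comment> \<open>\<open>integral_swap_UNIV\<close> asks for one rate in both variables.\<close>
    define e where "e = min e1 e2"
    have e: "0 < e" "e \<le> e1" "e \<le> e2" using e1 e2 by (auto simp: e_def)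
    have \<Phi>b: "cmod (\<Phi> t (Complex s c)) \<le> (2 * (K2 * B) / sin d) * decay e t" for s t
    proof -
      have 1: "cmod (hu (Complex t c') * cauchy_kernel (Complex t c') (Complex s c)) \<le> (K2 * B / sin d) * decay e t" if "\<bar>c'\<bar> = a" for c'
      proof -
        have "cmod (hu (Complex t c')) * cmod (cauchy_kernel (Complex t c') (Complex s c)) \<le> ((K2 * B) * decay e2 t) * (1 / sin d)"
          by (intro mult_mono hub kb) (use that c b B e2 in auto)
        also have "\<dots> \<le> ((K2 * B) * decay e t) * (1 / sin d)"
          using B e2 sd e by (intro mult_right_mono mult_left_mono) (auto intro: mult_right_mono)
        finally show ?thesis by (simp add: norm_mult)
      qed
      have "cmod (\<Phi> t (Complex s c)) \<le> (K2 * B / sin d) * decay e t + (K2 * B / sin d) * decay e t"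
        unfolding \<Phi>_def using a angle by (intro norm_triangle_le_diff add_mono 1) auto
      then show ?thesis by (simp add: mult_ac)
    qed
    have "J c = integral UNIV (\<lambda>s. integral UNIV (\<lambda>t. g (exp (Complex s c)) * \<Phi> t (Complex s c)))"
      unfolding J_def by simp
    also have "\<dots> = integral UNIV (\<lambda>t. integral UNIV (\<lambda>s. g (exp (Complex s c)) * \<Phi> t (Complex s c)))"
    proof (rule integral_swap_UNIV[OF _ e(1)])
      have A: "continuous_on UNIV (\<lambda>p. F (Complex (q p) r))"
        if "continuous_on UNIV (\<lambda>t. F (Complex t r))" "continuous_on UNIV q" for F :: "complex \<Rightarrow> complex" and q :: "real \<times> real \<Rightarrow> real" and r
        using continuous_on_compose2[OF that] by simp
      show "continuous_on UNIV (\<lambda>(s, t). g (exp (Complex s c)) * \<Phi> t (Complex s c))"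
        unfolding \<Phi>_def case_prod_beta
        by (intro continuous_on_mult continuous_on_diff kc A[OF cexp] A[OF huc] A[OF gc[OF c]] continuous_on_fst continuous_on_snd continuous_on_id)
          (use a b c angle kb in auto)
      show "cmod (g (exp (Complex s c)) * \<Phi> t (Complex s c)) \<le> (K1 * (2 * (K2 * B) / sin d)) * (decay e s * decay e t)" for s t
      proof -
        have "cmod (g (exp (Complex s c))) \<le> K1 * decay e1 s" using K1[of "Complex s c"] a b c by auto
        also have "\<dots> \<le> K1 * decay e s" using e1 e by (intro mult_left_mono) (auto intro: mult_right_mono)
        finally have "cmod (g (exp (Complex s c))) * cmod (\<Phi> t (Complex s c))
          \<le> (K1 * decay e s) * ((2 * (K2 * B) / sin d) * decay e t)"
          using e1 by (intro mult_mono \<Phi>b) auto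
        then show ?thesis by (simp add: norm_mult mult_ac)
      qed
    qed
    also have "\<dots> = integral UNIV (\<lambda>t. hu (Complex t (- a)) * I (Complex t (- a)) c - hu (Complex t a) * I (Complex t a) c)"
    proof (rule arg_cong[where f = "integral UNIV"], rule ext)
      fix t
      have i: "(\<lambda>s. g (exp (Complex s c)) * cauchy_kernel (Complex t c') (Complex s c)) integrable_on UNIV" if c': "\<bar>c'\<bar> = a" for c'
      proof (rule integrable_UNIV_dominated)
        show "continuous_on UNIV (\<lambda>s. g (exp (Complex s c)) * cauchy_kernel (Complex t c') (Complex s c))"
          by (intro continuous_on_mult gc kc cexp continuous_on_const) (use c c' kb in auto)
        show "(\<lambda>t. (K1 / sin d) * decay e1 t) integrable_on UNIV"
          by (intro integrable_on_mult_right exp_decay_integrable e1)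
        show "cmod (g (exp (Complex s c)) * cauchy_kernel (Complex t c') (Complex s c)) \<le> (K1 / sin d) * decay e1 s" for s
        proof -
          have "cmod (g (exp (Complex s c))) * cmod (cauchy_kernel (Complex t c') (Complex s c)) \<le> (K1 * decay e1 s) * (1 / sin d)"
            by (intro mult_mono kb) (use K1[of "Complex s c"] c c' a b e1 in auto)
          then show ?thesis by (simp add: norm_mult)
        qed
      qed
      have "integral UNIV (\<lambda>s. g (exp (Complex s c)) * \<Phi> t (Complex s c)) =
        integral UNIV (\<lambda>s. hu (Complex t (- a)) * (g (exp (Complex s c)) * cauchy_kernel (Complex t (- a)) (Complex s c))
          - hu (Complex t a) * (g (exp (Complex s c)) * cauchy_kernel (Complex t a) (Complex s c)))"
        by (simp add: \<Phi>_def algebra_simps)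
      also have "\<dots> = hu (Complex t (- a)) * I (Complex t (- a)) c - hu (Complex t a) * I (Complex t a) c"
        unfolding I_def using a angle by (subst integral_diff) (auto intro!: integrable_on_mult_right i)
      finally show "integral UNIV (\<lambda>s. g (exp (Complex s c)) * \<Phi> t (Complex s c)) = hu (Complex t (- a)) * I (Complex t (- a)) c - hu (Complex t a) * I (Complex t a) c" .
    qed
    finally show ?thesis .
  qed
  \<comment> \<open>The pole \<open>w\<close> has height \<open>a\<close> or \<open>- a\<close> with
    \<open>a > b\<close>, hence the line may be moved from \<open>- b\<close> to \<open>b\<close>.
    Consequently both rays give the same \<open>J\<close>, and it cancels in their
    difference.\<close>
  have Ipm: "I w (- b) = I w b" if w: "\<bar>Im w\<bar> = a" for w
    unfolding I_def
  proof (rule strip_shift[where F = "\<lambda>v. g (exp v) * cauchy_kernel w v", OF _ e1(1)])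
    have "(\<lambda>v. g (exp v)) holomorphic_on strip (- \<sigma>) \<sigma>"
      using g by (intro holomorphic_on_sector_exp s a) (simp add: Hinf0_def)
    then have "(\<lambda>v. g (exp v)) holomorphic_on strip (- a) a"
      by (rule holomorphic_on_subset) (use a in auto)
    moreover have "cauchy_kernel w holomorphic_on strip (- a) a"
      unfolding cauchy_kernel_def
    proof (intro holomorphic_intros)
      fix v assume v: "v \<in> strip (- a) a"
      then have lt: "\<bar>Im v - Im w\<bar> < 2 * pi" using w a by auto
      have "v \<noteq> w" using v w by auto
      with exp_inj_strip[OF _ lt] show "exp v - exp w \<noteq> 0" by auto
    qed
    ultimately show "(\<lambda>v. g (exp v) * cauchy_kernel w v) holomorphic_on strip (- a) a" by (rule holomorphic_on_mult)
    fix v assume v: "- b \<le> Im v" "Im v \<le> b"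
    have "cmod (g (exp v)) * cmod (cauchy_kernel w v) \<le> (K1 * decay e1 (Re v)) * (1 / sin d)"
      by (intro mult_mono kb K1) (use v w a b e1 in auto)
    then show "cmod (g (exp v) * cauchy_kernel w v) \<le> (K1 / sin d) * decay e1 (Re v)"
      by (simp add: norm_mult)
  qed (use b in auto)
  have Jeq: "J (- b) = J b"
    using Jc[of b] Jc[of "- b"] b a angle by (simp add: Ipm)
  have lines: "integral UNIV (\<lambda>s. g (exp (Complex s c)) * l (U y (Complex s c)))
    = integral UNIV (\<lambda>s. (g (exp (Complex s c)) * h (exp (Complex s c))) * u (Complex s c)) + (1 / (2 * of_real pi * \<i>)) * J c"
    if c: "\<bar>c\<bar> = b" for c
  proof -
    from l interpret l: bounded_linear l by (simp add: clinear_functional_def)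
    have lc: "l (c *\<^sub>C y) = c * l y" for c y using l by (simp add: clinear_functional_def)
    have ib: "(\<lambda>s. k (exp (Complex s c)) * l (U z (Complex s c))) integrable_on UNIV" if "k \<in> Hinf0 \<sigma>" for k z
      using integrable_linear[OF ray_integrable[OF that, of c z] l.bounded_linear_axioms] c b a
      by (simp add: o_def lc)
    have i1: "(\<lambda>s. g (exp (Complex s c)) * l (U y (Complex s c))) integrable_on UNIV" by (rule ib[OF g])
    have i2: "(\<lambda>s. (g (exp (Complex s c)) * h (exp (Complex s c))) * u (Complex s c)) integrable_on UNIV"
      unfolding u_def by (rule ib[OF gh])
    have eq: "g (exp (Complex s c)) * l (U y (Complex s c)) - (g (exp (Complex s c)) * h (exp (Complex s c))) * u (Complex s c)
      = (1 / (2 * of_real pi * \<i>)) * (g (exp (Complex s c)) * integral UNIV (\<lambda>t. \<Phi> t (Complex s c)))" for s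
      using step1[of "Complex s c"] c by (simp add: algebra_simps)
    have "integral UNIV (\<lambda>s. g (exp (Complex s c)) * l (U y (Complex s c)))
      - integral UNIV (\<lambda>s. (g (exp (Complex s c)) * h (exp (Complex s c))) * u (Complex s c))
      = (1 / (2 * of_real pi * \<i>)) * J c"
      unfolding J_def integral_diff[OF i1 i2, symmetric] eq by simp
    then show ?thesis by (simp add: algebra_simps)
  qed
  \<comment> \<open>Independence of the angle moves the contour of \<open>g\<close> inwards here and
    that of the product back to \<open>a\<close> at the end.\<close>
  have "l (Hinf0_calc A a g y) = l (Hinf0_calc A b g y)"
    using calc_angle[OF g, of b a y] a b by simp
  also have "\<dots> = l (Hinf0_calc A b (\<lambda>z. g z * h z) x)"
  proof -
    have bb: "\<bar>b\<bar> = b" "\<bar>- b\<bar> = b" "b < \<sigma>" using b a by auto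
    show ?thesis
      unfolding calc_functional[OF g b(1) bb(3) a(3) l] calc_functional[OF gh b(1) bb(3) a(3) l]
        lines[OF bb(1)] lines[OF bb(2)] Jeq u_def by (simp add: algebra_simps)
  qed
  also have "\<dots> = l (Hinf0_calc A a (\<lambda>z. g z * h z) x)"
    using calc_angle[OF gh, of b a x] a b by simp
  finally show "l (Hinf0_calc A a g (Hinf0_calc A a h x)) = l (Hinf0_calc A a (\<lambda>z. g z * h z) x)"
    by (simp add: y_def)
qed

end

section \<open>The regulariser and the calculus of bounded functions\<close>

context sectorial_operator
begin

text \<open>In the integrand \<open>regularizer(z) z R(z) y\<close>, everything except explicit scalar kernels is collected
  in a term \<open>V\<close> that is holomorphic across the negative axis and decays, hence contributes nothing.\<close>

lemma regularizer_calc: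
  assumes a: "\<theta> < a" "a < pi"
  shows "Hinf0_calc A a regularizer y = - R (- 1) (R (- 1) y) - R (- 1) y"
proof (rule eq_functionalI)
  fix l assume "l \<in> L"
  then have l: "clinear_functional l" by (rule functional)
  then interpret l: bounded_linear l by (simp add: clinear_functional_def)
  have lc: "l (c *\<^sub>C y) = c * l y" for c y using l by (simp add: clinear_functional_def)
  have lneg: "l (- x) = - l x" for x using l.diff[of 0 x] l.zero by simp
  define T1 where "T1 = R (- 1) y"
  define T2 where "T2 = R (- 1) T1"
  \<comment> \<open>Since \<open>R (- 1)\<close> is the negative of \<open>(1 + A)^{-1}\<close>,
    this is \<open>(1 + A)^{-1} y - (1 + A)^{-2} y = A (1 + A)^{-2} y\<close>.\<close>
  define u where "u = - T2 - T1"
  define \<sigma> where "\<sigma> = (a + pi) / 2"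
  have \<sigma>: "a < \<sigma>" "\<sigma> < pi" "0 < \<sigma>" using a angle by (auto simp: \<sigma>_def)
  define m where "m = - (of_real pi * \<i>)"
  have em: "exp m = - 1" by (simp add: m_def exp_minus)
  have m1: "- 1 \<in> off" by (rule minus_one_off)
  \<comment> \<open>\<open>U u w\<close> tends to \<open>u\<close> as \<open>Re w\<close> tends to
    \<open>+\<infinity>\<close>. The subtracted kernel, with limits 1 to the right and 0 to the
    left, removes this limit, and its pole \<open>exp w = 1\<close> does not occur in the strip
    between \<open>\<theta>\<close> and \<open>2 * pi - \<theta>\<close>.\<close>
  define V where "V w = l (U u w) - cauchy_kernel 0 w * l u" for w
  \<comment> \<open>The resolvent identity between \<open>z\<close> and \<open>-1\<close>, used for
    \<open>y\<close> and for \<open>T1\<close>, expresses everything by \<open>R(z) T2\<close>; the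
    rest is partial fractions in \<open>z\<close>.\<close>
  have key: "regularizer (exp w) * l (U y w)
    = - l u * (cauchy_kernel m w - cauchy_kernel 0 w) - regularizer (exp w) * l T1 + V w"
    if w: "exp w \<in> off" "exp w \<noteq> - 1" for w
  proof -
    define z where "z = exp w"
    define r where "r = l (R z T2)"
    have zo: "z \<in> off" "1 + z \<noteq> 0" using w by (auto simp: z_def add_eq_0_iff)
    have i1: "l (R z T1) = l T2 - (1 + z) * r"
      unfolding r_def T2_def by (subst resolvent_identity[OF zo(1) m1]) (simp add: l.add lc algebra_simps)
    have i0: "l (R z y) = l T1 - (1 + z) * l (R z T1)"
      by (subst resolvent_identity[OF zo(1) m1]) (simp add: l.add lc algebra_simps T1_def)
    have U0: "l (U y w) = z * (l T1 - (1 + z) * (l T2 - (1 + z) * r))"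
      unfolding U_def z_def[symmetric] lc i0 i1 ..
    have Uu: "l (U u w) = z * (- r - (l T2 - (1 + z) * r))"
      unfolding U_def z_def[symmetric] lc u_def by (simp add: resolvent_linear[OF zo(1)] l.diff lneg i1 r_def)
    have lu: "l u = - l T2 - l T1" by (simp add: u_def l.diff lneg)
    have km: "cauchy_kernel m w = z / (1 + z)" by (simp add: cauchy_kernel_def em z_def add.commute)
    have "regularizer z * (z * (l T1 - (1 + z) * (l T2 - (1 + z) * r))) =
      (l T2 + l T1) * (z / (1 + z)) - regularizer z * l T1 + z * (- r - (l T2 - (1 + z) * r))"
      using zo(2) unfolding regularizer_def by (simp add: divide_simps) (simp add: power2_eq_square algebra_simps)
    then show ?thesis
      unfolding U0 V_def Uu km lu z_def[symmetric] by (simp add: algebra_simps)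
  qed
  have aa: "\<bar>a\<bar> = a" "\<bar>- a\<bar> = a" using a angle by auto
  have offl: "exp (Complex t c) \<in> off" "exp (Complex t c) \<noteq> - 1" if "\<bar>c\<bar> = a" for t c
  proof -
    show "exp (Complex t c) \<in> off" using that a angle by (intro exp_off) auto
    show "exp (Complex t c) \<noteq> - 1"
    proof
      assume "exp (Complex t c) = - 1"
      then have "exp (Complex t c) = exp m" by (simp add: em)
      moreover have "\<bar>Im (Complex t c) - Im m\<bar> < 2 * pi"
        using that a angle by (auto simp: m_def abs_if split: if_splits)
      ultimately have "Complex t c = m" by (rule exp_inj_strip)
      then have "c = - pi" by (auto simp: m_def complex_eq_iff)
      then show False using that a by auto
    qed
  qed
  have reg: "regularizer \<in> Hinf0 \<sigma>" using \<sigma> by (intro regularizer_Hinf0)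
  obtain K e where e: "0 < e" "0 \<le> K"
    and K: "\<And>w. \<bar>Im w\<bar> < \<sigma> \<Longrightarrow> cmod (regularizer (exp w)) \<le> K * decay e (Re w)"
    using Hinf0_decay[OF reg \<sigma>(3)] \<sigma> by (metis less_imp_le)
  have regh: "(\<lambda>w. regularizer (exp w)) holomorphic_on strip (- \<sigma>) \<sigma>"
    using reg \<sigma> by (intro holomorphic_on_sector_exp) (auto simp: Hinf0_def)
  have regi: "(\<lambda>t. regularizer (exp (Complex t c))) integrable_on UNIV" if "\<bar>c\<bar> = a" for c
    by (rule integrable_line[OF regh _ _ e(1)]) (use that \<sigma> K[of "Complex _ c"] in auto)
  have reg0: "integral UNIV (\<lambda>t. regularizer (exp (Complex t (- a)))) = integral UNIV (\<lambda>t. regularizer (exp (Complex t a)))"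
    by (rule strip_shift[OF regh e(1) _ _ _ K]) (use a angle \<sigma> in auto)
  define s where "s = sin (a / 2)"
  have spos: "0 < s" unfolding s_def using a angle by (intro sin_gt_zero) auto
  have k0: "(1 + exp (- Re w)) * cmod (cauchy_kernel 0 w) \<le> 1 / s" "exp w \<noteq> 1"
    if "a \<le> Im w" "Im w \<le> 2 * pi - a" for w
    using cauchy_kernel_bound[of "a / 2" w 0] that a angle by (auto simp: s_def)
  have Vh: "V holomorphic_on strip \<theta> (2 * pi - \<theta>)"
    unfolding V_def cauchy_kernel_def
  proof (intro holomorphic_intros U_holomorphic l)
    show "exp w \<in> off" if "w \<in> strip \<theta> (2 * pi - \<theta>)" for w using that angle by (intro exp_off) auto
    show "exp w - exp 0 \<noteq> 0" if w: "w \<in> strip \<theta> (2 * pi - \<theta>)" for w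
      using exp_inj_strip[of w 0] w angle by auto
  qed
  obtain B where B: "\<And>x. cmod (l x) \<le> norm x * B" "0 \<le> B" using l.nonneg_bounded by blast
  define K' where "K' = (norm T2 + C * norm T2) * B + B * (C * norm (T2 + T1 + (T1 + y))) + cmod (l u) / s"
  \<comment> \<open>To the left the decay comes from \<open>u = A T2\<close>, by which
    \<open>U u w\<close> is \<open>exp w\<close> times the bounded term \<open>U T2 w - T2\<close>.
    To the right it comes from \<open>u\<close> lying in the domain: with \<open>q = A u\<close> the
    difference \<open>U u w - u\<close> is \<open>R (exp w) q\<close>.\<close>
  have Vb: "cmod (V w) \<le> K' * decay 1 (Re w)" if w: "a \<le> Im w" "Im w \<le> 2 * pi - a" for w
  proof (cases "Re w \<le> 0")
    case True
    have woff: "exp w \<in> off" using w a angle by (intro exp_off) auto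
    have Ueq: "U u w = exp w *\<^sub>C (U T2 w - T2)"
    proof -
      have "R (exp w) T1 = T2 + (- 1 - exp w) *\<^sub>C R (exp w) T2"
        using resolvent_identity[OF woff m1, of T1] by (simp add: T2_def)
      then have "R (exp w) u = - R (exp w) T2 - (T2 + (- 1 - exp w) *\<^sub>C R (exp w) T2)"
        by (simp add: u_def resolvent_linear[OF woff])
      also have "\<dots> = U T2 w - T2" by (simp add: U_def scaleC.diff_left scaleC.minus_left)
      finally show ?thesis by (simp add: U_def)
    qed
    have "cmod (l (U u w)) \<le> norm (U u w) * B" by (rule B)
    also have "norm (U u w) \<le> exp (Re w) * (C * norm T2 + norm T2)"
      unfolding Ueq norm_scaleC norm_exp_eq_Re
      by (intro mult_left_mono norm_triangle_le_diff add_mono U_norm woff) auto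
    finally have 1: "cmod (l (U u w)) \<le> exp (Re w) * ((norm T2 + C * norm T2) * B)"
      using B by (simp add: mult_ac add.commute mult_right_mono)
    have "cmod (cauchy_kernel 0 w) \<le> exp (Re w) * ((1 + exp (- Re w)) * cmod (cauchy_kernel 0 w))"
    proof -
      have "exp (Re w) * ((1 + exp (- Re w)) * cmod (cauchy_kernel 0 w)) = (exp (Re w) + 1) * cmod (cauchy_kernel 0 w)"
        by (simp add: algebra_simps exp_minus)
      moreover have "1 * cmod (cauchy_kernel 0 w) \<le> (exp (Re w) + 1) * cmod (cauchy_kernel 0 w)"
        by (intro mult_right_mono) auto
      ultimately show ?thesis by linarith
    qed
    also have "\<dots> \<le> exp (Re w) * (1 / s)" by (intro mult_left_mono k0 w) auto
    finally have 2: "cmod (cauchy_kernel 0 w * l u) \<le> exp (Re w) * (cmod (l u) / s)"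
      by (simp add: norm_mult) (metis mult.commute mult_right_mono norm_ge_zero times_divide_eq_right mult.left_commute)
    have "cmod (V w) \<le> exp (Re w) * ((norm T2 + C * norm T2) * B) + exp (Re w) * (cmod (l u) / s)"
      unfolding V_def by (intro norm_triangle_le_diff add_mono 1 2)
    also have "\<dots> \<le> exp (Re w) * K'"
      unfolding K'_def using B Cn_nonneg by (simp add: distrib_left)
    finally show ?thesis using True by (simp add: mult.commute)
  next
    case False
    have woff: "exp w \<in> off" using w a angle by (intro exp_off) auto
    define q where "q = T2 + T1 + (T1 + y)"
    have "(T2, (- 1) *\<^sub>C T2 - T1) \<in> A" "(T1, (- 1) *\<^sub>C T1 - y) \<in> A"
      unfolding T2_def T1_def by (rule resolvent_in[OF m1])+
    then have "(T2 + T1, ((- 1) *\<^sub>C T2 - T1) + ((- 1) *\<^sub>C T1 - y)) \<in> A"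
      using linear_op unfolding linear_operator_def by blast
    then have *: "((- 1) *\<^sub>C (T2 + T1), (- 1) *\<^sub>C (((- 1) *\<^sub>C T2 - T1) + ((- 1) *\<^sub>C T1 - y))) \<in> A"
      using linear_op unfolding linear_operator_def by blast
    have neg: "(- 1) *\<^sub>C x = - x" for x :: 'x by (simp add: scaleC.minus_left)
    have "(- 1) *\<^sub>C (T2 + T1) = u" "(- 1) *\<^sub>C (((- 1) *\<^sub>C T2 - T1) + ((- 1) *\<^sub>C T1 - y)) = q"
      by (simp_all add: neg u_def q_def)
    with * have "(u, q) \<in> A" by (simp only:)
    from resolvent_eq[OF woff this] have "R (exp w) (exp w *\<^sub>C u - q) = u" .
    then have Ueq: "U u w - u = R (exp w) q" by (simp add: resolvent_linear[OF woff] U_def algebra_simps)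
    have "V w = l (U u w - u) + (1 - cauchy_kernel 0 w) * l u" by (simp add: V_def l.diff algebra_simps)
    also have "1 - cauchy_kernel 0 w = - (exp (- w) * cauchy_kernel 0 w)"
      using k0(2)[OF w] by (simp add: cauchy_kernel_def exp_minus field_simps)
    finally have "cmod (V w) \<le> cmod (l (U u w - u)) + cmod (exp (- w) * cauchy_kernel 0 w) * cmod (l u)"
      using norm_triangle_ineq[of "l (U u w - u)" "- (exp (- w) * cauchy_kernel 0 w) * l u"] by (simp add: norm_mult)
    moreover have "cmod (l (U u w - u)) \<le> exp (- Re w) * (B * (C * norm q))"
    proof -
      have "cmod (l (U u w - u)) \<le> norm (R (exp w) q) * B" unfolding Ueq by (rule B)
      also have "\<dots> \<le> (C * norm q / cmod (exp w)) * B" by (intro mult_right_mono resolvent_norm woff B)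
      finally show ?thesis by (simp add: exp_minus field_simps)
    qed
    moreover have "cmod (exp (- w) * cauchy_kernel 0 w) \<le> exp (- Re w) * (1 / s)"
    proof -
      have "1 * cmod (cauchy_kernel 0 w) \<le> (1 + exp (- Re w)) * cmod (cauchy_kernel 0 w)"
        by (intro mult_right_mono) auto
      then have "cmod (cauchy_kernel 0 w) \<le> 1 / s" using k0(1)[OF w] by linarith
      then show ?thesis unfolding norm_mult by (intro mult_mono) auto
    qed
    then have "cmod (exp (- w) * cauchy_kernel 0 w) * cmod (l u) \<le> exp (- Re w) * (1 / s) * cmod (l u)"
      by (intro mult_right_mono) auto
    ultimately have "cmod (V w) \<le> exp (- Re w) * (B * (C * norm q) + cmod (l u) / s)"
      by (simp add: algebra_simps)
    also have "\<dots> \<le> exp (- Re w) * K'"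
      unfolding K'_def q_def using B Cn_nonneg by (intro mult_left_mono) auto
    finally show ?thesis using False by (simp add: mult.commute)
  qed
  \<comment> \<open>The lower ray is also the line at height \<open>2 * pi - a\<close>, to which
    \<open>V\<close> can be shifted from height \<open>a\<close> across the negative axis.\<close>
  have wrap: "exp (Complex t (- a)) = exp (Complex t (2 * pi - a))" for t
  proof -
    have "Complex t (2 * pi - a) = Complex t (- a) + 2 * of_real pi * \<i>" by (simp add: complex_eq_iff)
    then show ?thesis by (simp add: exp_add exp_two_pi_i)
  qed
  have V0: "integral UNIV (\<lambda>t. V (Complex t (- a))) = integral UNIV (\<lambda>t. V (Complex t a))"
  proof -
    have "V (Complex t (- a)) = V (Complex t (2 * pi - a))" for t
      by (simp add: V_def U_def cauchy_kernel_def wrap)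
    moreover have "integral UNIV (\<lambda>t. V (Complex t a)) = integral UNIV (\<lambda>t. V (Complex t (2 * pi - a)))"
      by (rule strip_shift[OF Vh _ _ _ _ Vb]) (use a angle in auto)
    ultimately show ?thesis by simp
  qed
  have Vi: "(\<lambda>t. V (Complex t c)) integrable_on UNIV" if "\<bar>c\<bar> = a" for c
  proof -
    have "(\<lambda>t. V (Complex t a)) integrable_on UNIV"
      by (rule integrable_line[OF Vh, where e = 1 and K = K']) (use Vb[of "Complex _ a"] a angle in auto)
    moreover have "(\<lambda>t. V (Complex t (2 * pi - a))) integrable_on UNIV"
      by (rule integrable_line[OF Vh, where e = 1 and K = K']) (use Vb[of "Complex _ (2 * pi - a)"] a angle in auto)
    moreover have "V (Complex t (- a)) = V (Complex t (2 * pi - a))" for t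
      by (simp add: V_def U_def cauchy_kernel_def wrap)
    ultimately show ?thesis using that by (auto simp: abs_if split: if_splits)
  qed
  have line: "integral UNIV (\<lambda>t. regularizer (exp (Complex t c)) * l (U y (Complex t c)))
     = - l u * X - integral UNIV (\<lambda>t. regularizer (exp (Complex t c))) * l T1 + integral UNIV (\<lambda>t. V (Complex t c))"
    if c: "\<bar>c\<bar> = a" and X: "((\<lambda>t. cauchy_kernel m (Complex t c) - cauchy_kernel 0 (Complex t c)) has_integral X) UNIV" for c X
    unfolding key[OF offl[OF c]]
    by (intro integral_unique has_integral_add has_integral_diff has_integral_mult_left has_integral_mult_right X
        integrable_integral regi Vi c)
  have up: "((\<lambda>t. cauchy_kernel m (Complex t a) - cauchy_kernel 0 (Complex t a)) has_integral 0 - m) UNIV"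
    by (rule has_integral_cauchy_kernel_diff) (use a angle in \<open>auto simp: m_def\<close>)
  \<comment> \<open>The point 0 lies above the lower line and is moved by
    \<open>- 2 * pi * \<i>\<close>. The kernel integrals over the two lines then differ by this
    amount, and with the prefactor of the calculus exactly \<open>l u\<close> remains.\<close>
  have dn: "((\<lambda>t. cauchy_kernel m (Complex t (- a)) - cauchy_kernel 0 (Complex t (- a))) has_integral (0 - 2 * of_real pi * \<i>) - m) UNIV"
  proof -
    have "((\<lambda>t. cauchy_kernel m (Complex t (- a)) - cauchy_kernel (0 - 2 * of_real pi * \<i>) (Complex t (- a))) has_integral (0 - 2 * of_real pi * \<i>) - m) UNIV"
      by (rule has_integral_cauchy_kernel_diff) (use a angle in \<open>auto simp: m_def\<close>)
    then show ?thesis using cauchy_kernel_periodic[of "0 - 2 * of_real pi * \<i>"] by simp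
  qed
  have "l (Hinf0_calc A a regularizer y) = l u"
    unfolding calc_functional[OF reg a(1) \<sigma>(1) less_imp_le[OF \<sigma>(2)] l] line[OF aa(1) up] line[OF aa(2) dn] reg0 V0
    by (simp add: m_def algebra_simps)
  then show "l (Hinf0_calc A a regularizer y) = l (- R (- 1) (R (- 1) y) - R (- 1) y)"
    by (simp add: u_def T1_def T2_def)
qed

text \<open>By \<open>regularizer_calc\<close> the vector \<open>A R(-1)^2 (x - y)\<close> vanishes.
  Injectivity of \<open>A\<close> gives \<open>R(-1)^2 (x - y) = 0\<close>, the formula then gives
  \<open>R(-1) (x - y) = 0\<close>, and a resolvent is injective because \<open>A\<close> is
  single-valued.\<close>

lemma regularizer_calc_injective:
  assumes a: "\<theta> < a" "a < pi" and inj: "injective_operator A"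
    and eq: "Hinf0_calc A a regularizer x = Hinf0_calc A a regularizer y"
  shows "x = y"
proof -
  define z where "z = x - y"
  define \<sigma> where "\<sigma> = (a + pi) / 2"
  have \<sigma>: "a < \<sigma>" "\<sigma> < pi" "0 < \<sigma>" using a angle by (auto simp: \<sigma>_def)
  have "Hinf0_calc A a regularizer z = 0"
    using calc_diff[OF regularizer_Hinf0[OF \<sigma>(3,2)] a(1) \<sigma>(1) less_imp_le[OF \<sigma>(2)]] eq by (simp add: z_def)
  then have 0: "- R (- 1) (R (- 1) z) - R (- 1) z = 0" using regularizer_calc[OF a] by simp
  have neg: "(- 1) *\<^sub>C x = - x" for x :: 'x by (simp add: scaleC.minus_left)
  have "(R (- 1) (R (- 1) z), 0) \<in> A"
    using resolvent_in[OF minus_one_off, of "R (- 1) z"] 0 by (simp add: neg)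
  then have "R (- 1) (R (- 1) z) = 0" using inj by (simp add: injective_operator_def)
  with 0 have R0: "R (- 1) z = 0" by simp
  have "(0, - z) \<in> A" using resolvent_in[OF minus_one_off, of z] unfolding R0 by (simp add: scaleC.zero_right)
  moreover have "(0, 0) \<in> A" "single_valued A" using linear_op by (auto simp: linear_operator_def)
  ultimately have "- z = 0" by (meson single_valuedD)
  then show ?thesis by (simp add: z_def)
qed

text \<open>The graph condition holds because \<open>calc_mult\<close> turns both of its sides into
  the calculus of the product of \<open>regularizer\<close>, \<open>f\<close> and \<open>g\<close>
  at \<open>x\<close>. That it determines the value is the injectivity of the regulariser.\<close>

lemma Hinf_calc_apply:
  assumes a: "\<theta> < a" "a < \<sigma>" "\<sigma> < pi" and inj: "injective_operator A"
    and f: "f holomorphic_on sector \<sigma>" "\<And>z. z \<in> sector \<sigma> \<Longrightarrow> cmod (f z) \<le> B" and g: "g \<in> Hinf0 \<sigma>"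
  shows "op_apply (Hinf_calc A a f) (Hinf0_calc A a g x) = Hinf0_calc A a (\<lambda>z. f z * g z) x"
  unfolding op_apply_def
proof (rule the_equality)
  have s: "0 < \<sigma>" "\<sigma> \<le> pi" and a': "a < pi" using a angle by auto
  have r: "regularizer \<in> Hinf0 \<sigma>" using s a by (intro regularizer_Hinf0)
  have fg: "(\<lambda>z. f z * g z) \<in> Hinf0 \<sigma>" by (rule Hinf0_mult_bounded[OF g f])
  have rf: "(\<lambda>z. regularizer z * f z) \<in> Hinf0 \<sigma>"
    using Hinf0_mult_bounded[OF r f] by (simp add: mult.commute)
  have "Hinf0_calc A a regularizer (Hinf0_calc A a (\<lambda>z. f z * g z) x)
    = Hinf0_calc A a (\<lambda>z. regularizer z * f z) (Hinf0_calc A a g x)"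
    by (simp add: calc_mult[OF r fg a(1,2) s(2)] calc_mult[OF rf g a(1,2) s(2)] mult.assoc)
  then show *: "(Hinf0_calc A a g x, Hinf0_calc A a (\<lambda>z. f z * g z) x) \<in> Hinf_calc A a f"
    by (simp add: Hinf_calc_def)
  fix y assume "(Hinf0_calc A a g x, y) \<in> Hinf_calc A a f"
  with * have "Hinf0_calc A a regularizer y = Hinf0_calc A a regularizer (Hinf0_calc A a (\<lambda>z. f z * g z) x)"
    by (simp add: Hinf_calc_def)
  then show "y = Hinf0_calc A a (\<lambda>z. f z * g z) x"
    by (rule regularizer_calc_injective[OF a(1) a' inj])
qed

end

section \<open>The reproducing formula\<close>

lemma two_powi_eq_exp: "(2 :: complex) powi k = exp (of_real (of_int k * ln 2))"
proof -
  have "exp (complex_of_real (ln 2)) = 2" by (metis exp_ln exp_of_real of_real_numeral zero_less_numeral)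
  then show ?thesis by (metis exp_power_int of_real_mult of_real_of_int_eq)
qed

lemma sum_int_telescope:
  fixes f :: "int \<Rightarrow> 'b::ab_group_add"
  shows "(\<Sum>k\<in>{- int n..int n}. f (k + 1) - f k) = f (int n + 1) - f (- int n)"
proof (induction n)
  case (Suc n)
  have "{- int (Suc n)..int (Suc n)} = insert (1 + int n) (insert (- 1 - int n) {- int n..int n})" by auto
  then show ?case using Suc by (simp add: algebra_simps)
qed simp

text \<open>This is the case \<open>j = 0\<close> of the first family of quotients, with
  \<open>t = exp \<tau>\<close> in \<open>[1,2]\<close>. The members of the family are bounded by
  one constant on the whole sector, so the unknown dilation by \<open>r\<close> does no
  harm.\<close>

lemma Phi_class_ratio:
  assumes \<psi>: "\<psi> \<in> Phi_class \<sigma>" and s: "0 < \<sigma>" "\<sigma> \<le> pi"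
  obtains d :: int and B where "\<And>w \<tau>. \<bar>Im w\<bar> < \<sigma> \<Longrightarrow> 0 \<le> \<tau> \<Longrightarrow> \<tau> \<le> ln 2 \<Longrightarrow>
    cmod (\<psi> (exp (w + of_real \<tau>))) \<le> B * cmod (\<psi> (exp (w - of_real (of_int d * ln 2))))"
proof -
  from \<psi>[unfolded Phi_class_def, THEN CollectD]
  obtain d :: int and \<F> and C :: real where nz: "0 \<notin> \<psi> ` sector \<sigma>"
    and C: "\<forall>f\<in>\<F>. \<forall>z\<in>sector \<sigma>. cmod (f z) \<le> C"
    and F: "\<forall>(j::int) t::real. t \<in> {1..2} \<longrightarrow>
      (\<exists>f\<in>\<F>. \<exists>r>0. \<forall>z\<in>sector \<sigma>.
         \<psi> (2 powi j * of_real t * z) / \<psi> (2 powi (j - d) * z) = f (of_real r * z)) \<and>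
      (\<exists>f\<in>\<F>. \<exists>r>0. \<forall>z\<in>sector \<sigma>.
         \<psi> (2 powi (j + d) * z) / \<psi> (2 powi j * of_real t * z) = f (of_real r * z))"
    by (elim conjE exE) (rule that, assumption+)
  show ?thesis
  proof (rule that[of C d])
    fix w :: complex and \<tau> :: real assume w: "\<bar>Im w\<bar> < \<sigma>" and \<tau>: "0 \<le> \<tau>" "\<tau> \<le> ln 2"
    have "exp \<tau> \<in> {1..2}" using \<tau> by (auto simp: ln_ge_iff)
    from F[rule_format, OF this, of 0, THEN conjunct1] obtain f r where f: "f \<in> \<F>" "r > 0"
      and eq0: "\<forall>z\<in>sector \<sigma>. \<psi> (2 powi 0 * of_real (exp \<tau>) * z) / \<psi> (2 powi (0 - d) * z) = f (of_real r * z)"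
      by (elim bexE exE conjE) (rule that)
    have eq: "\<psi> (of_real (exp \<tau>) * z) / \<psi> (2 powi (- d) * z) = f (of_real r * z)" if "z \<in> sector \<sigma>" for z
      using eq0[rule_format, OF that] by simp
    have ws: "exp w \<in> sector \<sigma>" using exp_in_sector[OF s w] .
    have "\<psi> (exp (w + of_real \<tau>)) / \<psi> (exp (w - of_real (of_int d * ln 2))) = f (exp (w + of_real (ln r)))"
    proof -
      have "of_real (exp \<tau>) * exp w = exp (w + of_real \<tau>)"
        by (simp add: exp_add mult.commute flip: exp_of_real)
      moreover have "2 powi (- d) * exp w = exp (w - of_real (of_int d * ln 2))"
        by (simp only: two_powi_eq_exp flip: exp_add) simp
      moreover have "of_real r * exp w = exp (w + of_real (ln r))"
        using f(2) by (simp add: exp_add exp_of_real mult.commute)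
      ultimately show ?thesis using eq[OF ws] by simp
    qed
    moreover have "cmod (f (exp (w + of_real (ln r)))) \<le> C"
      by (intro C[rule_format] f exp_in_sector s) (use w in simp)
    moreover have "\<psi> (exp (w - of_real (of_int d * ln 2))) \<noteq> 0"
      using nz exp_in_sector[OF s, of "w - of_real (of_int d * ln 2)"] w by (auto simp: image_iff)
    ultimately show "cmod (\<psi> (exp (w + of_real \<tau>))) \<le> C * cmod (\<psi> (exp (w - of_real (of_int d * ln 2))))"
      by (metis norm_divide pos_divide_le_eq zero_less_norm_iff)
  qed
qed

text \<open>If \<open>G\<close> is a primitive of \<open>g w = cnj (\<psi> (exp (cnj w))) \<psi> (exp w)\<close>, the integral over \<open>[1,2]\<close> above
  is \<open>G (w + ln 2) - G w\<close>, so that the partial sums telescope; their limit is constant because the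
  derivative tends to 0, and it is positive on the real axis.\<close>

lemma Phi_class_reproducing:
  assumes \<psi>: "\<psi> \<in> Phi_class \<sigma>" and s: "0 < \<sigma>" "\<sigma> \<le> pi"
  shows "\<exists>\<eta>\<in>Hinf0 \<sigma>. \<exists>B. \<forall>z\<in>sector \<sigma>.
    (\<forall>n. cmod (\<Sum>k\<in>{- int n..int n}. \<eta> (2 powi k * z) * \<psi> (2 powi k * z)) \<le> B) \<and>
    (\<lambda>n. \<Sum>k\<in>{- int n..int n}. \<eta> (2 powi k * z) * \<psi> (2 powi k * z)) \<longlonglongrightarrow> 1"
proof -
  define ll :: real where "ll = ln 2"
  have ll: "0 < ll" by (simp add: ll_def)
  let ?S = "strip (- \<sigma>) \<sigma>"
  have \<psi>0: "\<psi> \<in> Hinf0 \<sigma>" and nz: "0 \<notin> \<psi> ` sector \<sigma>" using \<psi> by (auto simp: Phi_class_def)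
  obtain d :: int and B where ratio: "\<And>w \<tau>. \<bar>Im w\<bar> < \<sigma> \<Longrightarrow> 0 \<le> \<tau> \<Longrightarrow> \<tau> \<le> ll \<Longrightarrow>
    cmod (\<psi> (exp (w + of_real \<tau>))) \<le> B * cmod (\<psi> (exp (w - of_real (of_int d * ll))))"
    unfolding ll_def using Phi_class_ratio[OF \<psi> s] by metis
  obtain K e where e: "0 < e" "0 \<le> K"
    and K: "\<And>w. \<bar>Im w\<bar> < \<sigma> \<Longrightarrow> cmod (\<psi> (exp w)) \<le> K * decay e (Re w)"
    using Hinf0_decay[OF \<psi>0 s] by metis
  define b where "b w = \<psi> (exp w)" for w
  define g where "g w = cnj (b (cnj w)) * b w" for w
  have S: "w \<in> ?S \<longleftrightarrow> \<bar>Im w\<bar> < \<sigma>" for w by auto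
  have b0: "b w \<noteq> 0" if "\<bar>Im w\<bar> < \<sigma>" for w
    using nz exp_in_sector[OF s that] by (auto simp: b_def image_iff)
  have bh: "b holomorphic_on ?S" unfolding b_def
    using \<psi>0 by (intro holomorphic_on_sector_exp s) (simp add: Hinf0_def)
  have "x \<in> cnj ` ?S" if "x \<in> ?S" for x using that by (intro image_eqI[of _ _ "cnj x"]) auto
  then have "cnj ` ?S = ?S" by auto
  then have "(cnj \<circ> b \<circ> cnj) holomorphic_on ?S"
    using bh by (intro holomorphic_on_compose_cnj_cnj strip_open) simp
  then have gh: "g holomorphic_on ?S" unfolding g_def using bh by (intro holomorphic_intros) (simp_all add: o_def)
  have gb1: "cmod (g w) \<le> K * decay e (Re w) * cmod (b w)" if "\<bar>Im w\<bar> < \<sigma>" for w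
    using K[of "cnj w"] that unfolding g_def norm_mult b_def by (intro mult_right_mono) auto
  have gb: "cmod (g w) \<le> K\<^sup>2 * decay e (Re w)" if "\<bar>Im w\<bar> < \<sigma>" for w
  proof -
    have "cmod (b w) \<le> K * decay e (Re w)" using K[OF that] by (simp add: b_def)
    also have "\<dots> \<le> K" using e by (intro mult_right_le_one_le) auto
    finally have "K * decay e (Re w) * cmod (b w) \<le> K * decay e (Re w) * K"
      using e by (intro mult_left_mono) auto
    then show ?thesis using gb1[OF that] by (simp add: power2_eq_square mult_ac)
  qed
  obtain G where "\<And>w. w \<in> ?S \<Longrightarrow> (G has_field_derivative g w) (at w within ?S)"
    using holomorphic_convex_primitive'[OF strip_convex strip_open gh] by metis
  note GS = this
  have G: "(G has_field_derivative g w) (at w)" if "\<bar>Im w\<bar> < \<sigma>" for w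
    using GS[of w] at_within_open[OF S[THEN iffD2, OF that] strip_open] that S by simp
  have G': "((\<lambda>w. G (w + of_real r)) has_field_derivative g (w + of_real r)) (at w)" if "\<bar>Im w\<bar> < \<sigma>" for w r
    using DERIV_shift[of G "g (w + of_real r)" w "of_real r"] G[of "w + of_real r"] that by simp
  have seg: "\<bar>Im u\<bar> < \<sigma>" if "u \<in> closed_segment w w'" "\<bar>Im w\<bar> < \<sigma>" "\<bar>Im w'\<bar> < \<sigma>" for u w w'
    using closed_segment_subset[of w ?S w'] strip_convex[of "- \<sigma>" \<sigma>] that S by blast
  define H where "H w = G (w + of_real ll) - G w" for w
  have Hh: "H holomorphic_on ?S"
  proof (rule holomorphic_onI)
    fix w assume "w \<in> ?S"
    then have "(H has_field_derivative g (w + of_real ll) - g w) (at w)"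
      unfolding H_def by (intro DERIV_diff G G') auto
    then show "H field_differentiable at w within ?S"
      using field_differentiable_at_within field_differentiable_def by blast
  qed
  \<comment> \<open>A mean value bound on the segment of length \<open>ln 2\<close> needs a bound
    for \<open>g\<close> on it. One factor of \<open>g\<close> gives the decay; the other is
    compared by \<open>ratio\<close> with the single value of \<open>b\<close> at
    \<open>w - d * ln 2\<close>.\<close>
  have Hb: "cmod (H w) \<le> (K * exp (e * ll) * B * ll) * decay e (Re w) * cmod (b (w - of_real (of_int d * ll)))"
    if w: "\<bar>Im w\<bar> < \<sigma>" for w
  proof -
    have "cmod (G (w + of_real ll) - G w) \<le> (K * exp (e * ll - e * \<bar>Re w\<bar>) * (B * cmod (b (w - of_real (of_int d * ll))))) * cmod ((w + of_real ll) - w)"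
    proof (rule field_differentiable_bound)
      show "(G has_field_derivative g u) (at u within closed_segment w (w + of_real ll))"
        if "u \<in> closed_segment w (w + of_real ll)" for u
        using seg[OF that] w by (intro has_field_derivative_at_within[OF G]) auto
      fix u assume "u \<in> closed_segment w (w + of_real ll)"
      then obtain x where x: "0 \<le> x" "x \<le> 1" "u = (1 - x) *\<^sub>R w + x *\<^sub>R (w + of_real ll)"
        unfolding in_segment by auto
      have u: "u = w + of_real (x * ll)" unfolding x(3) by (simp add: algebra_simps scaleR_conv_of_real)
      have xl: "0 \<le> x * ll" "x * ll \<le> ll" using x ll by auto
      have "cmod (g u) \<le> K * decay e (Re u) * cmod (b u)" using gb1[of u] w u by simp
      also have "\<dots> \<le> K * exp (e * ll - e * \<bar>Re w\<bar>) * (B * cmod (b (w - of_real (of_int d * ll))))"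
      proof (intro mult_mono)
        have "e * \<bar>Re w\<bar> \<le> e * (ll + \<bar>Re u\<bar>)" using e xl by (intro mult_left_mono) (auto simp: u)
        then show "decay e (Re u) \<le> exp (e * ll - e * \<bar>Re w\<bar>)" by (simp add: algebra_simps)
        show "cmod (b u) \<le> B * cmod (b (w - of_real (of_int d * ll)))"
          unfolding u b_def by (rule ratio[OF w xl])
      qed (use e in auto)
      finally show "cmod (g u) \<le> K * exp (e * ll - e * \<bar>Re w\<bar>) * (B * cmod (b (w - of_real (of_int d * ll))))" .
    qed auto
    then show ?thesis using ll by (simp add: H_def exp_diff exp_minus field_simps)
  qed
  \<comment> \<open>The telescoped sum of \<open>H (w + k * ln 2)\<close> over
    \<open>- n \<le> k \<le> n\<close>; the upper end is \<open>n + 1\<close> because the last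
    summand reaches from \<open>n\<close> to \<open>n + 1\<close>.\<close>
  define D where "D n w = G (w + of_real ((real n + 1) * ll)) - G (w + of_real (- real n * ll))" for n w
  have Dint: "((\<lambda>t. g (w + of_real t)) has_integral D n w) {- real n * ll..(real n + 1) * ll}"
    if w: "\<bar>Im w\<bar> < \<sigma>" for w n
    unfolding D_def
  proof (rule fundamental_theorem_of_calculus)
    show "- real n * ll \<le> (real n + 1) * ll" using ll by (intro mult_right_mono) auto
    fix t :: real
    have "((\<lambda>z. G (w + z)) has_field_derivative g (w + of_real t)) (at (of_real t))"
      using DERIV_shift[of G "g (w + of_real t)" "of_real t" w] G[of "w + of_real t"] w by (simp add: add.commute)
    from has_vector_derivative_real_field[OF this]
    show "((\<lambda>t. G (w + of_real t)) has_vector_derivative g (w + of_real t)) (at t within {- real n * ll..(real n + 1) * ll})" .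
  qed
  have gc: "continuous_on UNIV (\<lambda>t. g (w + of_real t))" if "\<bar>Im w\<bar> < \<sigma>" for w
    by (rule continuous_on_compose2[OF holomorphic_on_imp_continuous_on[OF gh]])
      (use that in \<open>auto intro!: continuous_intros\<close>)
  define M where "M = integral UNIV (\<lambda>t::real. K\<^sup>2 * decay e t)"
  have ei: "(\<lambda>t::real. K\<^sup>2 * decay e t) integrable_on UNIV"
    by (intro integrable_on_mult_right exp_decay_integrable e)
  \<comment> \<open>The bound for \<open>g\<close> is integrated over the whole line, which makes it
    independent of \<open>n\<close> and, by translation, of \<open>w\<close>.\<close>
  have DM: "cmod (D n w) \<le> M" if w: "\<bar>Im w\<bar> < \<sigma>" for n w
  proof -
    have tr: "((\<lambda>t. K\<^sup>2 * decay e (t + Re w)) has_integral M) UNIV"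
      unfolding M_def by (rule has_integral_UNIV_translate[OF ei])
    have tri: "(\<lambda>t. K\<^sup>2 * decay e (t + Re w)) integrable_on {- real n * ll..(real n + 1) * ll}"
      using tr by (intro integrable_on_subinterval[of _ UNIV]) auto
    have "cmod (D n w) \<le> integral {- real n * ll..(real n + 1) * ll} (\<lambda>t. K\<^sup>2 * decay e (t + Re w))"
      unfolding integral_unique[OF Dint[OF w], symmetric]
    proof (rule integral_norm_bound_integral[OF _ tri])
      show "(\<lambda>t. g (w + of_real t)) integrable_on {- real n * ll..(real n + 1) * ll}" using Dint[OF w] by blast
      show "cmod (g (w + of_real t)) \<le> K\<^sup>2 * decay e (t + Re w)" for t
        using gb[of "w + of_real t"] w by (simp add: add.commute)
    qed
    also have "\<dots> \<le> integral UNIV (\<lambda>t. K\<^sup>2 * decay e (t + Re w))"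
      by (rule integral_subset_le[OF _ tri]) (use tr in auto)
    finally show ?thesis unfolding integral_unique[OF tr] .
  qed
  have g0i: "(\<lambda>t::real. g (of_real t)) integrable_on UNIV"
    by (rule integrable_UNIV_dominated[OF _ ei]) (use gc[of 0] gb[of "of_real _"] s in auto)
  define c where "c = integral UNIV (\<lambda>t::real. g (of_real t))"
  have D0: "(\<lambda>n. D n 0) \<longlonglongrightarrow> c"
  proof (rule LIMSEQ_I)
    fix r :: real assume "0 < r"
    from has_integral_UNIV_D[OF g0i this] obtain X where X: "0 < X"
      "\<And>a b. a \<le> - X \<Longrightarrow> X \<le> b \<Longrightarrow> norm (integral {a..b} (\<lambda>t. g (of_real t)) - c) < r"
      unfolding c_def by metis
    obtain N where N: "X / ll \<le> real N" using real_arch_simple by blast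
    show "\<exists>no. \<forall>n\<ge>no. norm (D n 0 - c) < r"
    proof (intro exI[of _ N] allI impI)
      fix n assume "N \<le> n"
      then have "X / ll \<le> real n" using N by linarith
      then have "X \<le> real n * ll" using ll by (simp add: field_simps)
      then have "norm (integral {- real n * ll..(real n + 1) * ll} (\<lambda>t. g (of_real t)) - c) < r"
        using ll by (intro X) (auto simp: algebra_simps)
      then show "norm (D n 0 - c) < r" using integral_unique[OF Dint[of 0 n]] s by simp
    qed
  qed
  have c0: "c \<noteq> 0"
  proof
    assume c: "c = 0"
    define p where "p t = (cmod (b (of_real t)))\<^sup>2" for t :: real
    have gp: "g (of_real t) = of_real (p t)" for t :: real
      by (simp add: g_def p_def complex_norm_square mult.commute flip: of_real_power)
    have pi: "p integrable_on UNIV"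
      using integrable_linear[OF g0i bounded_linear_Re] by (simp add: o_def gp)
    have "integral UNIV p = Re c"
      using integral_linear[OF g0i bounded_linear_Re] by (simp add: o_def gp c_def)
    then have I0: "integral UNIV p = 0" using c by simp
    have pc: "continuous_on {0..1} p"
      unfolding p_def
      by (intro continuous_intros continuous_on_compose2[OF holomorphic_on_imp_continuous_on[OF bh]]) (use s in auto)
    have "integral {0..1} p \<le> integral UNIV p"
      by (rule integral_subset_le) (use pi pc in \<open>auto simp: p_def intro: integrable_continuous_real\<close>)
    moreover have "0 \<le> integral {0..1} p" by (rule integral_nonneg) (use pc in \<open>auto simp: p_def intro: integrable_continuous_real\<close>)
    ultimately have "integral {0..1} p = 0" using I0 by simp
    then have "p 0 = 0" using integral_eq_0_iff[OF pc] zero_le_power2 by (fastforce simp: p_def)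
    then show False using b0[of 0] s by (simp add: p_def)
  qed
  have Dlim: "(\<lambda>n. D n w) \<longlonglongrightarrow> c" if w: "\<bar>Im w\<bar> < \<sigma>" for w
  proof -
    have "(\<lambda>n. D n w - D n 0) \<longlonglongrightarrow> 0"
    proof (rule exp_decay_tendsto[of "e * ll"])
      show "0 < e * ll" using e ll by simp
      fix n
      have "cmod (D n w - D n 0) \<le> (2 * (K\<^sup>2 * exp (e * cmod w - e * (real n * ll)))) * cmod (w - 0)"
      proof (rule field_differentiable_bound)
        fix u assume u: "u \<in> closed_segment 0 w"
        have uI: "\<bar>Im u\<bar> < \<sigma>" using seg[OF u] w s by simp
        show "(D n has_field_derivative g (u + of_real ((real n + 1) * ll)) - g (u + of_real (- real n * ll))) (at u within closed_segment 0 w)"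
          unfolding D_def by (intro has_field_derivative_at_within[OF DERIV_diff] G' uI)
        have "\<bar>Re u\<bar> \<le> cmod w"
          using abs_Re_le_cmod[of u] segment_bound1[OF u] by simp
        have gu: "cmod (g (u + of_real r)) \<le> K\<^sup>2 * exp (e * cmod w - e * (real n * ll))" if "real n * ll \<le> \<bar>r\<bar>" for r
        proof -
          have "cmod (g (u + of_real r)) \<le> K\<^sup>2 * decay e (Re u + r)" using gb[of "u + of_real r"] uI by simp
          moreover have "e * (real n * ll) \<le> e * (cmod w + \<bar>Re u + r\<bar>)"
            using that \<open>\<bar>Re u\<bar> \<le> cmod w\<close> e by (intro mult_left_mono) auto
          then have "K\<^sup>2 * decay e (Re u + r) \<le> K\<^sup>2 * exp (e * cmod w - e * (real n * ll))"
            by (intro mult_left_mono) (auto simp: algebra_simps)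
          ultimately show ?thesis by linarith
        qed
        have "real n * ll \<le> \<bar>(real n + 1) * ll\<bar>" "real n * ll \<le> \<bar>- real n * ll\<bar>" using ll by (auto simp: algebra_simps)
        from gu[OF this(1)] gu[OF this(2)]
        show "cmod (g (u + of_real ((real n + 1) * ll)) - g (u + of_real (- real n * ll))) \<le> 2 * (K\<^sup>2 * exp (e * cmod w - e * (real n * ll)))"
          using norm_triangle_ineq4[of "g (u + of_real ((real n + 1) * ll))" "g (u + of_real (- real n * ll))"] by linarith
      qed auto
      then show "cmod (D n w - D n 0) \<le> (2 * K\<^sup>2 * exp (e * cmod w) * cmod w) * exp (- (e * ll) * real n)"
        by (simp add: exp_diff exp_minus field_simps)
    qed
    from tendsto_add[OF this D0] show ?thesis by simp
  qed
  \<comment> \<open>The translation by \<open>d * ln 2\<close> moves the reference value in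
    \<open>Hb\<close> to \<open>b w\<close>, so that the division by \<open>b w\<close> leaves the
    decay intact.\<close>
  define h where "h w = H (w + of_real (of_int d * ll)) / (c * b w)" for w
  define \<eta> where "\<eta> z = h (Ln z)" for z
  have \<eta>: "\<eta> \<in> Hinf0 \<sigma>"
  proof (rule Hinf0I[of h \<sigma> e])
    have "(\<lambda>w. H (w + of_real (of_int d * ll))) holomorphic_on ?S"
      by (rule holomorphic_on_compose_gen[OF _ Hh, unfolded o_def]) (auto intro!: holomorphic_intros)
    then show "h holomorphic_on ?S" unfolding h_def
      by (intro holomorphic_intros bh) (use b0 c0 in auto)
    fix w assume w: "\<bar>Im w\<bar> < \<sigma>"
    define x where "x = of_int d * ll"
    have bp: "0 < cmod (b w)" using b0[OF w] by simp
    have "cmod (H (w + of_real x)) \<le> (K * exp (e * ll) * B * ll) * decay e (Re w + x) * cmod (b w)"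
      using Hb[of "w + of_real x"] w by (simp add: x_def)
    then have "cmod (H (w + of_real x)) / cmod (b w) \<le> (K * exp (e * ll) * B * ll) * decay e (Re w + x)"
      using bp by (simp add: pos_divide_le_eq)
    also have "\<dots> \<le> \<bar>K * exp (e * ll) * B * ll\<bar> * exp (e * \<bar>x\<bar> - e * \<bar>Re w\<bar>)"
    proof (intro mult_mono)
      have "e * \<bar>Re w\<bar> \<le> e * (\<bar>x\<bar> + \<bar>Re w + x\<bar>)" using e by (intro mult_left_mono) auto
      then show "decay e (Re w + x) \<le> exp (e * \<bar>x\<bar> - e * \<bar>Re w\<bar>)" by (simp add: algebra_simps)
    qed auto
    also have "\<dots> = (\<bar>K * exp (e * ll) * B * ll\<bar> * exp (e * \<bar>x\<bar>)) * decay e (Re w)"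
      by (simp add: exp_diff exp_minus field_simps)
    finally have "cmod (H (w + of_real x)) / cmod (b w) / cmod c \<le> (\<bar>K * exp (e * ll) * B * ll\<bar> * exp (e * \<bar>x\<bar>)) * decay e (Re w) / cmod c"
      by (rule divide_right_mono) simp
    then show "cmod (h w) \<le> (\<bar>K * exp (e * ll) * B * ll\<bar> * exp (e * \<bar>x\<bar>) / cmod c) * decay e (Re w)"
      by (simp add: h_def x_def norm_divide norm_mult mult.commute)
  qed (use s e in \<open>auto simp: \<eta>_def\<close>)
  have sum: "(\<Sum>k\<in>{- int n..int n}. \<eta> (2 powi k * z) * \<psi> (2 powi k * z)) = D n (Ln z + of_real (of_int d * ll)) / c"
    if z: "z \<in> sector \<sigma>" for n z
  proof -
    define w where "w = Ln z"
    have w: "\<bar>Im w\<bar> < \<sigma>" "z = exp w" using sector_Ln[OF s(1) z] by (auto simp: w_def)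
    define f where "f k = G (w + of_real (of_int d * ll) + of_real (of_int k * ll))" for k :: int
    have "\<eta> (2 powi k * z) * \<psi> (2 powi k * z) = (f (k + 1) - f k) / c" for k
    proof -
      have e: "2 powi k * z = exp (w + of_real (of_int k * ll))"
        by (simp only: two_powi_eq_exp ll_def w(2) flip: exp_add) (simp add: add.commute)
      have "Ln (exp (w + of_real (of_int k * ll))) = w + of_real (of_int k * ll)"
        using w s by (intro Ln_exp) auto
      then have "\<eta> (2 powi k * z) * \<psi> (2 powi k * z) = h (w + of_real (of_int k * ll)) * b (w + of_real (of_int k * ll))"
        unfolding \<eta>_def e b_def by simp
      also have "\<dots> = H (w + of_real (of_int k * ll) + of_real (of_int d * ll)) / c"
        using b0[of "w + of_real (of_int k * ll)"] w by (simp add: h_def)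
      also have "H (w + of_real (of_int k * ll) + of_real (of_int d * ll)) = f (k + 1) - f k"
        by (simp add: H_def f_def algebra_simps)
      finally show ?thesis .
    qed
    then have "(\<Sum>k\<in>{- int n..int n}. \<eta> (2 powi k * z) * \<psi> (2 powi k * z)) = (f (int n + 1) - f (- int n)) / c"
      by (simp add: sum_int_telescope flip: sum_divide_distrib)
    then show ?thesis by (simp add: f_def D_def w_def)
  qed
  show ?thesis
  proof (rule bexI[OF _ \<eta>], intro exI[of _ "M / cmod c"] ballI conjI allI)
    fix z assume z: "z \<in> sector \<sigma>"
    have w: "\<bar>Im (Ln z + of_real (of_int d * ll))\<bar> < \<sigma>" using sector_Ln[OF s(1) z] by simp
    show "cmod (\<Sum>k\<in>{- int n..int n}. \<eta> (2 powi k * z) * \<psi> (2 powi k * z)) \<le> M / cmod c" for n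
      unfolding sum[OF z] norm_divide by (intro divide_right_mono DM w) simp
    have "(\<lambda>n. D n (Ln z + of_real (of_int d * ll)) / c) \<longlonglongrightarrow> c / c"
      by (intro tendsto_divide Dlim w c0 tendsto_const)
    then show "(\<lambda>n. \<Sum>k\<in>{- int n..int n}. \<eta> (2 powi k * z) * \<psi> (2 powi k * z)) \<longlonglongrightarrow> 1"
      unfolding sum[OF z] using c0 by simp
  qed
qed

context sectorial_operator
begin

text \<open>Dominated convergence is applied not to the vector-valued integrands but to the real
  functions \<open>q n\<close>, which bound the norm of the difference on a ray and tend to 0
  pointwise.\<close>

lemma calc_tendsto:
  assumes g: "g \<in> Hinf0 \<sigma>" and a: "\<theta> < a" "a < \<sigma>" "\<sigma> \<le> pi"
    and E: "\<And>n. E n holomorphic_on sector \<sigma>" "\<And>n z. z \<in> sector \<sigma> \<Longrightarrow> cmod (E n z) \<le> B"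
    and lim: "\<And>z. z \<in> sector \<sigma> \<Longrightarrow> (\<lambda>n. E n z) \<longlonglongrightarrow> 1"
  shows "(\<lambda>n. Hinf0_calc A a (\<lambda>z. E n z * g z) x) \<longlonglongrightarrow> Hinf0_calc A a g x"
proof -
  have s: "0 < \<sigma>" using a angle by linarith
  obtain K e where e: "0 < e" "0 \<le> K"
    and K: "\<And>w. \<bar>Im w\<bar> < \<sigma> \<Longrightarrow> cmod (g (exp w)) \<le> K * decay e (Re w)"
    using Hinf0_decay[OF g s a(3)] by metis
  have Eg: "(\<lambda>z. E n z * g z) \<in> Hinf0 \<sigma>" for n by (rule Hinf0_mult_bounded[OF g E])
  have ray: "(\<lambda>n. integral UNIV (\<lambda>t. (E n (exp (Complex t c)) * g (exp (Complex t c))) *\<^sub>C U x (Complex t c)))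
     \<longlonglongrightarrow> integral UNIV (\<lambda>t. g (exp (Complex t c)) *\<^sub>C U x (Complex t c))" if c: "\<bar>c\<bar> = a" for c
  proof (rule LIM_zero_cancel)
    have ca: "\<theta> < \<bar>c\<bar>" "\<bar>c\<bar> < \<sigma>" using a c by auto
    have sec: "exp (Complex t c) \<in> sector \<sigma>" for t using ca a s by (intro exp_in_sector) auto
    have off: "exp (Complex t c) \<in> off" for t using ca a angle by (intro exp_off) auto
    define q where "q n t = cmod (E n (exp (Complex t c)) - 1) * cmod (g (exp (Complex t c))) * (C * norm x)" for n t
    have Ec: "continuous_on UNIV (\<lambda>t. E n (exp (Complex t c)))" for n
      by (rule continuous_on_line[OF holomorphic_on_sector_exp[OF E(1)]]) (use ca a s in auto)
    have gc: "continuous_on UNIV (\<lambda>t. g (exp (Complex t c)))"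
      by (rule continuous_on_line[OF holomorphic_on_sector_exp[of _ \<sigma>]]) (use g ca a s in \<open>auto simp: Hinf0_def\<close>)
    have qi: "(\<lambda>t. (B + 1) * K * (C * norm x) * decay e t) integrable_on UNIV"
      by (intro integrable_on_mult_right exp_decay_integrable e)
    have qb: "norm (q n t) \<le> (B + 1) * K * (C * norm x) * decay e t" for n t
    proof -
      have "cmod (E n (exp (Complex t c)) - 1) \<le> B + 1"
        using E(2)[OF sec, of n t] norm_triangle_ineq4[of "E n (exp (Complex t c))" 1] by simp
      moreover have "cmod (g (exp (Complex t c))) \<le> K * decay e t" using K[of "Complex t c"] ca by simp
      ultimately have "cmod (E n (exp (Complex t c)) - 1) * cmod (g (exp (Complex t c))) \<le> (B + 1) * (K * decay e t)"
        by (intro mult_mono) (auto intro: order_trans[OF norm_ge_zero])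
      then have "q n t \<le> (B + 1) * (K * decay e t) * (C * norm x)"
        unfolding q_def using Cn_nonneg by (intro mult_right_mono)
      moreover have "0 \<le> q n t" unfolding q_def by (rule mult_nonneg_nonneg[OF mult_nonneg_nonneg[OF norm_ge_zero norm_ge_zero] Cn_nonneg])
      ultimately show ?thesis by (simp add: mult_ac)
    qed
    have qint: "q n integrable_on UNIV" for n
      by (rule integrable_UNIV_dominated[OF _ qi qb]) (unfold q_def, intro continuous_intros Ec gc)
    have "(\<lambda>n. integral UNIV (q n)) \<longlonglongrightarrow> integral UNIV (\<lambda>t::real. 0::real)"
    proof (rule dominated_convergence(2)[OF qint qi])
      show "norm (q n t) \<le> (B + 1) * K * (C * norm x) * decay e t" for n t by (rule qb)
      show "(\<lambda>n. q n t) \<longlonglongrightarrow> 0" for t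
      proof -
        have "(\<lambda>n. cmod (E n (exp (Complex t c)) - 1) * cmod (g (exp (Complex t c))) * (C * norm x))
          \<longlonglongrightarrow> cmod (1 - 1) * cmod (g (exp (Complex t c))) * (C * norm x)"
          by (intro tendsto_intros lim sec)
        then show ?thesis by (simp add: q_def)
      qed
    qed
    then have q0: "(\<lambda>n. integral UNIV (q n)) \<longlonglongrightarrow> 0" by simp
    have i1: "(\<lambda>t. (E n (exp (Complex t c)) * g (exp (Complex t c))) *\<^sub>C U x (Complex t c)) integrable_on UNIV" for n
      by (rule ray_integrable[OF Eg ca a(3)])
    have i2: "(\<lambda>t. g (exp (Complex t c)) *\<^sub>C U x (Complex t c)) integrable_on UNIV"
      by (rule ray_integrable[OF g ca a(3)])
    show "(\<lambda>n. integral UNIV (\<lambda>t. (E n (exp (Complex t c)) * g (exp (Complex t c))) *\<^sub>C U x (Complex t c))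
      - integral UNIV (\<lambda>t. g (exp (Complex t c)) *\<^sub>C U x (Complex t c))) \<longlonglongrightarrow> 0"
    proof (rule Lim_null_comparison[OF _ q0], intro always_eventually allI)
      fix n
      show "norm (integral UNIV (\<lambda>t. (E n (exp (Complex t c)) * g (exp (Complex t c))) *\<^sub>C U x (Complex t c))
        - integral UNIV (\<lambda>t. g (exp (Complex t c)) *\<^sub>C U x (Complex t c))) \<le> integral UNIV (q n)"
        unfolding integral_diff[OF i1 i2, symmetric]
      proof (rule integral_norm_bound_integral[OF integrable_diff[OF i1 i2] qint])
        fix t
        have "(E n (exp (Complex t c)) * g (exp (Complex t c))) *\<^sub>C U x (Complex t c) - g (exp (Complex t c)) *\<^sub>C U x (Complex t c)
          = ((E n (exp (Complex t c)) - 1) * g (exp (Complex t c))) *\<^sub>C U x (Complex t c)"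
          by (simp add: left_diff_distrib scaleC.diff_left)
        then show "norm ((E n (exp (Complex t c)) * g (exp (Complex t c))) *\<^sub>C U x (Complex t c) - g (exp (Complex t c)) *\<^sub>C U x (Complex t c)) \<le> q n t"
          unfolding q_def by (simp add: norm_scaleC norm_mult mult_left_mono U_norm[OF off])
      qed
    qed
  qed
  have aa: "\<bar>a\<bar> = a" "\<bar>- a\<bar> = a" using a angle by auto
  show ?thesis
    unfolding calc_split[OF g a] calc_split[OF Eg a]
    by (intro scaleC.tendsto tendsto_const tendsto_diff ray aa)
qed

end

section \<open>The norm of \<open>X(\<ell>\<^sup>s)\<close>\<close>

text \<open>If one of the points is 0, \<open>r powr p \<le> r\<close> for
  \<open>0 \<le> r \<le> 1\<close> suffices; for positive points this is convexity of the
  power.\<close>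

lemma powr_convex_nonneg:
  fixes x y t p :: real
  assumes "1 \<le> p" "0 \<le> x" "0 \<le> y" "0 \<le> t" "t \<le> 1"
  shows "(t * x + (1 - t) * y) powr p \<le> t * x powr p + (1 - t) * y powr p"
proof -
  have *: "(r * z) powr p \<le> r * z powr p" if "0 \<le> r" "r \<le> 1" "0 \<le> z" for r z :: real
  proof (cases "r = 0")
    case False
    then have "r powr p \<le> r powr 1" using that assms(1) by (intro powr_mono') auto
    then have "r powr p \<le> r" using that by simp
    then show ?thesis using that by (simp add: powr_mult mult_right_mono)
  qed simp
  consider "x = 0" | "y = 0" | "0 < x" "0 < y" using assms by fastforce
  then show ?thesis
  proof cases
    case 1
    then show ?thesis using *[of "1 - t" y] assms by simp
  next
    case 2
    then show ?thesis using *[of t x] assms by simp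
  next
    case 3
    then show ?thesis
      using convex_onD[OF powr_convex[OF assms(1)], of t y x] assms by (simp add: add.commute)
  qed
qed

text \<open>Convexity of the power is applied to the normalised entries
  \<open>\<bar>a j\<bar> / N a\<close> and \<open>\<bar>b j\<bar> / N b\<close> with the weight
  \<open>t = N a / (N a + N b)\<close>; summation gives \<open>(N a + N b) powr p\<close>. If one of
  the norms is 0, that sequence vanishes on \<open>J\<close>.\<close>

lemma Minkowski_sum:
  fixes a b :: "'i \<Rightarrow> complex" and p :: real
  assumes p: "1 \<le> p" and J: "finite J"
  shows "(\<Sum>j\<in>J. cmod (a j + b j) powr p) powr (1 / p)
    \<le> (\<Sum>j\<in>J. cmod (a j) powr p) powr (1 / p) + (\<Sum>j\<in>J. cmod (b j) powr p) powr (1 / p)"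
proof -
  define S where "S c = (\<Sum>j\<in>J. cmod (c j) powr p)" for c :: "'i \<Rightarrow> complex"
  define N where "N c = S c powr (1 / p)" for c
  have S0: "0 \<le> S c" for c unfolding S_def by (intro sum_nonneg) auto
  have N0: "0 \<le> N c" for c by (simp add: N_def)
  have NS: "N c powr p = S c" for c using S0[of c] p by (simp add: N_def powr_powr)
  have zero: "c j = 0" if "N c = 0" "j \<in> J" for c j
  proof -
    have "S c = 0" using NS[of c] that by simp
    then show ?thesis using that J by (simp add: S_def sum_nonneg_eq_0_iff)
  qed
  have "N (\<lambda>j. a j + b j) \<le> N a + N b"
  proof (cases "N a = 0 \<or> N b = 0")
    case True
    then have "S (\<lambda>j. a j + b j) = S b \<or> S (\<lambda>j. a j + b j) = S a"
    proof
      assume "N a = 0"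
      then have "S (\<lambda>j. a j + b j) = S b" unfolding S_def by (intro sum.cong) (auto simp: zero)
      then show ?thesis ..
    next
      assume "N b = 0"
      then have "S (\<lambda>j. a j + b j) = S a" unfolding S_def by (intro sum.cong) (auto simp: zero)
      then show ?thesis ..
    qed
    then have "N (\<lambda>j. a j + b j) = N b \<or> N (\<lambda>j. a j + b j) = N a" by (auto simp: N_def)
    then show ?thesis using N0[of a] N0[of b] by auto
  next
    case False
    then have pos: "0 < N a" "0 < N b" using N0 by (auto simp: less_le)
    define t where "t = N a / (N a + N b)"
    have t: "0 \<le> t" "t \<le> 1" "1 - t = N b / (N a + N b)" using pos by (auto simp: t_def field_simps)
    have le: "cmod (a j + b j) powr p \<le> (N a + N b) powr p * (t * (cmod (a j) powr p / S a) + (1 - t) * (cmod (b j) powr p / S b))" for j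
    proof -
      have "cmod (a j + b j) \<le> (N a + N b) * (t * (cmod (a j) / N a) + (1 - t) * (cmod (b j) / N b))"
      proof -
        have "t * (cmod (a j) / N a) = cmod (a j) / (N a + N b)" using pos by (simp add: t_def)
        moreover have "(1 - t) * (cmod (b j) / N b) = cmod (b j) / (N a + N b)" using pos by (simp add: t(3))
        moreover have "N a + N b \<noteq> 0" using pos by simp
        ultimately show ?thesis
          using norm_triangle_ineq[of "a j" "b j"] by (simp add: distrib_left)
      qed
      then have "cmod (a j + b j) powr p \<le> ((N a + N b) * (t * (cmod (a j) / N a) + (1 - t) * (cmod (b j) / N b))) powr p"
        using p by (intro powr_mono2) auto
      also have "\<dots> = (N a + N b) powr p * (t * (cmod (a j) / N a) + (1 - t) * (cmod (b j) / N b)) powr p"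
        using pos t by (intro powr_mult)
      also have "\<dots> \<le> (N a + N b) powr p * (t * (cmod (a j) / N a) powr p + (1 - t) * (cmod (b j) / N b) powr p)"
        using pos t p by (intro mult_left_mono powr_convex_nonneg) auto
      finally show ?thesis using pos by (simp add: powr_divide NS)
    qed
    have Spos: "0 < S a" "0 < S b" using pos NS[of a] NS[of b] by (metis powr_gt_zero less_irrefl)+
    have "S (\<lambda>j. a j + b j) \<le> (\<Sum>j\<in>J. (N a + N b) powr p * (t * (cmod (a j) powr p / S a) + (1 - t) * (cmod (b j) powr p / S b)))"
      unfolding S_def[of "\<lambda>j. a j + b j"] by (intro sum_mono le)
    also have "\<dots> = (N a + N b) powr p * (t * (S a / S a) + (1 - t) * (S b / S b))"
    proof -
      have "(\<Sum>j\<in>J. w * (t * (x j / u) + r * (y j / v))) = w * (t * (sum x J / u) + r * (sum y J / v))"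
        for w r u v :: real and x y :: "'i \<Rightarrow> real"
        by (simp add: sum.distrib flip: sum_distrib_left sum_divide_distrib)
      from this[of "(N a + N b) powr p" "\<lambda>j. cmod (a j) powr p" "S a" "1 - t" "\<lambda>j. cmod (b j) powr p" "S b"]
      show ?thesis unfolding S_def[of a, symmetric] S_def[of b, symmetric] .
    qed
    also have "\<dots> = (N a + N b) powr p" using Spos by simp
    finally have "S (\<lambda>j. a j + b j) powr (1 / p) \<le> ((N a + N b) powr p) powr (1 / p)"
      using S0 p by (intro powr_mono2) auto
    then show ?thesis using pos p by (simp add: N_def powr_powr)
  qed
  then show ?thesis by (simp add: N_def S_def)
qed

lemma ls_norm_finite:
  assumes "finite J" "1 \<le> s" "s \<noteq> \<infinity>"
  shows "ls_norm s J a = ennreal ((\<Sum>j\<in>J. cmod (a j) powr enn2real s) powr (1 / enn2real s))"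
  using assms by (simp add: ls_norm_def nn_integral_count_space_finite sum_ennreal ennpowr_def sum_nonneg)

lemma enn2real_ge_1: "1 \<le> s \<Longrightarrow> s \<noteq> \<infinity> \<Longrightarrow> 1 \<le> enn2real s"
  by (cases s) (auto simp flip: ennreal_1)

lemma ls_norm_triangle:
  assumes J: "finite J" and s: "1 \<le> s"
  shows "ls_norm s J (\<lambda>j. a j + b j) \<le> ls_norm s J a + ls_norm s J b"
proof (cases "s = \<infinity>")
  case True
  show ?thesis unfolding ls_norm_def using True
    by (auto intro!: SUP_least order_trans[OF ennreal_leI[OF norm_triangle_ineq]] add_mono SUP_upper simp: ennreal_plus)
next
  case False
  then show ?thesis
    unfolding ls_norm_finite[OF J s False] using Minkowski_sum[OF enn2real_ge_1[OF s False] J, of a b]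
    by (simp add: ennreal_plus[symmetric] ennreal_leI del: ennreal_plus)
qed

lemma ls_norm_mult_le:
  assumes J: "finite J" and s: "1 \<le> s" and B: "0 \<le> B" "\<And>j. j \<in> J \<Longrightarrow> cmod (c j) \<le> B"
  shows "ls_norm s J (\<lambda>j. c j * a j) \<le> ennreal B * ls_norm s J a"
proof (cases "s = \<infinity>")
  case True
  have "ennreal (cmod (c j * a j)) \<le> ennreal B * (SUP j\<in>J. ennreal (cmod (a j)))" if "j \<in> J" for j
  proof -
    have "ennreal (cmod (c j * a j)) \<le> ennreal (B * cmod (a j))"
      using B that by (intro ennreal_leI) (simp add: norm_mult mult_right_mono)
    also have "\<dots> = ennreal B * ennreal (cmod (a j))" using B by (simp add: ennreal_mult)
    also have "\<dots> \<le> ennreal B * (SUP j\<in>J. ennreal (cmod (a j)))" by (intro mult_left_mono SUP_upper that) auto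
    finally show ?thesis .
  qed
  then show ?thesis unfolding ls_norm_def using True by (auto intro!: SUP_least)
next
  case False
  define p where "p = enn2real s"
  have p: "1 \<le> p" unfolding p_def by (rule enn2real_ge_1[OF s False])
  have "(\<Sum>j\<in>J. cmod (c j * a j) powr p) \<le> (\<Sum>j\<in>J. B powr p * cmod (a j) powr p)"
  proof (rule sum_mono)
    fix j assume "j \<in> J"
    then have "cmod (c j * a j) powr p \<le> (B * cmod (a j)) powr p"
      using B p by (intro powr_mono2) (auto simp: norm_mult mult_right_mono)
    then show "cmod (c j * a j) powr p \<le> B powr p * cmod (a j) powr p" using B by (simp add: powr_mult)
  qed
  then have "(\<Sum>j\<in>J. cmod (c j * a j) powr p) powr (1 / p) \<le> (B powr p * (\<Sum>j\<in>J. cmod (a j) powr p)) powr (1 / p)"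
    using p by (intro powr_mono2) (auto simp: sum_distrib_left sum_nonneg)
  also have "\<dots> = B * (\<Sum>j\<in>J. cmod (a j) powr p) powr (1 / p)"
    using B p by (simp add: powr_mult sum_nonneg powr_powr)
  finally show ?thesis
    unfolding ls_norm_finite[OF J s False] p_def[symmetric] using B by (simp add: ennreal_mult'[symmetric] ennreal_leI)
qed

text \<open>With \<open>T\<close> the sum of the moduli, \<open>\<bar>a j\<bar> powr p\<close> is at
  most \<open>T powr (p - 1)\<close> times \<open>\<bar>a j\<bar>\<close>. The bound yields
  continuity of the mixed norm with respect to the norms of the entries.\<close>

lemma ls_norm_le_sum:
  assumes J: "finite J" and s: "1 \<le> s"
  shows "ls_norm s J a \<le> (\<Sum>j\<in>J. ennreal (cmod (a j)))"
proof (cases "s = \<infinity>")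
  case True
  show ?thesis unfolding ls_norm_def using True J
    by (simp add: sum_ennreal) (auto intro!: SUP_least ennreal_leI member_le_sum)
next
  case False
  define p where "p = enn2real s"
  have p: "1 \<le> p" unfolding p_def by (rule enn2real_ge_1[OF s False])
  define T where "T = (\<Sum>j\<in>J. cmod (a j))"
  have T: "0 \<le> T" by (simp add: T_def sum_nonneg)
  have "(\<Sum>j\<in>J. cmod (a j) powr p) \<le> (\<Sum>j\<in>J. T powr (p - 1) * cmod (a j))"
  proof (rule sum_mono)
    fix j assume "j \<in> J"
    then have le: "cmod (a j) \<le> T" unfolding T_def using J by (intro member_le_sum) auto
    show "cmod (a j) powr p \<le> T powr (p - 1) * cmod (a j)"
    proof (cases "cmod (a j) = 0")
      case False
      then have "cmod (a j) powr p = cmod (a j) powr (p - 1) * cmod (a j)"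
        using powr_add[of "cmod (a j)" "p - 1" 1] by simp
      also have "\<dots> \<le> T powr (p - 1) * cmod (a j)" using le p by (intro mult_right_mono powr_mono2) auto
      finally show ?thesis .
    qed simp
  qed
  also have "\<dots> = T powr (p - 1) * T" by (simp add: T_def sum_distrib_left)
  also have "\<dots> = T powr p"
    using T powr_add[of T "p - 1" 1] p by (cases "T = 0") auto
  finally have "(\<Sum>j\<in>J. cmod (a j) powr p) powr (1 / p) \<le> (T powr p) powr (1 / p)"
    using p by (intro powr_mono2) (auto simp: sum_nonneg)
  also have "\<dots> = T" using T p by (simp add: powr_powr)
  finally show ?thesis
    unfolding ls_norm_finite[OF J s False] p_def[symmetric] T_def by (simp add: sum_ennreal ennreal_leI)
qed

lemma ls_norm_singleton:
  assumes "1 \<le> s"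
  shows "ls_norm s {i} a = ennreal (cmod (a i))"
proof (cases "s = \<infinity>")
  case False
  then show ?thesis using enn2real_ge_1[OF assms False] by (simp add: ls_norm_finite[OF _ assms] powr_powr)
qed (simp add: ls_norm_def)

lemma ennpowr_mono:
  assumes "a \<le> b" "0 \<le> p"
  shows "ennpowr a p \<le> ennpowr b p"
proof -
  have "enn2real a \<le> enn2real b" if "b \<noteq> \<infinity>"
    using assms that by (intro enn2real_mono) (auto simp: top.not_eq_extremum)
  then show ?thesis using assms
    by (auto simp: ennpowr_def top_unique intro!: ennreal_leI powr_mono2)
qed

text \<open>Covers restriction to a subset, translation of the indices and, used in both directions,
  a change of enumeration.\<close>

lemma ls_norm_mono_inj:
  assumes s: "1 \<le> s" and h: "inj_on h J" "h ` J \<subseteq> I"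
  shows "ls_norm s J (\<lambda>j. a (h j)) \<le> ls_norm s I a"
proof (cases "s = \<infinity>")
  case True
  then show ?thesis using h unfolding ls_norm_def by (auto intro!: SUP_least SUP_upper)
next
  case False
  have "(\<integral>\<^sup>+j. ennreal (cmod (a (h j)) powr enn2real s) \<partial>count_space J)
    = (\<integral>\<^sup>+j. ennreal (cmod (a j) powr enn2real s) \<partial>count_space (h ` J))"
    using h(1) by (intro nn_integral_bij_count_space[where f = "\<lambda>j. ennreal (cmod (a j) powr enn2real s)"]) (simp add: bij_betw_def)
  also have "\<dots> \<le> (\<integral>\<^sup>+j. ennreal (cmod (a j) powr enn2real s) \<partial>count_space I)"
    using h(2) by (subst (1 2) nn_integral_count_space_indicator)
      (auto intro!: nn_integral_mono simp: image_subset_iff split: split_indicator)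
  finally show ?thesis using False by (auto simp: ls_norm_def intro!: ennpowr_mono)
qed

lemma ls_norm_cong: "(\<And>j. j \<in> J \<Longrightarrow> a j = b j) \<Longrightarrow> ls_norm s J a = ls_norm s J b"
  unfolding ls_norm_def by (auto intro!: arg_cong[where f = "\<lambda>u. ennpowr u _"] nn_integral_cong SUP_cong)

text \<open>The power with exponent \<open>1 / p\<close> is monotone and inverse on finite values,
  so suprema are respected without a continuity argument. Arguing by contradiction supplies the
  finiteness of the supremum of the powers.\<close>

lemma ennpowr_SUP:
  fixes F :: "nat \<Rightarrow> ennreal"
  assumes F: "incseq F" and p: "0 < p"
  shows "ennpowr (SUP n. F n) p = (SUP n. ennpowr (F n) p)"
proof (rule antisym)
  show "(SUP n. ennpowr (F n) p) \<le> ennpowr (SUP n. F n) p"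
    using p by (intro SUP_least ennpowr_mono SUP_upper) auto
  show "ennpowr (SUP n. F n) p \<le> (SUP n. ennpowr (F n) p)"
  proof (rule ccontr)
    define b where "b = (SUP n. ennpowr (F n) p)"
    assume "\<not> ennpowr (SUP n. F n) p \<le> (SUP n. ennpowr (F n) p)"
    then have lt: "b < ennpowr (SUP n. F n) p" by (simp add: b_def)
    then have bf: "b \<noteq> \<infinity>" by auto
    have le: "F n \<le> ennpowr b (1 / p)" for n
    proof -
      have Fb: "ennpowr (F n) p \<le> b" unfolding b_def by (intro SUP_upper) auto
      then have Ff: "F n \<noteq> \<infinity>" using bf by (auto simp: ennpowr_def top_unique)
      then have "ennpowr (ennpowr (F n) p) (1 / p) = F n"
        using p by (simp add: ennpowr_def powr_powr top.not_eq_extremum)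
      then show ?thesis using ennpowr_mono[OF Fb, of "1 / p"] p by simp
    qed
    then have "(SUP n. F n) \<le> ennpowr b (1 / p)" by (intro SUP_least)
    then have "ennpowr (SUP n. F n) p \<le> ennpowr (ennpowr b (1 / p)) p" using p by (intro ennpowr_mono) auto
    also have "\<dots> = b" using p bf by (simp add: ennpowr_def powr_powr top.not_eq_extremum)
    finally show False using lt by simp
  qed
qed

text \<open>The intervals exhaust the integers; for finite \<open>s\<close>, monotone convergence
  under the counting measure is combined with \<open>ennpowr_SUP\<close>.\<close>

lemma ls_norm_UNIV_int:
  assumes s: "1 \<le> s"
  shows "ls_norm s (UNIV :: int set) a = (SUP n. ls_norm s {- int n..int n} a)"
    and "incseq (\<lambda>n. ls_norm s {- int n..int n} a)"
proof -
  show "incseq (\<lambda>n. ls_norm s {- int n..int n} a)"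
    by (intro incseq_SucI ls_norm_mono_inj[OF s, where h = "\<lambda>j. j"]) auto
  have U: "(UNIV :: int set) = (\<Union>n. {- int n..int n})"
  proof -
    have "x \<in> {- int (nat \<bar>x\<bar>)..int (nat \<bar>x\<bar>)}" for x by auto
    then show ?thesis by blast
  qed
  show "ls_norm s (UNIV :: int set) a = (SUP n. ls_norm s {- int n..int n} a)"
  proof (cases "s = \<infinity>")
    case True
    then show ?thesis unfolding ls_norm_def by (subst U) (simp add: SUP_UNION)
  next
    case False
    define f where "f j = ennreal (cmod (a j) powr enn2real s)" for j
    have fin: "(\<integral>\<^sup>+j. f j \<partial>count_space {- int n..int n}) = (\<integral>\<^sup>+j. f j * indicator {- int n..int n} j \<partial>count_space UNIV)" for n
      by (subst nn_integral_count_space_indicator) (auto simp: mult.commute)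
    have mono: "incseq (\<lambda>n j. f j * indicator {- int n..int n} j)"
      by (auto simp: incseq_def le_fun_def split: split_indicator)
    have "f j = (SUP n. f j * indicator {- int n..int n} j)" for j
    proof (rule antisym)
      have "f j = f j * indicator {- int (nat \<bar>j\<bar>)..int (nat \<bar>j\<bar>)} j" by (auto simp: indicator_def)
      also have "\<dots> \<le> (SUP n. f j * indicator {- int n..int n} j)" by (intro SUP_upper) auto
      finally show "f j \<le> (SUP n. f j * indicator {- int n..int n} j)" .
    qed (auto intro!: SUP_least split: split_indicator)
    then have "(\<integral>\<^sup>+j. f j \<partial>count_space UNIV) = (\<integral>\<^sup>+j. (SUP n. f j * indicator {- int n..int n} j) \<partial>count_space UNIV)"
      by simp
    also have "\<dots> = (SUP n. \<integral>\<^sup>+j. f j \<partial>count_space {- int n..int n})"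
      unfolding fin by (intro nn_integral_monotone_convergence_SUP mono) auto
    finally have "(\<integral>\<^sup>+j. f j \<partial>count_space UNIV) = (SUP n. \<integral>\<^sup>+j. f j \<partial>count_space {- int n..int n})" .
    moreover have "incseq (\<lambda>n. \<integral>\<^sup>+j. f j \<partial>count_space {- int n..int n})"
      unfolding fin using mono by (intro incseq_SucI nn_integral_mono) (auto simp: incseq_Suc_iff le_fun_def)
    moreover have "0 < 1 / enn2real s" using enn2real_ge_1[OF s False] by simp
    ultimately show ?thesis using False unfolding ls_norm_def f_def[symmetric] by (simp add: ennpowr_SUP)
  qed
qed

text \<open>Minkowski's inequality for integrals, through Riemann sums. As \<open>J\<close> is
  finite, one tagged division is fine enough for all \<open>h j\<close> and for \<open>b\<close>. On
  it \<open>P\<close> is estimated by sublinearity, and \<open>cont\<close> controls the passage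
  from the sums to the integrals.\<close>

lemma seminorm_integral_le:
  fixes h :: "'i \<Rightarrow> real \<Rightarrow> 'x::banach" and P :: "('i \<Rightarrow> 'x) \<Rightarrow> real"
  assumes J: "finite J"
    and h: "\<And>j. j \<in> J \<Longrightarrow> h j integrable_on UNIV" and b: "b integrable_on UNIV" "\<And>t. 0 \<le> b t"
    and add: "\<And>x y. P (\<lambda>j. x j + y j) \<le> P x + P y"
    and scale: "\<And>r x. 0 \<le> r \<Longrightarrow> P (\<lambda>j. r *\<^sub>R x j) \<le> r * P x"
    and cont: "\<And>x. P x \<le> (\<Sum>j\<in>J. norm (x j))"
    and le: "\<And>t. P (\<lambda>j. h j t) \<le> b t"
  shows "P (\<lambda>j. integral UNIV (h j)) \<le> integral UNIV b"
proof (rule field_le_epsilon)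
  fix \<epsilon> :: real assume "0 < \<epsilon>"
  \<comment> \<open>One \<open>e\<close> is spent on the Riemann sum of \<open>b\<close>, and two
    for each \<open>j\<close>: on the truncation to \<open>[- n, n]\<close> and on the Riemann sum
    of \<open>h j\<close>.\<close>
  define e where "e = \<epsilon> / (1 + 2 * real (card J))"
  have e: "0 < e" using \<open>0 < \<epsilon>\<close> by (simp add: e_def add_pos_nonneg)
  have "\<forall>\<^sub>F n in sequentially. \<forall>j\<in>J. norm (integral {- real n..real n} (h j) - integral UNIV (h j)) < e"
    using integral_UNIV_limit[OF h] e J
    by (intro eventually_ball_finite ballI) (auto simp: tendsto_iff dist_norm)
  then obtain n where n: "\<And>j. j \<in> J \<Longrightarrow> norm (integral {- real n..real n} (h j) - integral UNIV (h j)) < e"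
    by (auto simp: eventually_sequentially)
  define a where "a = real n"
  have sub: "f integrable_on cbox (- a) a" if "f integrable_on UNIV" for f :: "real \<Rightarrow> 'c::banach"
    using that by (rule integrable_on_subcbox) auto
  have "\<exists>\<gamma>. \<forall>j\<in>J. gauge (\<gamma> j) \<and> (\<forall>p. p tagged_division_of cbox (- a) a \<and> \<gamma> j fine p \<longrightarrow>
      norm ((\<Sum>(x, k)\<in>p. measure lborel k *\<^sub>R h j x) - integral (cbox (- a) a) (h j)) < e)"
  proof (rule bchoice, rule ballI)
    fix j assume "j \<in> J"
    from integrable_integral[OF sub[OF h[OF this]], unfolded has_integral, rule_format, OF e]
    show "\<exists>\<gamma>. gauge \<gamma> \<and> (\<forall>p. p tagged_division_of cbox (- a) a \<and> \<gamma> fine p \<longrightarrow>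
      norm ((\<Sum>(x, k)\<in>p. measure lborel k *\<^sub>R h j x) - integral (cbox (- a) a) (h j)) < e)" .
  qed
  then obtain \<gamma> where \<gamma>0: "\<forall>j\<in>J. gauge (\<gamma> j) \<and> (\<forall>p. p tagged_division_of cbox (- a) a \<and> \<gamma> j fine p \<longrightarrow>
      norm ((\<Sum>(x, k)\<in>p. measure lborel k *\<^sub>R h j x) - integral (cbox (- a) a) (h j)) < e)" ..
  have \<gamma>: "gauge (\<gamma> j)"
    "\<And>p. p tagged_division_of cbox (- a) a \<Longrightarrow> \<gamma> j fine p \<Longrightarrow>
      norm ((\<Sum>(x, k)\<in>p. measure lborel k *\<^sub>R h j x) - integral (cbox (- a) a) (h j)) < e" if "j \<in> J" for j
    using \<gamma>0[rule_format, OF that] by simp_all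
  from integrable_integral[OF sub[OF b(1)], unfolded has_integral, rule_format, OF e]
  obtain \<gamma>b where \<gamma>b0: "gauge \<gamma>b \<and> (\<forall>p. p tagged_division_of cbox (- a) a \<and> \<gamma>b fine p \<longrightarrow>
      norm ((\<Sum>(x, k)\<in>p. measure lborel k *\<^sub>R b x) - integral (cbox (- a) a) b) < e)" ..
  have \<gamma>b: "gauge \<gamma>b" "\<And>p. p tagged_division_of cbox (- a) a \<Longrightarrow> \<gamma>b fine p \<Longrightarrow>
      norm ((\<Sum>(x, k)\<in>p. measure lborel k *\<^sub>R b x) - integral (cbox (- a) a) b) < e"
    using \<gamma>b0 by simp_all
  have "gauge (\<lambda>x. \<Inter>{\<gamma> j x |j. j \<in> J})" using J \<gamma>(1) by (rule gauge_Inter)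
  with \<gamma>b(1) have "gauge (\<lambda>x. \<gamma>b x \<inter> \<Inter>{\<gamma> j x |j. j \<in> J})" by (rule gauge_Int)
  then obtain p where p: "p tagged_division_of cbox (- a) a" "(\<lambda>x. \<gamma>b x \<inter> \<Inter>{\<gamma> j x |j. j \<in> J}) fine p"
    using fine_division_exists by blast
  from p(2) have fine: "\<gamma>b fine p" "\<And>j. j \<in> J \<Longrightarrow> \<gamma> j fine p" unfolding fine_def by blast+
  define S where "S j = (\<Sum>(x, k)\<in>p. measure lborel k *\<^sub>R h j x)" for j
  have PS: "P (\<lambda>j. \<Sum>(x, k)\<in>q. measure lborel k *\<^sub>R h j x) \<le> (\<Sum>(x, k)\<in>q. measure lborel k *\<^sub>R b x)" if "finite q" for q :: "(real \<times> real set) set"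
    using that
  proof induction
    case empty
    then show ?case using scale[of 0 "\<lambda>_. 0"] by simp
  next
    case (insert u q)
    obtain x k where u: "u = (x, k)" by fastforce
    have "P (\<lambda>j. measure lborel k *\<^sub>R h j x + (\<Sum>(x, k)\<in>q. measure lborel k *\<^sub>R h j x))
       \<le> P (\<lambda>j. measure lborel k *\<^sub>R h j x) + P (\<lambda>j. \<Sum>(x, k)\<in>q. measure lborel k *\<^sub>R h j x)" by (rule add)
    also have "P (\<lambda>j. measure lborel k *\<^sub>R h j x) \<le> measure lborel k * P (\<lambda>j. h j x)" by (rule scale) simp
    also have "\<dots> \<le> measure lborel k * b x" by (intro mult_left_mono le) simp
    finally show ?case using insert by (simp add: u)
  qed
  have "finite p" using p(1) by blast
  have "P (\<lambda>j. integral UNIV (h j)) = P (\<lambda>j. S j + (integral UNIV (h j) - S j))" by simp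
  also have "\<dots> \<le> P S + P (\<lambda>j. integral UNIV (h j) - S j)" by (rule add)
  also have "P S \<le> (\<Sum>(x, k)\<in>p. measure lborel k *\<^sub>R b x)" unfolding S_def by (rule PS[OF \<open>finite p\<close>])
  also have "\<dots> \<le> integral (cbox (- a) a) b + e" using \<gamma>b(2)[OF p(1) fine(1)] by simp
  also have "integral (cbox (- a) a) b \<le> integral UNIV b"
    by (rule integral_subset_le[OF _ sub[OF b(1)] b(1)]) (use b(2) in auto)
  also have "P (\<lambda>j. integral UNIV (h j) - S j) \<le> (\<Sum>j\<in>J. 2 * e)"
  proof (rule order_trans[OF cont sum_mono])
    fix j assume j: "j \<in> J"
    have "norm (S j - integral {- a..a} (h j)) < e" using \<gamma>(2)[OF j p(1) fine(2)[OF j]] by (simp add: S_def)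
    moreover have "norm (integral {- a..a} (h j) - integral UNIV (h j)) < e" using n[OF j] by (simp add: a_def)
    ultimately have "norm (S j - integral UNIV (h j)) < e + e" by (rule norm_diff_triangle_less)
    then show "norm (integral UNIV (h j) - S j) \<le> 2 * e" by (simp add: norm_minus_commute)
  qed
  finally have "P (\<lambda>j. integral UNIV (h j)) \<le> integral UNIV b + e * (1 + 2 * real (card J))"
    by (simp add: algebra_simps)
  also have "e * (1 + 2 * real (card J)) = \<epsilon>" unfolding e_def
    using of_nat_0_le_iff[of "card J"] by (smt (verit) nonzero_eq_divide_eq)
  finally show "P (\<lambda>j. integral UNIV (h j)) \<le> integral UNIV b + \<epsilon>" .
qed

section \<open>Mixed norms and functionals in the function space\<close>

context complex_banach_function_space
begin

abbreviation mixed :: "ennreal \<Rightarrow> 'i set \<Rightarrow> ('i \<Rightarrow> 'x) \<Rightarrow> ennreal" where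
  "mixed \<equiv> mixed_norm \<rho> rep"

declare rep_measurable [measurable]

lemma measurable_ls_norm_finite:
  assumes J: "finite J" and s: "1 \<le> s"
  shows "(\<lambda>\<xi>. ls_norm s J (\<lambda>j. rep (x j) \<xi>)) \<in> borel_measurable M"
proof (cases "s = \<infinity>")
  case True
  then show ?thesis using countable_finite[OF J] by (simp add: ls_norm_def)
next
  case False
  show ?thesis unfolding ls_norm_finite[OF J s False] by measurable
qed

lemma measurable_ls_norm_UNIV:
  assumes s: "1 \<le> s"
  shows "(\<lambda>\<xi>. ls_norm s (UNIV :: int set) (\<lambda>j. rep (x j) \<xi>)) \<in> borel_measurable M"
  unfolding ls_norm_UNIV_int(1)[OF s]
  by (intro borel_measurable_SUP measurable_ls_norm_finite s) auto

lemma mixed_norm_add: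
  assumes J: "finite J" and s: "1 \<le> s"
  shows "mixed s J (\<lambda>j. x j + y j) \<le> mixed s J x + mixed s J y"
proof -
  have "AE \<xi> in M. \<forall>j\<in>J. rep (x j + y j) \<xi> = rep (x j) \<xi> + rep (y j) \<xi>"
    using J by (intro AE_finite_allI rep_add)
  then have "AE \<xi> in M. ls_norm s J (\<lambda>j. rep (x j + y j) \<xi>) \<le> ls_norm s J (\<lambda>j. rep (x j) \<xi>) + ls_norm s J (\<lambda>j. rep (y j) \<xi>)"
  proof eventually_elim
    case (elim \<xi>)
    then have "ls_norm s J (\<lambda>j. rep (x j + y j) \<xi>) = ls_norm s J (\<lambda>j. rep (x j) \<xi> + rep (y j) \<xi>)"
      by (intro ls_norm_cong) auto
    also have "\<dots> \<le> ls_norm s J (\<lambda>j. rep (x j) \<xi>) + ls_norm s J (\<lambda>j. rep (y j) \<xi>)"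
      by (rule ls_norm_triangle[OF J s])
    finally show ?case .
  qed
  then have "mixed s J (\<lambda>j. x j + y j) \<le> \<rho> (\<lambda>\<xi>. ls_norm s J (\<lambda>j. rep (x j) \<xi>) + ls_norm s J (\<lambda>j. rep (y j) \<xi>))"
    unfolding mixed_norm_def
    by (intro rho_mono borel_measurable_add measurable_ls_norm_finite J s)
  also have "\<dots> \<le> mixed s J x + mixed s J y"
    unfolding mixed_norm_def by (intro rho_triangle measurable_ls_norm_finite J s)
  finally show ?thesis .
qed

lemma rho_zero: "\<rho> (\<lambda>_. 0) = 0"
  by (subst rho_eq_0_iff) auto

lemma mixed_norm_scale:
  assumes J: "finite J" and s: "1 \<le> s" and B: "0 \<le> B" "\<And>j. j \<in> J \<Longrightarrow> cmod (c j) \<le> B"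
  shows "mixed s J (\<lambda>j. c j *\<^sub>C x j) \<le> ennreal B * mixed s J x"
proof -
  have "AE \<xi> in M. \<forall>j\<in>J. rep (c j *\<^sub>C x j) \<xi> = c j * rep (x j) \<xi>"
    using J by (intro AE_finite_allI rep_scaleC)
  then have "AE \<xi> in M. ls_norm s J (\<lambda>j. rep (c j *\<^sub>C x j) \<xi>) \<le> ennreal B * ls_norm s J (\<lambda>j. rep (x j) \<xi>)"
  proof eventually_elim
    case (elim \<xi>)
    then have "ls_norm s J (\<lambda>j. rep (c j *\<^sub>C x j) \<xi>) = ls_norm s J (\<lambda>j. c j * rep (x j) \<xi>)"
      by (intro ls_norm_cong) auto
    also have "\<dots> \<le> ennreal B * ls_norm s J (\<lambda>j. rep (x j) \<xi>)"
      by (rule ls_norm_mult_le[OF J s B])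
    finally show ?case .
  qed
  then have le: "mixed s J (\<lambda>j. c j *\<^sub>C x j) \<le> \<rho> (\<lambda>\<xi>. ennreal B * ls_norm s J (\<lambda>j. rep (x j) \<xi>))"
    unfolding mixed_norm_def
  proof (rule rho_mono[rotated 2])
    have [measurable]: "(\<lambda>\<xi>. ls_norm s J (\<lambda>j. rep (x j) \<xi>)) \<in> borel_measurable M"
      by (rule measurable_ls_norm_finite[OF J s])
    show "(\<lambda>\<xi>. ennreal B * ls_norm s J (\<lambda>j. rep (x j) \<xi>)) \<in> borel_measurable M" by measurable
  qed (rule measurable_ls_norm_finite[OF J s])
  show ?thesis
  \<comment> \<open>\<open>rho_scale\<close> speaks of positive factors.\<close>
  proof (cases "B = 0")
    case True
    then show ?thesis using le by (simp add: rho_zero)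
  next
    case False
    then have "0 < B" using B by simp
    then have "\<rho> (\<lambda>\<xi>. ennreal B * ls_norm s J (\<lambda>j. rep (x j) \<xi>)) = ennreal B * mixed s J x"
      unfolding mixed_norm_def by (intro rho_scale measurable_ls_norm_finite J s)
    then show ?thesis using le by simp
  qed
qed

lemma mixed_norm_le_sum:
  assumes J: "finite J" and s: "1 \<le> s"
  shows "mixed s J x \<le> (\<Sum>j\<in>J. ennreal (norm (x j)))"
proof -
  have m: "(\<lambda>\<xi>. \<Sum>j\<in>K. ennreal (cmod (rep (x j) \<xi>))) \<in> borel_measurable M" for K by measurable
  have "mixed s J x \<le> \<rho> (\<lambda>\<xi>. \<Sum>j\<in>J. ennreal (cmod (rep (x j) \<xi>)))"
    unfolding mixed_norm_def
    by (intro rho_mono measurable_ls_norm_finite J s m AE_I2 ls_norm_le_sum)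
  also have "\<dots> \<le> (\<Sum>j\<in>J. ennreal (norm (x j)))"
    using J
  proof induction
    case (insert i K)
    have "\<rho> (\<lambda>\<xi>. ennreal (cmod (rep (x i) \<xi>)) + (\<Sum>j\<in>K. ennreal (cmod (rep (x j) \<xi>))))
      \<le> \<rho> (\<lambda>\<xi>. ennreal (cmod (rep (x i) \<xi>))) + \<rho> (\<lambda>\<xi>. \<Sum>j\<in>K. ennreal (cmod (rep (x j) \<xi>)))"
      by (intro rho_triangle m) measurable
    also have "\<dots> \<le> ennreal (norm (x i)) + (\<Sum>j\<in>K. ennreal (norm (x j)))"
      using insert by (intro add_mono) (simp_all add: norm_rep)
    finally show ?case using insert by (simp del: sum_ennreal)
  qed (simp add: rho_zero)
  finally show ?thesis .
qed

lemma mixed_norm_finite: "finite J \<Longrightarrow> 1 \<le> s \<Longrightarrow> mixed s J x < \<infinity>"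
  by (rule le_less_trans[OF mixed_norm_le_sum]) (auto simp: sum_ennreal)

text \<open>By the Fatou property of \<open>\<rho>\<close>, estimates for finitely many indices with
  a common bound are enough.\<close>

lemma mixed_norm_UNIV_le:
  assumes s: "1 \<le> s" and K: "\<And>n. mixed s {- int n..int n} x \<le> K"
  shows "mixed s (UNIV :: int set) x \<le> K"
proof -
  have "(\<lambda>n. mixed s {- int n..int n} x) \<longlonglongrightarrow> mixed s (UNIV :: int set) x"
    unfolding mixed_norm_def
  proof (rule rho_Fatou)
    show "(\<lambda>\<xi>. ls_norm s {- int n..int n} (\<lambda>j. rep (x j) \<xi>)) \<in> borel_measurable M" for n
      by (intro measurable_ls_norm_finite s) simp
    show "(\<lambda>\<xi>. ls_norm s (UNIV :: int set) (\<lambda>j. rep (x j) \<xi>)) \<in> borel_measurable M"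
      by (rule measurable_ls_norm_UNIV[OF s])
    show "AE \<xi> in M. incseq (\<lambda>n. ls_norm s {- int n..int n} (\<lambda>j. rep (x j) \<xi>)) \<and>
       (\<lambda>n. ls_norm s {- int n..int n} (\<lambda>j. rep (x j) \<xi>)) \<longlonglongrightarrow> ls_norm s UNIV (\<lambda>j. rep (x j) \<xi>)"
      using ls_norm_UNIV_int[OF s] by (auto intro!: AE_I2 LIMSEQ_SUP)
  qed
  then show ?thesis by (rule LIMSEQ_le_const2) (use K in auto)
qed

lemma mixed_norm_shift_le:
  assumes J: "finite J" and s: "1 \<le> s"
  shows "mixed s J (\<lambda>j. x (j + l)) \<le> mixed s (UNIV :: int set) x"
  unfolding mixed_norm_def
  by (intro rho_mono measurable_ls_norm_finite measurable_ls_norm_UNIV J s AE_I2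
      ls_norm_mono_inj[where h = "\<lambda>j. j + l"]) auto

lemma mixed_norm_singleton: "1 \<le> s \<Longrightarrow> mixed s {i} x = ennreal (norm (x i))"
  by (simp add: mixed_norm_def ls_norm_singleton norm_rep)

text \<open>The definition speaks of the index sets \<open>{..<n}\<close>, but the indices will be
  integers. An enumeration of \<open>J\<close> carries the bound over, with one constant for all
  \<open>J\<close>.\<close>

lemma Rs_bounded_finite:
  assumes T: "Rs_bounded \<rho> rep s \<T>" and s: "1 \<le> s"
  shows "\<exists>C>0. \<forall>(J :: 'i set) T x. finite J \<longrightarrow> (\<forall>j\<in>J. T j \<in> \<T>) \<longrightarrow>
    mixed s J (\<lambda>j. T j (x j)) \<le> ennreal C * mixed s J x"
proof -
  from T obtain C where C: "0 < C" "\<And>(n::nat) T x. (\<forall>j<n. T j \<in> \<T>) \<Longrightarrow>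
        mixed s {..<n} (\<lambda>j. T j (x j)) \<le> ennreal C * mixed s {..<n} x"
    unfolding Rs_bounded_def by blast
  show ?thesis
  proof (intro exI[of _ C] conjI C(1) allI impI)
    fix J :: "'i set" and T x assume J: "finite J" and TJ: "\<forall>j\<in>J. T j \<in> \<T>"
    from ex_bij_betw_nat_finite[OF J] obtain h where h: "bij_betw h {..<card J} J"
      by (auto simp: atLeast0LessThan)
    have eq: "mixed s {..<card J} (\<lambda>i. y (h i)) = mixed s J y" for y
    proof -
      have "ls_norm s {..<card J} (\<lambda>i. a (h i)) = ls_norm s J a" for a
      proof (rule antisym)
        show "ls_norm s {..<card J} (\<lambda>i. a (h i)) \<le> ls_norm s J a"
          using h by (intro ls_norm_mono_inj s) (auto simp: bij_betw_def)
        have "ls_norm s J a = ls_norm s J (\<lambda>j. a (h (the_inv_into {..<card J} h j)))"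
          by (rule ls_norm_cong) (metis bij_betw_def f_the_inv_into_f h)
        also have "\<dots> \<le> ls_norm s {..<card J} (\<lambda>i. a (h i))"
          using bij_betw_the_inv_into[OF h]
          by (intro ls_norm_mono_inj[where a = "\<lambda>i. a (h i)"] s) (auto simp: bij_betw_def)
        finally show "ls_norm s J a \<le> ls_norm s {..<card J} (\<lambda>i. a (h i))" .
      qed
      from this[of "\<lambda>j. rep (y j) \<xi>" for \<xi>] show ?thesis unfolding mixed_norm_def by simp
    qed
    have "\<forall>i<card J. T (h i) \<in> \<T>" using TJ h by (auto simp: bij_betw_def)
    from C(2)[OF this, of "\<lambda>i. x (h i)"]
    show "mixed s J (\<lambda>j. T j (x j)) \<le> ennreal C * mixed s J x"
      using eq[of "\<lambda>j. T j (x j)"] eq[of x] by simp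
  qed
qed

text \<open>The functionals \<open>x \<mapsto> \<integral>\<^sub>B g x d\<mu>\<close>, with \<open>B\<close> bounded and \<open>\<bar>g\<bar> \<le> 1\<close>; they separate the points of
  the space, which replaces the Hahn-Banach theorem.\<close>

definition local_functionals :: "('x \<Rightarrow> complex) set" where
  "local_functionals = {(\<lambda>x. LINT \<xi>|M. indicator B \<xi> *\<^sub>R (g \<xi> * rep x \<xi>)) | B g n.
     B \<in> sets M \<and> B \<subseteq> \<Omega> n \<and> g \<in> borel_measurable M \<and> (\<forall>\<xi>. cmod (g \<xi>) \<le> 1)}"

lemma local_integrable:
  assumes B: "B \<in> sets M" "B \<subseteq> \<Omega> n" and g: "g \<in> borel_measurable M" "\<And>\<xi>. cmod (g \<xi>) \<le> 1"
  obtains C where "0 \<le> C" "\<And>x. integrable M (\<lambda>\<xi>. indicator B \<xi> *\<^sub>R (g \<xi> * rep x \<xi>))"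
    "\<And>x. cmod (LINT \<xi>|M. indicator B \<xi> *\<^sub>R (g \<xi> * rep x \<xi>)) \<le> C * norm x"
proof -
  from rho_local_L1[OF B] obtain C where C: "\<And>f. f \<in> borel_measurable M \<Longrightarrow> (\<integral>\<^sup>+\<xi>\<in>B. f \<xi> \<partial>M) \<le> ennreal C * \<rho> f"
    by blast
  have m: "(\<lambda>\<xi>. indicator B \<xi> *\<^sub>R (g \<xi> * rep x \<xi>)) \<in> borel_measurable M" for x
    using B g by measurable
  have le: "(\<integral>\<^sup>+\<xi>. ennreal (cmod (indicator B \<xi> *\<^sub>R (g \<xi> * rep x \<xi>))) \<partial>M) \<le> ennreal (max C 0 * norm x)" for x
  proof -
    have "(\<integral>\<^sup>+\<xi>. ennreal (cmod (indicator B \<xi> *\<^sub>R (g \<xi> * rep x \<xi>))) \<partial>M) \<le> (\<integral>\<^sup>+\<xi>\<in>B. ennreal (cmod (rep x \<xi>)) \<partial>M)"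
    proof (rule nn_integral_mono)
      fix \<xi>
      have "cmod (g \<xi> * rep x \<xi>) \<le> 1 * cmod (rep x \<xi>)" unfolding norm_mult by (intro mult_right_mono g) simp
      then show "ennreal (cmod (indicator B \<xi> *\<^sub>R (g \<xi> * rep x \<xi>))) \<le> ennreal (cmod (rep x \<xi>)) * indicator B \<xi>"
        by (auto split: split_indicator intro: ennreal_leI)
    qed
    also have "\<dots> \<le> ennreal C * \<rho> (\<lambda>\<xi>. ennreal (cmod (rep x \<xi>)))" by (rule C) measurable
    also have "\<dots> = ennreal C * ennreal (norm x)" by (simp add: norm_rep)
    also have "\<dots> = ennreal (max C 0 * norm x)" by (simp add: ennreal_mult' max_def ennreal_neg)
    finally show ?thesis .
  qed
  have int: "integrable M (\<lambda>\<xi>. indicator B \<xi> *\<^sub>R (g \<xi> * rep x \<xi>))" for x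
    by (rule integrableI_bounded[OF m]) (rule le_less_trans[OF le], simp)
  show ?thesis
  proof (rule that[OF _ int])
    show "0 \<le> max C 0" by simp
    fix x
    have "ennreal (cmod (LINT \<xi>|M. indicator B \<xi> *\<^sub>R (g \<xi> * rep x \<xi>))) \<le> ennreal (max C 0 * norm x)"
      by (rule order_trans[OF integral_norm_bound_ennreal[OF int] le])
    then show "cmod (LINT \<xi>|M. indicator B \<xi> *\<^sub>R (g \<xi> * rep x \<xi>)) \<le> max C 0 * norm x"
      by (subst (asm) ennreal_le_iff) auto
  qed
qed

lemma local_functionals_clinear:
  assumes "l \<in> local_functionals"
  shows "clinear_functional l"
proof -
  from assms obtain B g n where B: "B \<in> sets M" "B \<subseteq> \<Omega> n" and g: "g \<in> borel_measurable M" "\<And>\<xi>. cmod (g \<xi>) \<le> 1"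
    and l: "l = (\<lambda>x. LINT \<xi>|M. indicator B \<xi> *\<^sub>R (g \<xi> * rep x \<xi>))"
    unfolding local_functionals_def by auto
  obtain C where C: "\<And>x. integrable M (\<lambda>\<xi>. indicator B \<xi> *\<^sub>R (g \<xi> * rep x \<xi>))"
    "\<And>x. cmod (l x) \<le> C * norm x" unfolding l using local_integrable[OF B g] by metis
  have m [measurable]: "(\<lambda>\<xi>. indicator B \<xi> *\<^sub>R (g \<xi> * rep x \<xi>)) \<in> borel_measurable M" for x
    using B g by measurable
  have add: "l (x + y) = l x + l y" for x y
  proof -
    have "l (x + y) = (LINT \<xi>|M. indicator B \<xi> *\<^sub>R (g \<xi> * rep x \<xi>) + indicator B \<xi> *\<^sub>R (g \<xi> * rep y \<xi>))"
      unfolding l using rep_add[of x y]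
      by (intro integral_cong_AE borel_measurable_add m, eventually_elim) (simp add: algebra_simps)
    then show ?thesis unfolding l by (simp add: C)
  qed
  have scale: "l (c *\<^sub>C x) = c * l x" for c x
  proof -
    have "l (c *\<^sub>C x) = (LINT \<xi>|M. c * (indicator B \<xi> *\<^sub>R (g \<xi> * rep x \<xi>)))"
      unfolding l using rep_scaleC[of c x]
      by (intro integral_cong_AE borel_measurable_times borel_measurable_const m, eventually_elim) (simp add: algebra_simps)
    then show ?thesis unfolding l by (simp only: integral_mult_right_zero)
  qed
  have "bounded_linear l"
  proof (rule bounded_linear_intro[of _ C])
    show "l (r *\<^sub>R x) = r *\<^sub>R l x" for r x
      using scale[of "of_real r" x] by (simp add: scaleC_of_real scaleR_conv_of_real)
  qed (use add C in \<open>auto simp: mult.commute\<close>)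
  then show ?thesis using scale by (simp add: clinear_functional_def)
qed

text \<open>Testing with \<open>g = cnj (sgn (rep x))\<close> on the bounded set
  \<open>\<Omega> n\<close> turns the functional into the integral of the modulus of
  \<open>x\<close> over \<open>\<Omega> n\<close>. So \<open>x\<close> vanishes almost everywhere on
  each of these countably many sets.\<close>

lemma local_functionals_separating:
  assumes "\<And>l. l \<in> local_functionals \<Longrightarrow> l x = 0"
  shows "x = 0"
proof -
  define g where "g \<xi> = cnj (sgn (rep x \<xi>))" for \<xi>
  have gm: "g \<in> borel_measurable M"
  proof -
    have "(\<lambda>\<xi>. cnj (rep x \<xi> / of_real (cmod (rep x \<xi>)))) \<in> borel_measurable M"
      by (intro borel_measurable_continuous_on[of cnj] borel_measurable_divide) (auto intro!: continuous_intros)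
    then show ?thesis by (simp add: g_def[abs_def] sgn_eq)
  qed
  have g1: "cmod (g \<xi>) \<le> 1" for \<xi> by (simp add: g_def norm_sgn)
  have gr: "g \<xi> * rep x \<xi> = of_real (cmod (rep x \<xi>))" for \<xi>
  proof (cases "rep x \<xi> = 0")
    case False
    have "cnj (rep x \<xi>) * rep x \<xi> = of_real (cmod (rep x \<xi>)) * of_real (cmod (rep x \<xi>))"
      by (metis complex_norm_square mult.commute of_real_power power2_eq_square)
    then show ?thesis using False by (simp add: g_def sgn_eq)
  qed (simp add: g_def)
  have "AE \<xi> in M. \<xi> \<in> \<Omega> n \<longrightarrow> rep x \<xi> = 0" for n
  proof -
    have int: "integrable M (\<lambda>\<xi>. indicator (\<Omega> n) \<xi> *\<^sub>R (g \<xi> * rep x \<xi>))"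
      using local_integrable[OF exhaust_sets order_refl gm g1] by metis
    have "(LINT \<xi>|M. indicator (\<Omega> n) \<xi> *\<^sub>R (g \<xi> * rep x \<xi>)) = 0"
      by (rule assms[of "\<lambda>x. LINT \<xi>|M. indicator (\<Omega> n) \<xi> *\<^sub>R (g \<xi> * rep x \<xi>)"])
        (use exhaust_sets gm g1 in \<open>auto simp: local_functionals_def intro!: exI[of _ "\<Omega> n"] exI[of _ g] exI[of _ n]\<close>)
    moreover have e: "indicator (\<Omega> n) \<xi> *\<^sub>R (g \<xi> * rep x \<xi>) = complex_of_real (indicator (\<Omega> n) \<xi> * cmod (rep x \<xi>))" for \<xi>
      by (simp add: gr scaleR_conv_of_real)
    ultimately have 0: "(LINT \<xi>|M. indicator (\<Omega> n) \<xi> * cmod (rep x \<xi>)) = 0"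
      unfolding e integral_complex_of_real by simp
    have "integrable M (\<lambda>\<xi>. indicator (\<Omega> n) \<xi> * cmod (rep x \<xi>))"
      using int unfolding e by (simp only: complex_of_real_integrable_eq)
    from integral_nonneg_eq_0_iff_AE[OF this] 0
    have "AE \<xi> in M. indicator (\<Omega> n) \<xi> * cmod (rep x \<xi>) = 0" by simp
    then show ?thesis by eventually_elim (auto simp: indicator_def)
  qed
  then have "AE \<xi> in M. \<forall>n. \<xi> \<in> \<Omega> n \<longrightarrow> rep x \<xi> = 0" by (subst AE_all_countable) blast
  then have "AE \<xi> in M. ennreal (cmod (rep x \<xi>)) = 0"
  proof (rule AE_mp, intro AE_I2 impI)
    fix \<xi> assume "\<xi> \<in> space M" "\<forall>n. \<xi> \<in> \<Omega> n \<longrightarrow> rep x \<xi> = 0"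
    then show "ennreal (cmod (rep x \<xi>)) = 0" using exhaust_Union by auto
  qed
  then have "\<rho> (\<lambda>\<xi>. ennreal (cmod (rep x \<xi>))) = 0" by (subst rho_eq_0_iff) auto
  then show "x = 0" by (simp flip: norm_rep)
qed

end

section \<open>The square function estimate\<close>

context sectorial_operator
begin

lemma calc_cong:
  assumes "\<And>z. z \<in> sector \<sigma> \<Longrightarrow> g z = h z" and a: "\<theta> < a" "a < \<sigma>" "\<sigma> \<le> pi"
  shows "Hinf0_calc A a g x = Hinf0_calc A a h x"
proof -
  have "g (exp (Complex t c)) = h (exp (Complex t c))" if "\<bar>c\<bar> = a" for t c
    by (rule assms(1), rule exp_in_sector) (use that a angle in auto)
  then show ?thesis unfolding calc_eq using a angle by simp
qed

lemma calc_zero: "Hinf0_calc A a (\<lambda>_. 0) x = 0"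
  by (simp add: calc_eq scaleC.zero_left scaleC.zero_right)

lemma calc_zero_right:
  assumes g: "g \<in> Hinf0 \<sigma>" and a: "\<theta> < a" "a < \<sigma>" "\<sigma> \<le> pi"
  shows "Hinf0_calc A a g 0 = 0"
  using calc_diff[OF g a, of 0 0] by simp

lemma calc_sum:
  assumes K: "finite K" and g: "\<And>k. k \<in> K \<Longrightarrow> g k \<in> Hinf0 \<sigma>" and a: "\<theta> < a" "a < \<sigma>" "\<sigma> \<le> pi"
  shows "Hinf0_calc A a (\<lambda>z. \<Sum>k\<in>K. g k z) x = (\<Sum>k\<in>K. Hinf0_calc A a (g k) x)"
proof -
  define H where "H k t = g k (exp (Complex t (- a))) *\<^sub>C U x (Complex t (- a)) - g k (exp (Complex t a)) *\<^sub>C U x (Complex t a)" for k t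
  have i: "H k integrable_on UNIV" if "k \<in> K" for k
    unfolding H_def[abs_def] by (intro integrable_diff ray_integrable[OF g[OF that]]) (use a angle in auto)
  have "integral UNIV (\<lambda>t. \<Sum>k\<in>K. H k t) = (\<Sum>k\<in>K. integral UNIV (H k))"
    by (rule Henstock_Kurzweil_Integration.integral_sum[OF K i])
  then show ?thesis
    unfolding calc_eq scaleC.sum_left sum_subtractf[symmetric] H_def[abs_def]
    by (simp only: scaleC.sum_right)
qed

end

lemma Hinf0_powi:
  assumes "g \<in> Hinf0 \<sigma>" "0 < \<sigma>" "\<sigma> \<le> pi"
  shows "(\<lambda>z. g (2 powi k * z)) \<in> Hinf0 \<sigma>"
  unfolding two_powi_eq_exp by (rule Hinf0_dilate[OF assms])

text \<open>On the contour dilated by \<open>2^-j\<close>, a function dilated by \<open>2^k\<close>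
  is evaluated at the parameter \<open>t + (k - j) * ln 2\<close>, so only the offset
  \<open>k - j\<close> counts.\<close>

lemma powi_exp_line:
  "2 powi k * exp (Complex (t + - (of_int j * ln 2)) c) = exp (Complex (t + of_int (k - j) * ln 2) c)"
  unfolding two_powi_eq_exp exp_add[symmetric]
  by (rule arg_cong[where f = exp]) (simp add: complex_eq_iff algebra_simps)

lemma sum_int_abs_le:
  fixes g :: "nat \<Rightarrow> real"
  assumes "\<And>i. 0 \<le> g i"
  shows "(\<Sum>l\<in>{- int m..int m}. g (nat \<bar>l\<bar>)) \<le> 2 * (\<Sum>i\<le>m. g i)"
proof -
  have "(\<Sum>l\<in>{- int m..int m}. g (nat \<bar>l\<bar>)) + g 0 = 2 * (\<Sum>i\<le>m. g i)"
  proof (induction m)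
    case (Suc m)
    have "{- int (Suc m)..int (Suc m)} = insert (1 + int m) (insert (- 1 - int m) {- int m..int m})" by auto
    moreover have "nat \<bar>1 + int m\<bar> = Suc m" "nat \<bar>- 1 - int m\<bar> = Suc m" by auto
    ultimately show ?case using Suc by simp
  qed simp
  then show ?thesis using assms[of 0] by linarith
qed

lemma sum_power_le:
  fixes q :: real
  assumes "0 \<le> q" "q < 1"
  shows "(\<Sum>i\<le>m. q ^ i) \<le> 1 / (1 - q)"
proof -
  have "(\<Sum>i\<le>m. q ^ i) \<le> (\<Sum>i. q ^ i)"
    using assms by (intro sum_le_suminf summable_geometric) auto
  then show ?thesis using assms by (simp add: suminf_geometric)
qed

section \<open>The estimate for a fixed offset and its summation\<close>

context complex_banach_function_space
begin

text \<open>The geometric factor in \<open>\<bar>l\<bar>\<close> is what makes the sum over the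
  offsets converge. The factor \<open>1 / pi\<close> arises from two rays with the prefactor
  \<open>1 / (2 * pi)\<close> each, and the integral on the right is that of the remaining decay in
  \<open>t\<close>.\<close>

lemma diagonal_calc_bound:
  assumes S: "sectorial_operator A \<theta> C L" and s: "1 \<le> s"
    and Cr: "0 \<le> Cr" and Rs: "\<And>z (x :: int \<Rightarrow> 'x). (\<And>j. j \<in> J \<Longrightarrow> z j \<notin> closure (sector \<theta>)) \<Longrightarrow>
      mixed s J (\<lambda>j. z j *\<^sub>C resolvent (z j) A (x j)) \<le> ennreal Cr * mixed s J x"
    and a: "\<theta> < a" "a < \<sigma>" "\<sigma> \<le> pi"
    and \<phi>: "\<phi> \<in> Hinf0 \<sigma>" "\<And>w. \<bar>Im w\<bar> < \<sigma> \<Longrightarrow> cmod (\<phi> (exp w)) \<le> K1 * decay e (Re w)"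
    and \<eta>: "\<eta> \<in> Hinf0 \<sigma>" "\<And>w. \<bar>Im w\<bar> < \<sigma> \<Longrightarrow> cmod (\<eta> (exp w)) \<le> K2 * decay e (Re w)"
    and K: "0 < e" "0 \<le> K1" "0 \<le> K2"
    and f: "f holomorphic_on sector \<sigma>" "\<And>z. z \<in> sector \<sigma> \<Longrightarrow> cmod (f z) \<le> F" "0 \<le> F"
    and J: "finite J" and Y: "mixed s J y \<le> ennreal Y" "0 \<le> Y"
  shows "mixed s J (\<lambda>j. Hinf0_calc A a (\<lambda>z. f z * (\<phi> (2 powi j * z) * \<eta> (2 powi (j + l) * z))) (y j))
    \<le> ennreal (K1 * K2 * Cr / pi * integral UNIV (\<lambda>t::real. decay (e / 2) t) * F * exp (- (e / 2) * ln 2) ^ nat \<bar>l\<bar> * Y)"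
proof -
  interpret S: sectorial_operator A \<theta> C L by (rule S)
  note angle = S.angle
  have s0: "0 < \<sigma>" using a angle by linarith
  \<comment> \<open>On finite families the mixed norm is finite and can be treated as a real
    seminorm, as \<open>seminorm_integral_le\<close> requires.\<close>
  define P where "P x = enn2real (mixed s J x)" for x
  have EP: "mixed s J x = ennreal (P x)" for x
    unfolding P_def using mixed_norm_finite[OF J s, of x] by simp
  have P0: "0 \<le> P x" for x by (simp add: P_def)
  have Ple: "P x \<le> r" if "mixed s J x \<le> ennreal r" "0 \<le> r" for x r
    using that unfolding EP by simp
  have Padd: "P (\<lambda>j. x j + y j) \<le> P x + P y" for x y
    using mixed_norm_add[OF J s, of x y] P0[of x] P0[of y] by (intro Ple) (simp_all add: EP ennreal_plus)
  have Pscale: "P (\<lambda>j. c j *\<^sub>C x j) \<le> B * P x" if "0 \<le> B" "\<And>j. j \<in> J \<Longrightarrow> cmod (c j) \<le> B" for B c x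
    using mixed_norm_scale[OF J s that] that(1) P0[of x] by (intro Ple) (simp_all add: EP ennreal_mult)
  define g where "g j = (\<lambda>z. f z * (\<phi> (2 powi j * z) * \<eta> (2 powi (j + l) * z)))" for j :: int
  have gH: "g j \<in> Hinf0 \<sigma>" for j
    unfolding g_def
    by (intro Hinf0_mult_bounded[OF _ f(1,2)] Hinf0_mult Hinf0_powi \<phi> \<eta> s0 a)
  define G where "G c j t = g j (exp (Complex t c)) *\<^sub>C S.U (y j) (Complex t c)" for c :: real and j :: int and t :: real
  define k where "k = 1 / (2 * of_real pi * \<i>)"
  have kn: "cmod k = 1 / (2 * pi)" by (simp add: k_def norm_divide norm_mult)
  \<comment> \<open>The \<open>j\<close>-th integrand is translated by \<open>j * ln 2\<close>. Its
    integral does not change, but now the scalar bounds at the parameter \<open>t\<close> are the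
    same for all \<open>j\<close>.\<close>
  define h where "h j t = k *\<^sub>C (G (- a) j (t + - (of_int j * ln 2)) - G a j (t + - (of_int j * ln 2)))" for j :: int and t :: real
  have Gi: "G c j integrable_on UNIV" if "\<bar>c\<bar> = a" for c j
    unfolding G_def[abs_def] by (rule S.ray_integrable[OF gH]) (use that a in auto)
  have bi: "(\<lambda>t. k *\<^sub>C (G (- a) j t - G a j t)) integrable_on UNIV"
    and calc: "Hinf0_calc A a (g j) (y j) = integral UNIV (\<lambda>t. k *\<^sub>C (G (- a) j t - G a j t))" for j
  proof -
    have i: "(\<lambda>t. G (- a) j t - G a j t) integrable_on UNIV"
      using a angle by (intro integrable_diff Gi) auto
    show "(\<lambda>t. k *\<^sub>C (G (- a) j t - G a j t)) integrable_on UNIV"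
      using integrable_linear[OF i scaleC.bounded_linear_right] by (simp add: o_def)
    show "Hinf0_calc A a (g j) (y j) = integral UNIV (\<lambda>t. k *\<^sub>C (G (- a) j t - G a j t))"
      using integral_linear[OF i scaleC.bounded_linear_right, of k]
      by (simp add: o_def S.calc_eq G_def k_def)
  qed
  have hI: "(h j has_integral Hinf0_calc A a (g j) (y j)) UNIV" for j
    unfolding calc h_def[abs_def] by (rule has_integral_UNIV_translate[OF bi])
  define q where "q = exp (- (e / 2) * ln 2) ^ nat \<bar>l\<bar>"
  have q: "q = exp (- (e / 2) * (\<bar>of_int l\<bar> * ln 2))"
    unfolding q_def by (simp add: exp_of_nat_mult[symmetric] mult_ac)
  define \<beta> where "\<beta> t = F * (K1 * K2 * (q * decay (e / 2) t))" for t :: real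
  have \<beta>0: "0 \<le> \<beta> t" for t unfolding \<beta>_def q using f(3) K by simp
  have PG: "P (\<lambda>j. G c j (t + - (of_int j * ln 2))) \<le> \<beta> t * (Cr * Y)" if c: "\<bar>c\<bar> = a" for c t
  proof -
    define w where "w j = Complex (t + - (of_int j * ln 2)) c" for j :: int
    have sec: "exp (w j) \<in> sector \<sigma>" for j using c a s0 by (intro exp_in_sector) (auto simp: w_def)
    have off: "exp (w j) \<notin> closure (sector \<theta>)" for j
      using c a angle by (intro exp_notin_closure_sector) (auto simp: w_def)
    have U: "P (\<lambda>j. S.U (y j) (w j)) \<le> Cr * Y"
    proof (rule Ple)
      have "mixed s J (\<lambda>j. S.U (y j) (w j)) \<le> ennreal Cr * mixed s J y"
        unfolding S.U_def by (rule Rs) (rule off)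
      also have "\<dots> \<le> ennreal Cr * ennreal Y" by (intro mult_left_mono Y) simp
      finally show "mixed s J (\<lambda>j. S.U (y j) (w j)) \<le> ennreal (Cr * Y)"
        using Cr Y by (simp add: ennreal_mult)
    qed (use Cr Y in simp)
    have "P (\<lambda>j. g j (exp (w j)) *\<^sub>C S.U (y j) (w j)) \<le> \<beta> t * P (\<lambda>j. S.U (y j) (w j))"
    proof (rule Pscale[OF \<beta>0])
      fix j
      have "cmod (\<phi> (2 powi j * exp (w j))) \<le> K1 * decay e t"
        unfolding w_def powi_exp_line using \<phi>(2)[of "Complex t c"] c a by simp
      moreover have "cmod (\<eta> (2 powi (j + l) * exp (w j))) \<le> K2 * decay e (t + of_int l * ln 2)"
        unfolding w_def powi_exp_line using \<eta>(2)[of "Complex (t + of_int l * ln 2) c"] c a by simp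
      ultimately have "cmod (g j (exp (w j))) \<le> F * ((K1 * decay e t) * (K2 * decay e (t + of_int l * ln 2)))"
        unfolding g_def norm_mult using f(3) K by (intro mult_mono f sec) auto
      also have "\<dots> = F * (K1 * K2 * exp (- e * (\<bar>t\<bar> + \<bar>t + of_int l * ln 2\<bar>)))"
        by (simp add: exp_add[symmetric] algebra_simps)
      also have "\<dots> \<le> \<beta> t"
      proof -
        \<comment> \<open>Of the joint decay in \<open>t\<close> and \<open>t + l * ln 2\<close>,
          one half is kept for the integration over \<open>t\<close> and one for the summation over
          \<open>l\<close>; hence the rate \<open>e / 2\<close>.\<close>
        have "\<bar>x\<bar> + \<bar>t\<bar> \<le> 2 * (\<bar>t\<bar> + \<bar>t + x\<bar>)" for x :: real
          by (smt (verit))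
        from this[of "of_int l * ln 2"]
        have "\<bar>of_int l\<bar> * ln 2 + \<bar>t\<bar> \<le> 2 * (\<bar>t\<bar> + \<bar>t + of_int l * ln 2\<bar>)" by (simp add: abs_mult)
        then have "(e / 2) * (\<bar>of_int l\<bar> * ln 2 + \<bar>t\<bar>) \<le> (e / 2) * (2 * (\<bar>t\<bar> + \<bar>t + of_int l * ln 2\<bar>))"
          using K by (intro mult_left_mono) auto
        then have "exp (- e * (\<bar>t\<bar> + \<bar>t + of_int l * ln 2\<bar>)) \<le> exp (- (e / 2) * (\<bar>of_int l\<bar> * ln 2) + - (e / 2) * \<bar>t\<bar>)"
          by (simp add: algebra_simps)
        then have "exp (- e * (\<bar>t\<bar> + \<bar>t + of_int l * ln 2\<bar>)) \<le> q * decay (e / 2) t"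
          unfolding q exp_add .
        then show ?thesis unfolding \<beta>_def using K f(3) by (intro mult_left_mono) auto
      qed
      finally show "cmod (g j (exp (w j))) \<le> \<beta> t" .
    qed
    also have "\<dots> \<le> \<beta> t * (Cr * Y)" by (intro mult_left_mono U \<beta>0)
    finally show ?thesis by (simp add: G_def w_def)
  qed
  have Ph: "P (\<lambda>j. h j t) \<le> 1 / pi * (\<beta> t * (Cr * Y))" for t
  proof -
    have aa: "\<bar>a\<bar> = a" "\<bar>- a\<bar> = a" using a angle by auto
    have "P (\<lambda>j. h j t) = P (\<lambda>j. k *\<^sub>C G (- a) j (t + - (of_int j * ln 2)) + (- k) *\<^sub>C G a j (t + - (of_int j * ln 2)))"
      unfolding h_def by (simp add: scaleC.diff_right scaleC.minus_left)
    also have "\<dots> \<le> P (\<lambda>j. k *\<^sub>C G (- a) j (t + - (of_int j * ln 2))) + P (\<lambda>j. (- k) *\<^sub>C G a j (t + - (of_int j * ln 2)))"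
      by (rule Padd)
    also have "\<dots> \<le> 1 / (2 * pi) * P (\<lambda>j. G (- a) j (t + - (of_int j * ln 2))) + 1 / (2 * pi) * P (\<lambda>j. G a j (t + - (of_int j * ln 2)))"
      by (intro add_mono Pscale) (auto simp: kn)
    also have "\<dots> \<le> 1 / (2 * pi) * (\<beta> t * (Cr * Y)) + 1 / (2 * pi) * (\<beta> t * (Cr * Y))"
      by (intro add_mono mult_left_mono PG aa) auto
    finally show ?thesis by (simp add: field_simps)
  qed
  define I where "I = integral UNIV (\<lambda>t::real. decay (e / 2) t)"
  have ei: "(\<lambda>t::real. decay (e / 2) t) integrable_on UNIV"
    using K by (intro exp_decay_integrable) simp
  have b: "1 / pi * (\<beta> t * (Cr * Y)) = (K1 * K2 * Cr / pi * F * q * Y) * decay (e / 2) t" for t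
    by (simp add: \<beta>_def)
  have "P (\<lambda>j. integral UNIV (h j)) \<le> integral UNIV (\<lambda>t. 1 / pi * (\<beta> t * (Cr * Y)))"
  proof (rule seminorm_integral_le[where P = P and h = h and J = J])
    show "finite J" by (rule J)
    show "P (\<lambda>j. x j + y j) \<le> P x + P y" for x y by (rule Padd)
    show "P (\<lambda>j. h j t) \<le> 1 / pi * (\<beta> t * (Cr * Y))" for t by (rule Ph)
    show "h j integrable_on UNIV" for j using hI by blast
    show "(\<lambda>t. 1 / pi * (\<beta> t * (Cr * Y))) integrable_on UNIV"
      unfolding b by (intro integrable_on_mult_right ei)
    show "0 \<le> 1 / pi * (\<beta> t * (Cr * Y))" for t using \<beta>0 Cr Y by simp
    show "P (\<lambda>j. r *\<^sub>R x j) \<le> r * P x" if "0 \<le> r" for r x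
      using Pscale[of r "\<lambda>_. of_real r" x] that by (simp add: scaleC_of_real)
    show "P x \<le> (\<Sum>j\<in>J. norm (x j))" for x
      using mixed_norm_le_sum[OF J s, of x] by (intro Ple) (auto simp: sum_ennreal sum_nonneg)
  qed
  also have "\<dots> = K1 * K2 * Cr / pi * I * F * q * Y"
    unfolding b integral_mult_right I_def by (simp add: mult_ac)
  finally have "P (\<lambda>j. Hinf0_calc A a (g j) (y j)) \<le> K1 * K2 * Cr / pi * I * F * q * Y"
    unfolding integral_unique[OF hI] .
  then have "ennreal (P (\<lambda>j. Hinf0_calc A a (g j) (y j))) \<le> ennreal (K1 * K2 * Cr / pi * I * F * q * Y)"
    by (rule ennreal_leI)
  then show ?thesis unfolding EP[symmetric] g_def I_def q_def .
qed

lemma square_function_bound: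
  assumes S: "sectorial_operator A \<theta> C L" and s: "1 \<le> s"
    and Cr: "0 \<le> Cr" and Rs: "\<And>(J :: int set) z x. finite J \<Longrightarrow> (\<And>j. j \<in> J \<Longrightarrow> z j \<notin> closure (sector \<theta>)) \<Longrightarrow>
      mixed s J (\<lambda>j. z j *\<^sub>C resolvent (z j) A (x j)) \<le> ennreal Cr * mixed s J x"
    and a: "\<theta> < a" "a < \<sigma>" "\<sigma> \<le> pi"
    and \<phi>: "\<phi> \<in> Hinf0 \<sigma>" and \<psi>: "\<psi> \<in> Hinf0 \<sigma>" and \<eta>: "\<eta> \<in> Hinf0 \<sigma>"
    and E: "\<And>n z. z \<in> sector \<sigma> \<Longrightarrow> cmod (\<Sum>k\<in>{- int n..int n}. \<eta> (2 powi k * z) * \<psi> (2 powi k * z)) \<le> B"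
      "\<And>z. z \<in> sector \<sigma> \<Longrightarrow> (\<lambda>n. \<Sum>k\<in>{- int n..int n}. \<eta> (2 powi k * z) * \<psi> (2 powi k * z)) \<longlonglongrightarrow> 1"
  shows "\<exists>K>0. \<forall>f F x. f holomorphic_on sector \<sigma> \<longrightarrow> (\<forall>z\<in>sector \<sigma>. cmod (f z) \<le> F) \<longrightarrow>
    mixed s UNIV (\<lambda>j::int. Hinf0_calc A a (\<lambda>z. f z * \<phi> (2 powi j * z)) x)
    \<le> ennreal (K * F) * mixed s UNIV (\<lambda>j::int. Hinf0_calc A a (\<lambda>z. \<psi> (2 powi j * z)) x)"
proof -
  interpret S: sectorial_operator A \<theta> C L by (rule S)
  note angle = S.angle
  have s0: "0 < \<sigma>" using a angle by linarith
  obtain K1 e1 where e1: "0 < e1" "0 \<le> K1"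
    and K1: "\<And>w. \<bar>Im w\<bar> < \<sigma> \<Longrightarrow> cmod (\<phi> (exp w)) \<le> K1 * decay e1 (Re w)"
    using Hinf0_decay[OF \<phi> s0 a(3)] by metis
  obtain K2 e2 where e2: "0 < e2" "0 \<le> K2"
    and K2: "\<And>w. \<bar>Im w\<bar> < \<sigma> \<Longrightarrow> cmod (\<eta> (exp w)) \<le> K2 * decay e2 (Re w)"
    using Hinf0_decay[OF \<eta> s0 a(3)] by metis
  define e where "e = min e1 e2"
  have e: "0 < e" "e \<le> e1" "e \<le> e2" using e1 e2 by (auto simp: e_def)
  have K1': "cmod (\<phi> (exp w)) \<le> K1 * decay e (Re w)" if "\<bar>Im w\<bar> < \<sigma>" for w
    by (rule order_trans[OF K1[OF that]]) (use e e1 in \<open>auto intro!: mult_left_mono mult_right_mono\<close>)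
  have K2': "cmod (\<eta> (exp w)) \<le> K2 * decay e (Re w)" if "\<bar>Im w\<bar> < \<sigma>" for w
    by (rule order_trans[OF K2[OF that]]) (use e e2 in \<open>auto intro!: mult_left_mono mult_right_mono\<close>)
  define q where "q = exp (- (e / 2) * ln 2)"
  have q: "0 < q" "q < 1" using e by (auto simp: q_def)
  define K0 where "K0 = K1 * K2 * Cr / pi * integral UNIV (\<lambda>t::real. decay (e / 2) t)"
  have K0: "0 \<le> K0"
    unfolding K0_def using e1 e2 e Cr by (intro mult_nonneg_nonneg divide_nonneg_pos integral_nonneg exp_decay_integrable) auto
  \<comment> \<open>The geometric series in \<open>\<bar>l\<bar>\<close> counts both signs, hence
    the factor 2; adding 1 makes \<open>K\<close> positive.\<close>
  define K where "K = K0 * (2 * (1 / (1 - q))) + 1"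
  have K: "0 < K" unfolding K_def using K0 q by (intro add_nonneg_pos mult_nonneg_nonneg) auto
  show ?thesis
  proof (intro exI[of _ K] conjI K allI impI)
    fix f F and x :: 'x assume fh: "f holomorphic_on sector \<sigma>" and fF: "\<forall>z\<in>sector \<sigma>. cmod (f z) \<le> F"
    have one: "1 \<in> sector \<sigma>" using exp_in_sector[OF s0 a(3), of 0] s0 by simp
    have F0: "0 \<le> F" using fF one norm_ge_zero order_trans by blast
    define y where "y k = Hinf0_calc A a (\<lambda>z. \<psi> (2 powi k * z)) x" for k :: int
    define z where "z j = Hinf0_calc A a (\<lambda>z. f z * \<phi> (2 powi j * z)) x" for j :: int
    \<comment> \<open>Treated separately, because for \<open>F = 0\<close> the right-hand side is 0
      even if the norm for \<open>\<psi>\<close> is infinite.\<close>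
    have zero: "mixed s UNIV z \<le> 0" if "F = 0"
    proof (rule mixed_norm_UNIV_le[OF s])
      fix n
      have "z j = 0" for j
      proof -
        have "z j = Hinf0_calc A a (\<lambda>_. 0) x"
          unfolding z_def by (rule S.calc_cong[OF _ a]) (use fF that in auto)
        then show ?thesis by (simp add: S.calc_zero)
      qed
      then show "mixed s {- int n..int n} z \<le> 0"
        using mixed_norm_le_sum[OF _ s, of "{- int n..int n}" z] by simp
    qed
    have fin: "mixed s UNIV z \<le> ennreal (K * F * Y)" if Y: "mixed s UNIV y = ennreal Y" "0 \<le> Y" for Y
    proof (rule mixed_norm_UNIV_le[OF s])
      fix n
      define J where "J = {- int n..int n}"
      have J: "finite J" by (simp add: J_def)
      define E where "E N w = (\<Sum>k\<in>{- int N..int N}. \<eta> (2 powi k * w) * \<psi> (2 powi k * w))" for N w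
      have Eh: "E N holomorphic_on sector \<sigma>" for N
      proof -
        have "(\<lambda>z. \<eta> (2 powi k * z)) holomorphic_on sector \<sigma>" "(\<lambda>z. \<psi> (2 powi k * z)) holomorphic_on sector \<sigma>" for k
          using Hinf0_powi[OF \<eta> s0 a(3), of k] Hinf0_powi[OF \<psi> s0 a(3), of k] by (simp_all add: Hinf0_def)
        then show ?thesis unfolding E_def[abs_def] by (intro holomorphic_intros)
      qed
      have fp: "(\<lambda>w. f w * \<phi> (2 powi j * w)) \<in> Hinf0 \<sigma>" for j
        by (rule Hinf0_mult_bounded[OF Hinf0_powi[OF \<phi> s0 a(3)] fh]) (use fF in auto)
      define g where "g j k = (\<lambda>w. f w * (\<phi> (2 powi j * w) * \<eta> (2 powi k * w)))" for j k :: int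
      have gH: "g j k \<in> Hinf0 \<sigma>" for j k
        unfolding g_def
        by (rule Hinf0_mult_bounded[OF Hinf0_mult[OF Hinf0_powi[OF \<eta> s0 a(3)] Hinf0_powi[OF \<phi> s0 a(3)] s0 a(3)] fh])
          (use fF in auto)
      \<comment> \<open>The partial sums of the reproducing formula. By multiplicativity they are
        also the calculus of \<open>E N\<close> times \<open>f \<phi>(2^j w)\<close> at
        \<open>x\<close>, and in this form they are seen to converge to \<open>z j\<close>.\<close>
      define zN where "zN N j = (\<Sum>k\<in>{- int N..int N}. Hinf0_calc A a (g j k) (y k))" for N j
      have zN: "zN N j = Hinf0_calc A a (\<lambda>w. E N w * (f w * \<phi> (2 powi j * w))) x" for N j
      proof -
        have "zN N j = (\<Sum>k\<in>{- int N..int N}. Hinf0_calc A a (\<lambda>w. g j k w * \<psi> (2 powi k * w)) x)"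
          unfolding zN_def y_def by (intro sum.cong refl S.calc_mult[OF gH _ a] Hinf0_powi \<psi> s0 a)
        also have "\<dots> = Hinf0_calc A a (\<lambda>w. \<Sum>k\<in>{- int N..int N}. g j k w * \<psi> (2 powi k * w)) x"
          by (intro S.calc_sum[symmetric, OF _ _ a] Hinf0_mult Hinf0_powi \<psi> gH s0 a) simp
        also have "\<dots> = Hinf0_calc A a (\<lambda>w. E N w * (f w * \<phi> (2 powi j * w))) x"
          by (rule S.calc_cong[OF _ a]) (simp add: E_def g_def sum_distrib_right sum_distrib_left mult_ac)
        finally show ?thesis .
      qed
      have lim: "(\<lambda>N. zN N j) \<longlonglongrightarrow> z j" for j
        unfolding zN z_def by (rule S.calc_tendsto[OF fp a Eh]) (use E in \<open>auto simp: E_def\<close>)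
      have bound: "mixed s J (zN N) \<le> ennreal (K * F * Y)" for N
      proof -
        \<comment> \<open>For \<open>\<bar>j\<bar> \<le> n\<close> and
          \<open>\<bar>k\<bar> \<le> N\<close> the offset \<open>k - j\<close> is at most
          \<open>N + n\<close> in modulus.\<close>
        define m where "m = N + n"
        \<comment> \<open>Along a fixed offset, entries whose index \<open>j + l\<close> leaves the
          truncated range are replaced by 0. The family is then defined for all \<open>j\<close> in
          \<open>J\<close> and still has norm at most \<open>Y\<close>.\<close>
        define y' where "y' l j = (if j + l \<in> {- int N..int N} then y (j + l) else 0)" for l j
        have y': "mixed s J (y' l) \<le> ennreal Y" for l
        proof -
          have "y' l = (\<lambda>j. (if j + l \<in> {- int N..int N} then 1 else 0) *\<^sub>C y (j + l))"
            by (auto simp: y'_def scaleC.zero_left)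
          then have "mixed s J (y' l) \<le> ennreal 1 * mixed s J (\<lambda>j. y (j + l))"
            using mixed_norm_scale[OF J s, of 1 "\<lambda>j. if j + l \<in> {- int N..int N} then 1 else 0" "\<lambda>j. y (j + l)"] by simp
          also have "\<dots> \<le> mixed s UNIV y" using mixed_norm_shift_le[OF J s, of y l] by simp
          finally show ?thesis using Y by simp
        qed
        have each: "mixed s J (\<lambda>j. Hinf0_calc A a (g j (j + l)) (y' l j)) \<le> ennreal (K0 * F * q ^ nat \<bar>l\<bar> * Y)" for l
          unfolding g_def K0_def q_def
          by (rule diagonal_calc_bound[OF S s Cr Rs[OF J] a \<phi> K1' \<eta> K2' e(1) e1(2) e2(2) fh _ F0 J y' Y(2)])
            (use fF in auto)
        have eq: "zN N j = (\<Sum>l\<in>{- int m..int m}. Hinf0_calc A a (g j (j + l)) (y' l j))" if j: "j \<in> J" for j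
        proof -
          define G where "G k = Hinf0_calc A a (g j k) (if k \<in> {- int N..int N} then y k else 0)" for k
          have "(\<Sum>l\<in>{- int m..int m}. Hinf0_calc A a (g j (j + l)) (y' l j)) = (\<Sum>l\<in>{- int m..int m}. G (j + l))"
            by (simp add: G_def y'_def)
          also have "\<dots> = (\<Sum>k\<in>{j - int m..j + int m}. G k)"
            by (rule sum.reindex_bij_witness[where i = "\<lambda>k. k - j" and j = "\<lambda>l. j + l"]) auto
          also have "\<dots> = (\<Sum>k\<in>{- int N..int N}. G k)"
            using j by (intro sum.mono_neutral_right) (auto simp: G_def J_def m_def S.calc_zero_right[OF gH a])
          also have "\<dots> = zN N j" unfolding zN_def by (intro sum.cong) (auto simp: G_def)
          finally show ?thesis by simp
        qed
        have sub: "mixed s J (\<lambda>j. \<Sum>l\<in>D. v l j) \<le> (\<Sum>l\<in>D. mixed s J (v l))"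
          if "finite D" for D :: "int set" and v :: "int \<Rightarrow> int \<Rightarrow> 'x"
          using that
        proof induction
          case empty
          then show ?case using mixed_norm_le_sum[OF J s, of "\<lambda>_. 0"] by simp
        next
          case (insert u D)
          then show ?case using mixed_norm_add[OF J s, of "v u" "\<lambda>j. \<Sum>l\<in>D. v l j"]
            by (simp add: order_trans[OF _ add_left_mono])
        qed
        have "mixed s J (zN N) = mixed s J (\<lambda>j. \<Sum>l\<in>{- int m..int m}. Hinf0_calc A a (g j (j + l)) (y' l j))"
        proof -
          have "ls_norm s J (\<lambda>j. rep (zN N j) \<xi>) = ls_norm s J (\<lambda>j. rep (\<Sum>l\<in>{- int m..int m}. Hinf0_calc A a (g j (j + l)) (y' l j)) \<xi>)" for \<xi>
            by (rule ls_norm_cong) (simp add: eq)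
          then show ?thesis unfolding mixed_norm_def by simp
        qed
        also have "\<dots> \<le> (\<Sum>l\<in>{- int m..int m}. mixed s J (\<lambda>j. Hinf0_calc A a (g j (j + l)) (y' l j)))"
          by (rule sub) simp
        also have "\<dots> \<le> (\<Sum>l\<in>{- int m..int m}. ennreal (K0 * F * q ^ nat \<bar>l\<bar> * Y))"
          by (intro sum_mono each)
        also have "\<dots> = ennreal (\<Sum>l\<in>{- int m..int m}. K0 * F * q ^ nat \<bar>l\<bar> * Y)"
          using K0 F0 Y q by (intro sum_ennreal) simp
        also have "\<dots> \<le> ennreal (K * F * Y)"
        proof (rule ennreal_leI)
          have "(\<Sum>l\<in>{- int m..int m}. K0 * F * q ^ nat \<bar>l\<bar> * Y) = K0 * F * Y * (\<Sum>l\<in>{- int m..int m}. q ^ nat \<bar>l\<bar>)"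
            by (simp add: sum_distrib_left mult_ac)
          also have "\<dots> \<le> K0 * F * Y * (2 * (1 / (1 - q)))"
          proof (rule mult_left_mono)
            have "(\<Sum>l\<in>{- int m..int m}. q ^ nat \<bar>l\<bar>) \<le> 2 * (\<Sum>i\<le>m. q ^ i)"
              using q by (intro sum_int_abs_le) simp
            also have "(\<Sum>i\<le>m. q ^ i) \<le> 1 / (1 - q)" using q by (intro sum_power_le) auto
            finally show "(\<Sum>l\<in>{- int m..int m}. q ^ nat \<bar>l\<bar>) \<le> 2 * (1 / (1 - q))" by simp
          qed (use K0 F0 Y in simp)
          also have "\<dots> = (K - 1) * (F * Y)" by (simp add: K_def)
          also have "\<dots> \<le> K * (F * Y)" using F0 Y by (intro mult_right_mono) auto
          finally show "(\<Sum>l\<in>{- int m..int m}. K0 * F * q ^ nat \<bar>l\<bar> * Y) \<le> K * F * Y" by (simp add: mult.assoc)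
        qed
        finally show ?thesis .
      qed
      \<comment> \<open>The error is measured by the sum of the norms over the finite set
        \<open>J\<close>, so convergence of each entry in the space suffices to let \<open>N\<close>
        tend to infinity.\<close>
      have "(\<lambda>N. ennreal (K * F * Y) + ennreal (\<Sum>j\<in>J. norm (z j - zN N j))) \<longlonglongrightarrow> ennreal (K * F * Y) + ennreal (\<Sum>j\<in>J. norm (z j - z j))"
        by (intro tendsto_add tendsto_const tendsto_ennrealI tendsto_sum tendsto_norm tendsto_diff lim)
      then have "(\<lambda>N. ennreal (K * F * Y) + ennreal (\<Sum>j\<in>J. norm (z j - zN N j))) \<longlonglongrightarrow> ennreal (K * F * Y)" by simp
      moreover have "mixed s J z \<le> ennreal (K * F * Y) + ennreal (\<Sum>j\<in>J. norm (z j - zN N j))" for N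
      proof -
        have "mixed s J (\<lambda>j. zN N j + (z j - zN N j)) \<le> mixed s J (zN N) + mixed s J (\<lambda>j. z j - zN N j)"
          by (rule mixed_norm_add[OF J s])
        also have "\<dots> \<le> ennreal (K * F * Y) + (\<Sum>j\<in>J. ennreal (norm (z j - zN N j)))"
          by (intro add_mono bound mixed_norm_le_sum J s)
        finally show ?thesis by (simp add: sum_ennreal)
      qed
      ultimately show "mixed s {- int n..int n} z \<le> ennreal (K * F * Y)"
        unfolding J_def[symmetric] by (intro LIMSEQ_le_const) auto
    qed
    have "mixed s UNIV z \<le> ennreal (K * F) * mixed s UNIV y"
    proof (cases "F = 0")
      case True
      then show ?thesis using zero by simp
    next
      case False
      then have KF: "0 < K * F" using K F0 by simp
      show ?thesis
      proof (cases "mixed s UNIV y")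
        case (real Y)
        then show ?thesis using fin[of Y] KF by (simp add: ennreal_mult)
      next
        \<comment> \<open>Here \<open>F\<close> is positive, so the right-hand side is
          infinite.\<close>
        case top
        have "ennreal (K * F) \<noteq> 0" using KF by (metis ennreal_eq_0_iff not_le)
        then show ?thesis unfolding top by (simp only: ennreal_mult_top top_greatest if_False)
      qed
    qed
    then show "mixed s UNIV (\<lambda>j::int. Hinf0_calc A a (\<lambda>z. f z * \<phi> (2 powi j * z)) x)
      \<le> ennreal (K * F) * mixed s UNIV (\<lambda>j::int. Hinf0_calc A a (\<lambda>z. \<psi> (2 powi j * z)) x)"
      unfolding z_def y_def .
  qed
qed

end

theorem proposition3p15:
  fixes M :: "'a measure" and \<Omega> :: "nat \<Rightarrow> 'a set" and \<rho> :: "('a \<Rightarrow> ennreal) \<Rightarrow> ennreal"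
    and rep :: "'x::complex_banach \<Rightarrow> 'a \<Rightarrow> complex"
    and s :: ennreal and A :: "('x \<times> 'x) set" and \<sigma> \<omega> :: real and \<phi> \<psi> :: "complex \<Rightarrow> complex"
  assumes "complex_banach_function_space M \<Omega> \<rho> rep"
    and "absolutely_continuous_norm M \<rho> rep"
    and "1 \<le> s"
    and "Rs_sectorial \<rho> rep s A"
    and "injective_operator A"
    and "closure (Domain A) = UNIV" and "closure (Range A) = UNIV"
    and "Rs_angle \<rho> rep s A < \<sigma>" and "\<sigma> \<le> pi"
    and "\<phi> \<in> Phi_class \<sigma>" and "\<psi> \<in> Phi_class \<sigma>"
    and "Rs_angle \<rho> rep s A < \<omega>" and "\<omega> < \<sigma>"
  shows "\<exists>C>0. \<forall>f\<in>Hinf \<sigma>. \<forall>x::'x.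
     mixed_norm \<rho> rep s (UNIV :: int set)
       (\<lambda>j. op_apply (Hinf_calc A \<omega> f) (Hinf0_calc A \<omega> (\<lambda>z. \<phi> (2 powi j * z)) x))
     \<le> ennreal (C * Hinf_norm \<sigma> f) *
        mixed_norm \<rho> rep s (UNIV :: int set)
          (\<lambda>j. Hinf0_calc A \<omega> (\<lambda>z. \<psi> (2 powi j * z)) x)"
proof -
  interpret X: complex_banach_function_space M \<Omega> \<rho> rep by fact
  note s = \<open>1 \<le> s\<close>
  \<comment> \<open>The infimum need not be attained; some admissible angle below
    \<open>\<omega>\<close> is enough.\<close>
  obtain \<omega>0 where \<omega>0: "Rs_sectorial_of_angle \<rho> rep s A \<omega>0" "\<omega>0 < \<omega>"
  proof -
    have "{\<omega>. Rs_sectorial_of_angle \<rho> rep s A \<omega>} \<noteq> {}" using assms(4) by (auto simp: Rs_sectorial_def)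
    from cInf_lessD[OF this assms(12)[unfolded Rs_angle_def]] show ?thesis using that by auto
  qed
  have \<omega>: "0 \<le> \<omega>0" "\<omega> < pi" using \<omega>0 assms(9,13) by (auto simp: Rs_sectorial_of_angle_def)
  \<comment> \<open>The resolvent bounds hold for every angle above \<open>\<omega>0\<close>; this
    choice leaves room between the sector on which they are used and the contour of angle
    \<open>\<omega>\<close>.\<close>
  define \<theta> where "\<theta> = (\<omega>0 + \<omega>) / 2"
  have \<theta>: "\<omega>0 < \<theta>" "\<theta> < \<omega>" "0 < \<theta>" "\<theta> < pi" using \<omega> \<omega>0(2) by (auto simp: \<theta>_def)
  define \<tau> where "\<tau> = (\<omega> + \<sigma>) / 2"
  have \<tau>: "\<omega> < \<tau>" "\<tau> < \<sigma>" "\<tau> < pi" "0 < \<tau>" using assms(9,13) \<theta> by (auto simp: \<tau>_def)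
  have \<sigma>: "0 < \<sigma>" using \<tau> by linarith
  let ?\<T> = "(\<lambda>z x. z *\<^sub>C resolvent z A x) ` (- closure (sector \<theta>))"
  have RsT: "Rs_bounded \<rho> rep s ?\<T>" using \<omega>0(1) \<theta> by (auto simp: Rs_sectorial_of_angle_def)
  from X.Rs_bounded_finite[OF RsT s]
  obtain Cr where Cr: "0 < Cr" "\<forall>(J :: int set) T x. finite J \<longrightarrow> (\<forall>j\<in>J. T j \<in> ?\<T>) \<longrightarrow>
    mixed_norm \<rho> rep s J (\<lambda>j. T j (x j)) \<le> ennreal Cr * mixed_norm \<rho> rep s J x"
    by (elim exE conjE) (rule that)
  have S: "sectorial_operator A \<theta> Cr X.local_functionals"
  proof
    show "linear_operator A" using assms(4) by (simp add: Rs_sectorial_def)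
    show "z \<notin> op_spectrum A" if "z \<notin> closure (sector \<theta>)" for z
    proof -
      have "closure (sector \<omega>0) \<subseteq> closure (sector \<theta>)" using \<omega> \<theta> by (intro closure_mono sector_mono) auto
      then show ?thesis using that \<omega>0(1) by (auto simp: Rs_sectorial_of_angle_def)
    qed
    show "norm (z *\<^sub>C resolvent z A x) \<le> Cr * norm x" if "z \<notin> closure (sector \<theta>)" for z x
    proof -
      \<comment> \<open>A family with a single index turns \<open>R_s\<close>-boundedness into a
        uniform norm bound with the same constant.\<close>
      have "ennreal (norm (z *\<^sub>C resolvent z A x)) \<le> ennreal Cr * ennreal (norm x)"
        using Cr(2)[rule_format, of "{0}" "\<lambda>_ x. z *\<^sub>C resolvent z A x" "\<lambda>_. x"] that
        by (auto simp: X.mixed_norm_singleton[OF s])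
      then show ?thesis using Cr(1) by (simp add: ennreal_mult'[symmetric])
    qed
  qed (use \<theta> X.local_functionals_clinear X.local_functionals_separating in auto)
  interpret S: sectorial_operator A \<theta> Cr X.local_functionals by (rule S)
  have Rs: "mixed_norm \<rho> rep s J (\<lambda>j. z j *\<^sub>C resolvent (z j) A (x j)) \<le> ennreal Cr * mixed_norm \<rho> rep s J x"
    if "finite J" "\<And>j. j \<in> J \<Longrightarrow> z j \<notin> closure (sector \<theta>)" for J :: "int set" and z x
    using Cr(2)[rule_format, OF that(1), of "\<lambda>j x. z j *\<^sub>C resolvent (z j) A x" x] that(2) by auto
  have mono: "Hinf0 \<sigma> \<subseteq> Hinf0 \<tau>" "sector \<tau> \<subseteq> sector \<sigma>"
    using \<tau> by (intro Hinf0_mono sector_mono; simp)+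
  have "Phi_class \<sigma> \<subseteq> Hinf0 \<sigma>" unfolding Phi_class_def by (rule Collect_restrict)
  then have \<phi>: "\<phi> \<in> Hinf0 \<tau>" and \<psi>: "\<psi> \<in> Hinf0 \<tau>" using assms(10,11) mono(1) by blast+
  from Phi_class_reproducing[OF assms(11) \<sigma> assms(9)]
  obtain \<eta> B where \<eta>: "\<eta> \<in> Hinf0 \<sigma>"
    and E: "\<forall>z\<in>sector \<sigma>. (\<forall>n. cmod (\<Sum>k\<in>{- int n..int n}. \<eta> (2 powi k * z) * \<psi> (2 powi k * z)) \<le> B) \<and>
      (\<lambda>n. \<Sum>k\<in>{- int n..int n}. \<eta> (2 powi k * z) * \<psi> (2 powi k * z)) \<longlonglongrightarrow> 1"
    by (elim bexE exE) (rule that)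
  have \<eta>': "\<eta> \<in> Hinf0 \<tau>" using \<eta> mono(1) by blast
  have Cr0: "0 \<le> Cr" using Cr(1) by simp
  have E': "cmod (\<Sum>k\<in>{- int n..int n}. \<eta> (2 powi k * z) * \<psi> (2 powi k * z)) \<le> B"
    "(\<lambda>n. \<Sum>k\<in>{- int n..int n}. \<eta> (2 powi k * z) * \<psi> (2 powi k * z)) \<longlonglongrightarrow> 1"
    if "z \<in> sector \<tau>" for n z
    using E[rule_format, OF subsetD[OF mono(2) that]] by simp_all
  have "\<exists>K>0. \<forall>f F x. f holomorphic_on sector \<tau> \<longrightarrow> (\<forall>z\<in>sector \<tau>. cmod (f z) \<le> F) \<longrightarrow>
      mixed_norm \<rho> rep s UNIV (\<lambda>j::int. Hinf0_calc A \<omega> (\<lambda>z. f z * \<phi> (2 powi j * z)) x)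
      \<le> ennreal (K * F) * mixed_norm \<rho> rep s UNIV (\<lambda>j::int. Hinf0_calc A \<omega> (\<lambda>z. \<psi> (2 powi j * z)) x)"
    by (rule X.square_function_bound[OF S s Cr0 Rs \<theta>(2) \<tau>(1) less_imp_le[OF \<tau>(3)] \<phi> \<psi> \<eta>' E']) blast+
  then obtain K where K: "0 < K"
    "\<forall>f F x. f holomorphic_on sector \<tau> \<longrightarrow> (\<forall>z\<in>sector \<tau>. cmod (f z) \<le> F) \<longrightarrow>
      mixed_norm \<rho> rep s UNIV (\<lambda>j::int. Hinf0_calc A \<omega> (\<lambda>z. f z * \<phi> (2 powi j * z)) x)
      \<le> ennreal (K * F) * mixed_norm \<rho> rep s UNIV (\<lambda>j::int. Hinf0_calc A \<omega> (\<lambda>z. \<psi> (2 powi j * z)) x)"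
    by (elim exE conjE) (rule that)
  show ?thesis
  proof (intro exI[of _ K] conjI K(1) ballI allI)
    fix f and x :: 'x assume f: "f \<in> Hinf \<sigma>"
    have "bdd_above ((\<lambda>z. cmod (f z)) ` sector \<sigma>)"
      using f unfolding Hinf_def bounded_iff bdd_above_def by auto
    then have fb: "cmod (f z) \<le> Hinf_norm \<sigma> f" if "z \<in> sector \<tau>" for z
      unfolding Hinf_norm_def using that mono(2) by (intro cSUP_upper) auto
    have fh: "f holomorphic_on sector \<tau>" using f mono(2) holomorphic_on_subset by (auto simp: Hinf_def)
    have "op_apply (Hinf_calc A \<omega> f) (Hinf0_calc A \<omega> (\<lambda>z. \<phi> (2 powi j * z)) x)
      = Hinf0_calc A \<omega> (\<lambda>z. f z * \<phi> (2 powi j * z)) x" for j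
      by (rule S.Hinf_calc_apply[OF \<theta>(2) \<tau>(1,3) assms(5) fh fb Hinf0_powi[OF \<phi> \<tau>(4) less_imp_le[OF \<tau>(3)]]])
    then show "mixed_norm \<rho> rep s (UNIV :: int set)
       (\<lambda>j. op_apply (Hinf_calc A \<omega> f) (Hinf0_calc A \<omega> (\<lambda>z. \<phi> (2 powi j * z)) x))
     \<le> ennreal (K * Hinf_norm \<sigma> f) *
        mixed_norm \<rho> rep s (UNIV :: int set)
          (\<lambda>j. Hinf0_calc A \<omega> (\<lambda>z. \<psi> (2 powi j * z)) x)"
      using K(2)[rule_format, OF fh fb, of x] by simp
  qed
qed

end
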